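(* Let $\mathbf{B}$ be the Burnside bicategory of groupoids, $\mathbf{G}$ the 2-category of groupoids, functors and natural transformations, and $\mathbf{G}_{fc}$ its sub-bicategory with all groupoids as objects and with $\mathbf{G}_{fc}(H,G)$ the groupoid of finite covers $H\to G$ and natural transformations between them. There are pseudo-functors $$S:\mathbf{G}\to\mathbf{B},\qquad T:\mathbf{G}_{fc}^{\mathrm{op}}\to\mathbf{B},$$ each the identity on objects, given as follows. For a functor $p:H\to G$, $S(p)\in\mathbf{B}(H,G)$ is the bi-set $S(p)^\eta_\gamma=G(p\eta,\gamma)$; for a finite cover $p:H\to G$, $T(p)\in\mathbf{B}(G,H)$ is the bi-set $T(p)^\gamma_\eta=G(\gamma,p\eta)$. For a natural transformation $\alpha:p'\to p$, $S(\alpha)$ is given by $(\alpha_\eta^{-1})^*:G(p'\eta,\gamma)\to G(p\eta,\gamma)$ and $T(\alpha)$ by $(\alpha_\eta)_*:G(\gamma,p'\eta)\to G(\gamma,p\eta)$. For $K\xrightarrow{q}H\xrightarrow{p}G$, the composition comparisons are the canonical isomorphisms $$S(p)_\gamma\otimes_HS(q)^\kappa\xrightarrow{\cong}S(p\circ q)^\kappa_\gamma,\qquad T(q)_\kappa\otimes_HT(p)^\gamma\xrightarrow{\cong}T(p\circ q)^\gamma_\kappa,$$ given respectively by $[g,h]\mapsto g\circ p(h)$ for $g:p\eta\to\gamma$, $h:q\kappa\to\eta$, and $[h,g]\mapsto p(h)\circ g$ for $h:\eta\to q\kappa$, $g:\gamma\to p\eta$.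
   Context: All groupoids are small; $G_0$ is the object set of $G$; $(-)^{\mathrm{op}}$ on a bicategory reverses 1-cells only. A (left) $G$-set is a functor $X:G\to\mathbf{Set}$, with values $X_\gamma$ and action $x\mapsto gx$; a right $G$-set is a functor $Y:G^{\mathrm{op}}\to\mathbf{Set}$, with values $Y^\gamma$ and action $y\mapsto yg$. A $G$-set $X$ is free if for all $\gamma,\gamma'\in G_0$ and $x\in X_{\gamma'}$ the map $G(\gamma',\gamma)\to X_\gamma$, $g\mapsto gx$, is injective; it is finitely generated if $\mathrm{colim}_GX$ is finite. An $(H,G)$-bi-set is a functor $X:H^{\mathrm{op}}\times G\to\mathbf{Set}$, with values $X^\eta_\gamma$; it is admissible if for every $\eta\in H_0$ the $G$-set $X^\eta$ is free and finitely generated. For a right $H$-set $X$ and left $H$-set $Y$, $X\otimes_HY=\coprod_{\eta\in H_0}X^\eta\times Y_\eta/\sim$, with $(xh,y)\sim(x,hy)$; $[x,y]$ is the class of $(x,y)$. The bicategory $\mathbf{B}$: objects are groupoids; $\mathbf{B}(H,G)$ is the groupoid of admissible $(H,G)$-bi-sets and natural isomorphisms; composition $\mathbf{B}(H,G)\times\mathbf{B}(K,H)\to\mathbf{B}(K,G)$ is $(X,Y)\mapsto X\otimes_HY$ with $(X\otimes_HY)^\kappa_\gamma=X_\gamma\otimes_HY^\kappa$; the identity is $(1_G)^{\gamma'}_\gamma=G(\gamma',\gamma)$; unitors and associator are the canonical ones. A functor of groupoids $p:H\to G$ is a cover if for every $\eta'\in H_0$ and $g:p\eta'\to\gamma$ in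 $G$ there is exactly one pair $(\eta,\ h:\eta'\to\eta)$ with $ph=g$; it is a finite cover if in addition $p^{-1}\gamma$ is finite for all $\gamma\in G_0$. *)

theory Defs
  imports "HOL-Library.FuncSet" "HOL-Library.Infinite_Typeclass"
begin

section \<open>Categories, groupoids and functors\<close>

record ('o, 'a) cat =
  Ob  :: "'o set"
  Ar  :: "'a set"
  Src :: "'a \<Rightarrow> 'o"
  Tgt :: "'a \<Rightarrow> 'o"
  Idt :: "'o \<Rightarrow> 'a"
  Cmp :: "'a \<Rightarrow> 'a \<Rightarrow> 'a"  (infixr \<open>\<cdot>\<index>\<close> 70)

definition homset :: "('o, 'a) cat \<Rightarrow> 'o \<Rightarrow> 'o \<Rightarrow> 'a set" where
  "homset C a b = {f \<in> Ar C. Src C f = a \<and> Tgt C f = b}"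

locale category =
  fixes C :: "('o, 'a) cat"
  assumes src_ob: "f \<in> Ar C \<Longrightarrow> Src C f \<in> Ob C"
    and tgt_ob: "f \<in> Ar C \<Longrightarrow> Tgt C f \<in> Ob C"
    and idt_hom: "a \<in> Ob C \<Longrightarrow> Idt C a \<in> homset C a a"
    and cmp_hom: "\<lbrakk>f \<in> homset C a b; g \<in> homset C b c\<rbrakk> \<Longrightarrow> g \<cdot>\<^bsub>C\<^esub> f \<in> homset C a c"
    and cmp_idt_left: "f \<in> homset C a b \<Longrightarrow> Idt C b \<cdot>\<^bsub>C\<^esub> f = f"
    and cmp_idt_right: "f \<in> homset C a b \<Longrightarrow> f \<cdot>\<^bsub>C\<^esub> Idt C a = f"
    and cmp_assoc: "\<lbrakk>f \<in> homset C a b; g \<in> homset C b c; h \<in> homset C c d\<rbrakk>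
      \<Longrightarrow> (h \<cdot>\<^bsub>C\<^esub> g) \<cdot>\<^bsub>C\<^esub> f = h \<cdot>\<^bsub>C\<^esub> (g \<cdot>\<^bsub>C\<^esub> f)"

definition inverse_arrows :: "('o, 'a) cat \<Rightarrow> 'a \<Rightarrow> 'a \<Rightarrow> bool" where
  "inverse_arrows C f g \<longleftrightarrow> f \<in> Ar C \<and> g \<in> homset C (Tgt C f) (Src C f) \<and>
     g \<cdot>\<^bsub>C\<^esub> f = Idt C (Src C f) \<and> f \<cdot>\<^bsub>C\<^esub> g = Idt C (Tgt C f)"

definition inv_arrow :: "('o, 'a) cat \<Rightarrow> 'a \<Rightarrow> 'a" where
  "inv_arrow C f = (THE g. inverse_arrows C f g)"

definition isos :: "('o, 'a) cat \<Rightarrow> 'o \<Rightarrow> 'o \<Rightarrow> 'a set" where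
  "isos C a b = {f \<in> homset C a b. \<exists>g. inverse_arrows C f g}"

locale groupoid = category C for C :: "('o, 'a) cat" +
  assumes invertible: "f \<in> Ar C \<Longrightarrow> \<exists>g. inverse_arrows C f g"

definition op_cat :: "('o, 'a) cat \<Rightarrow> ('o, 'a) cat" where
  "op_cat C = \<lparr>Ob = Ob C, Ar = Ar C, Src = Tgt C, Tgt = Src C, Idt = Idt C,
     Cmp = (\<lambda>g f. f \<cdot>\<^bsub>C\<^esub> g)\<rparr>"

definition prod_cat :: "('o, 'a) cat \<Rightarrow> ('p, 'b) cat \<Rightarrow> ('o \<times> 'p, 'a \<times> 'b) cat" where
  "prod_cat C D = \<lparr>Ob = Ob C \<times> Ob D, Ar = Ar C \<times> Ar D,
     Src = map_prod (Src C) (Src D), Tgt = map_prod (Tgt C) (Tgt D),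
     Idt = map_prod (Idt C) (Idt D),
     Cmp = (\<lambda>(g, g') (f, f'). (g \<cdot>\<^bsub>C\<^esub> f, g' \<cdot>\<^bsub>D\<^esub> f'))\<rparr>"

definition full_subcat :: "('o, 'a) cat \<Rightarrow> ('o \<Rightarrow> bool) \<Rightarrow> ('o, 'a) cat" where
  "full_subcat C P = C\<lparr>Ob := {x \<in> Ob C. P x}, Ar := {f \<in> Ar C. P (Src C f) \<and> P (Tgt C f)}\<rparr>"

record ('o, 'a, 'p, 'b) fctr =
  FO :: "'o \<Rightarrow> 'p"
  FA :: "'a \<Rightarrow> 'b"

locale is_functor = C: category C + D: category D
  for C :: "('o, 'a) cat" and D :: "('p, 'b) cat" +
  fixes F :: "('o, 'a, 'p, 'b) fctr"
  assumes FO_ob: "a \<in> Ob C \<Longrightarrow> FO F a \<in> Ob D"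
    and FA_hom: "f \<in> homset C a b \<Longrightarrow> FA F f \<in> homset D (FO F a) (FO F b)"
    and FA_idt: "a \<in> Ob C \<Longrightarrow> FA F (Idt C a) = Idt D (FO F a)"
    and FA_cmp: "\<lbrakk>f \<in> homset C a b; g \<in> homset C b c\<rbrakk>
      \<Longrightarrow> FA F (g \<cdot>\<^bsub>C\<^esub> f) = FA F g \<cdot>\<^bsub>D\<^esub> FA F f"

text \<open>HOL functions are total.  Two records represent the same functor iff they agree on the
  objects and arrows of the domain; the representative that is \<open>undefined\<close> elsewhere is singled
  out by the equation \<open>fctr_trim C F = F\<close>, so that equality is equality of functors.  The same
  device is used for set-valued functors (\<open>cset_trim\<close>) and, through \<open>extensional\<close>, for
  transformations.\<close>

definition fctr_trim :: "('o, 'a) cat \<Rightarrow> ('o, 'a, 'p, 'b) fctr \<Rightarrow> ('o, 'a, 'p, 'b) fctr" where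
  "fctr_trim C F = \<lparr>FO = restrict (FO F) (Ob C), FA = restrict (FA F) (Ar C)\<rparr>"

definition functors :: "('o, 'a) cat \<Rightarrow> ('p, 'b) cat \<Rightarrow> ('o, 'a, 'p, 'b) fctr set" where
  "functors C D = {F. is_functor C D F \<and> fctr_trim C F = F}"

definition id_fctr :: "('o, 'a) cat \<Rightarrow> ('o, 'a, 'o, 'a) fctr" where
  "id_fctr C = fctr_trim C \<lparr>FO = (\<lambda>a. a), FA = (\<lambda>f. f)\<rparr>"

definition comp_fctr ::
  "('o, 'a) cat \<Rightarrow> ('p, 'b, 'q, 'c) fctr \<Rightarrow> ('o, 'a, 'p, 'b) fctr \<Rightarrow> ('o, 'a, 'q, 'c) fctr" where
  "comp_fctr C G F = fctr_trim C \<lparr>FO = FO G \<circ> FO F, FA = FA G \<circ> FA F\<rparr>"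

text \<open>Transformations carry their source and target.\<close>

record ('f, 'c) cell =
  csrc :: 'f
  ctgt :: 'f
  cmpt :: 'c

definition nat_trans ::
  "('o, 'a) cat \<Rightarrow> ('p, 'b) cat \<Rightarrow> (('o, 'a, 'p, 'b) fctr, 'o \<Rightarrow> 'b) cell set" where
  "nat_trans C D = {t. csrc t \<in> functors C D \<and> ctgt t \<in> functors C D \<and>
     cmpt t \<in> extensional (Ob C) \<and>
     (\<forall>a\<in>Ob C. cmpt t a \<in> homset D (FO (csrc t) a) (FO (ctgt t) a)) \<and>
     (\<forall>f\<in>Ar C. cmpt t (Tgt C f) \<cdot>\<^bsub>D\<^esub> FA (csrc t) f = FA (ctgt t) f \<cdot>\<^bsub>D\<^esub> cmpt t (Src C f))}"

definition functor_cat :: "('o, 'a) cat \<Rightarrow> ('p, 'b) cat \<Rightarrow>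
    (('o, 'a, 'p, 'b) fctr, (('o, 'a, 'p, 'b) fctr, 'o \<Rightarrow> 'b) cell) cat" where
  "functor_cat C D = \<lparr>Ob = functors C D, Ar = nat_trans C D, Src = csrc, Tgt = ctgt,
     Idt = (\<lambda>F. \<lparr>csrc = F, ctgt = F, cmpt = (\<lambda>a\<in>Ob C. Idt D (FO F a))\<rparr>),
     Cmp = (\<lambda>t s. \<lparr>csrc = csrc s, ctgt = ctgt t,
        cmpt = (\<lambda>a\<in>Ob C. cmpt t a \<cdot>\<^bsub>D\<^esub> cmpt s a)\<rparr>)\<rparr>"

section \<open>Bicategories and pseudo-functors\<close>

text \<open>\<open>BComp B a b c\<close> is the composition functor \<open>Hom(b,c) \<times> Hom(a,b) \<rightarrow> Hom(a,c)\<close>; for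
  \<open>f : a \<rightarrow> b\<close>, \<open>g : b \<rightarrow> c\<close>, \<open>h : c \<rightarrow> d\<close>, \<open>BAssoc B a b c d h g f\<close> is the
  2-cell from \<open>(hg)f\<close> to \<open>h(gf)\<close>.\<close>

record ('o, 'm, 't) bicat =
  BOb    :: "'o set"
  BHom   :: "'o \<Rightarrow> 'o \<Rightarrow> ('m, 't) cat"
  BComp  :: "'o \<Rightarrow> 'o \<Rightarrow> 'o \<Rightarrow> ('m \<times> 'm, 't \<times> 't, 'm, 't) fctr"
  BId    :: "'o \<Rightarrow> 'm"
  BAssoc :: "'o \<Rightarrow> 'o \<Rightarrow> 'o \<Rightarrow> 'o \<Rightarrow> 'm \<Rightarrow> 'm \<Rightarrow> 'm \<Rightarrow> 't"
  BLun   :: "'o \<Rightarrow> 'o \<Rightarrow> 'm \<Rightarrow> 't"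
  BRun   :: "'o \<Rightarrow> 'o \<Rightarrow> 'm \<Rightarrow> 't"

abbreviation comp1 :: "('o, 'm, 't) bicat \<Rightarrow> 'o \<Rightarrow> 'o \<Rightarrow> 'o \<Rightarrow> 'm \<Rightarrow> 'm \<Rightarrow> 'm" where
  "comp1 B a b c g f \<equiv> FO (BComp B a b c) (g, f)"

abbreviation comp2 :: "('o, 'm, 't) bicat \<Rightarrow> 'o \<Rightarrow> 'o \<Rightarrow> 'o \<Rightarrow> 't \<Rightarrow> 't \<Rightarrow> 't" where
  "comp2 B a b c \<beta> \<alpha> \<equiv> FA (BComp B a b c) (\<beta>, \<alpha>)"

abbreviation id2 :: "('o, 'm, 't) bicat \<Rightarrow> 'o \<Rightarrow> 'o \<Rightarrow> 'm \<Rightarrow> 't" where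
  "id2 B a b f \<equiv> Idt (BHom B a b) f"

locale bicategory =
  fixes B :: "('o, 'm, 't) bicat"
  assumes hom_category: "\<lbrakk>a \<in> BOb B; b \<in> BOb B\<rbrakk> \<Longrightarrow> category (BHom B a b)"
    and comp_functor: "\<lbrakk>a \<in> BOb B; b \<in> BOb B; c \<in> BOb B\<rbrakk>
      \<Longrightarrow> is_functor (prod_cat (BHom B b c) (BHom B a b)) (BHom B a c) (BComp B a b c)"
    and id_ob: "a \<in> BOb B \<Longrightarrow> BId B a \<in> Ob (BHom B a a)"
    and assoc_iso: "\<lbrakk>a \<in> BOb B; b \<in> BOb B; c \<in> BOb B; d \<in> BOb B;
        f \<in> Ob (BHom B a b); g \<in> Ob (BHom B b c); h \<in> Ob (BHom B c d)\<rbrakk>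
      \<Longrightarrow> BAssoc B a b c d h g f \<in> isos (BHom B a d)
            (comp1 B a b d (comp1 B b c d h g) f) (comp1 B a c d h (comp1 B a b c g f))"
    and assoc_natural: "\<lbrakk>a \<in> BOb B; b \<in> BOb B; c \<in> BOb B; d \<in> BOb B;
        \<alpha> \<in> homset (BHom B a b) f f'; \<beta> \<in> homset (BHom B b c) g g';
        \<gamma> \<in> homset (BHom B c d) h h'\<rbrakk>
      \<Longrightarrow> BAssoc B a b c d h' g' f' \<cdot>\<^bsub>BHom B a d\<^esub> comp2 B a b d (comp2 B b c d \<gamma> \<beta>) \<alpha>
        = comp2 B a c d \<gamma> (comp2 B a b c \<beta> \<alpha>) \<cdot>\<^bsub>BHom B a d\<^esub> BAssoc B a b c d h g f"
    and lun_iso: "\<lbrakk>a \<in> BOb B; b \<in> BOb B; f \<in> Ob (BHom B a b)\<rbrakk>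
      \<Longrightarrow> BLun B a b f \<in> isos (BHom B a b) (comp1 B a b b (BId B b) f) f"
    and lun_natural: "\<lbrakk>a \<in> BOb B; b \<in> BOb B; \<alpha> \<in> homset (BHom B a b) f f'\<rbrakk>
      \<Longrightarrow> BLun B a b f' \<cdot>\<^bsub>BHom B a b\<^esub> comp2 B a b b (id2 B b b (BId B b)) \<alpha>
        = \<alpha> \<cdot>\<^bsub>BHom B a b\<^esub> BLun B a b f"
    and run_iso: "\<lbrakk>a \<in> BOb B; b \<in> BOb B; f \<in> Ob (BHom B a b)\<rbrakk>
      \<Longrightarrow> BRun B a b f \<in> isos (BHom B a b) (comp1 B a a b f (BId B a)) f"
    and run_natural: "\<lbrakk>a \<in> BOb B; b \<in> BOb B; \<alpha> \<in> homset (BHom B a b) f f'\<rbrakk>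
      \<Longrightarrow> BRun B a b f' \<cdot>\<^bsub>BHom B a b\<^esub> comp2 B a a b \<alpha> (id2 B a a (BId B a))
        = \<alpha> \<cdot>\<^bsub>BHom B a b\<^esub> BRun B a b f"
    and pentagon: "\<lbrakk>a \<in> BOb B; b \<in> BOb B; c \<in> BOb B; d \<in> BOb B; e \<in> BOb B;
        f \<in> Ob (BHom B a b); g \<in> Ob (BHom B b c); h \<in> Ob (BHom B c d); k \<in> Ob (BHom B d e)\<rbrakk>
      \<Longrightarrow> BAssoc B a c d e k h (comp1 B a b c g f) \<cdot>\<^bsub>BHom B a e\<^esub>
            BAssoc B a b c e (comp1 B c d e k h) g f
        = comp2 B a d e (id2 B d e k) (BAssoc B a b c d h g f) \<cdot>\<^bsub>BHom B a e\<^esub>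
            (BAssoc B a b d e k (comp1 B b c d h g) f \<cdot>\<^bsub>BHom B a e\<^esub>
             comp2 B a b e (BAssoc B b c d e k h g) (id2 B a b f))"
    and triangle: "\<lbrakk>a \<in> BOb B; b \<in> BOb B; c \<in> BOb B;
        f \<in> Ob (BHom B a b); g \<in> Ob (BHom B b c)\<rbrakk>
      \<Longrightarrow> comp2 B a b c (id2 B b c g) (BLun B a b f) \<cdot>\<^bsub>BHom B a c\<^esub>
            BAssoc B a b b c g (BId B b) f
        = comp2 B a b c (BRun B b c g) (id2 B a b f)"

text \<open>The opposite bicategory reverses 1-cells only.\<close>

definition op_bicat :: "('o, 'm, 't) bicat \<Rightarrow> ('o, 'm, 't) bicat" where
  "op_bicat B = \<lparr>BOb = BOb B, BHom = (\<lambda>a b. BHom B b a),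
     BComp = (\<lambda>a b c. \<lparr>FO = (\<lambda>(g, f). comp1 B c b a f g), FA = (\<lambda>(\<beta>, \<alpha>). comp2 B c b a \<alpha> \<beta>)\<rparr>),
     BId = BId B,
     BAssoc = (\<lambda>a b c d h g f. inv_arrow (BHom B d a) (BAssoc B d c b a f g h)),
     BLun = (\<lambda>a b f. BRun B b a f), BRun = (\<lambda>a b f. BLun B b a f)\<rparr>"

text \<open>Locally full sub-bicategory with all objects, on the 1-cells selected by \<open>P\<close>.\<close>

definition sub_bicat :: "('o, 'm, 't) bicat \<Rightarrow> ('o \<Rightarrow> 'o \<Rightarrow> 'm \<Rightarrow> bool) \<Rightarrow> ('o, 'm, 't) bicat" where
  "sub_bicat B P = B\<lparr>BHom := (\<lambda>a b. full_subcat (BHom B a b) (P a b))\<rparr>"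

text \<open>For \<open>f : a \<rightarrow> b\<close> and \<open>g : b \<rightarrow> c\<close>, \<open>PComp F a b c g f\<close> is the comparison
  2-cell from \<open>F(g)F(f)\<close> to \<open>F(gf)\<close>, and \<open>PUnit F a\<close> is the one from the identity of
  \<open>F(a)\<close> to the image of the identity of \<open>a\<close>.\<close>

record ('o, 'm, 't, 'p, 'n, 's) psfun =
  PO    :: "'o \<Rightarrow> 'p"
  PHom  :: "'o \<Rightarrow> 'o \<Rightarrow> ('m, 't, 'n, 's) fctr"
  PComp :: "'o \<Rightarrow> 'o \<Rightarrow> 'o \<Rightarrow> 'm \<Rightarrow> 'm \<Rightarrow> 's"
  PUnit :: "'o \<Rightarrow> 's"

abbreviation P1 :: "('o, 'm, 't, 'p, 'n, 's) psfun \<Rightarrow> 'o \<Rightarrow> 'o \<Rightarrow> 'm \<Rightarrow> 'n" where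
  "P1 F a b f \<equiv> FO (PHom F a b) f"

abbreviation P2 :: "('o, 'm, 't, 'p, 'n, 's) psfun \<Rightarrow> 'o \<Rightarrow> 'o \<Rightarrow> 't \<Rightarrow> 's" where
  "P2 F a b \<alpha> \<equiv> FA (PHom F a b) \<alpha>"

locale pseudofunctor = C: bicategory C + D: bicategory D
  for C :: "('o, 'm, 't) bicat" and D :: "('p, 'n, 's) bicat" +
  fixes F :: "('o, 'm, 't, 'p, 'n, 's) psfun"
  assumes PO_ob: "a \<in> BOb C \<Longrightarrow> PO F a \<in> BOb D"
    and PHom_functor: "\<lbrakk>a \<in> BOb C; b \<in> BOb C\<rbrakk>
      \<Longrightarrow> is_functor (BHom C a b) (BHom D (PO F a) (PO F b)) (PHom F a b)"
    and PComp_iso: "\<lbrakk>a \<in> BOb C; b \<in> BOb C; c \<in> BOb C;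
        f \<in> Ob (BHom C a b); g \<in> Ob (BHom C b c)\<rbrakk>
      \<Longrightarrow> PComp F a b c g f \<in> isos (BHom D (PO F a) (PO F c))
            (comp1 D (PO F a) (PO F b) (PO F c) (P1 F b c g) (P1 F a b f))
            (P1 F a c (comp1 C a b c g f))"
    and PComp_natural: "\<lbrakk>a \<in> BOb C; b \<in> BOb C; c \<in> BOb C;
        \<alpha> \<in> homset (BHom C a b) f f'; \<beta> \<in> homset (BHom C b c) g g'\<rbrakk>
      \<Longrightarrow> PComp F a b c g' f' \<cdot>\<^bsub>BHom D (PO F a) (PO F c)\<^esub>
            comp2 D (PO F a) (PO F b) (PO F c) (P2 F b c \<beta>) (P2 F a b \<alpha>)
        = P2 F a c (comp2 C a b c \<beta> \<alpha>) \<cdot>\<^bsub>BHom D (PO F a) (PO F c)\<^esub> PComp F a b c g f"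
    and PUnit_iso: "a \<in> BOb C
      \<Longrightarrow> PUnit F a \<in> isos (BHom D (PO F a) (PO F a)) (BId D (PO F a)) (P1 F a a (BId C a))"
    and P_assoc: "\<lbrakk>a \<in> BOb C; b \<in> BOb C; c \<in> BOb C; d \<in> BOb C;
        f \<in> Ob (BHom C a b); g \<in> Ob (BHom C b c); h \<in> Ob (BHom C c d)\<rbrakk>
      \<Longrightarrow> P2 F a d (BAssoc C a b c d h g f) \<cdot>\<^bsub>BHom D (PO F a) (PO F d)\<^esub>
            (PComp F a b d (comp1 C b c d h g) f \<cdot>\<^bsub>BHom D (PO F a) (PO F d)\<^esub>
             comp2 D (PO F a) (PO F b) (PO F d)
               (PComp F b c d h g) (id2 D (PO F a) (PO F b) (P1 F a b f)))
        = PComp F a c d h (comp1 C a b c g f) \<cdot>\<^bsub>BHom D (PO F a) (PO F d)\<^esub>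
            (comp2 D (PO F a) (PO F c) (PO F d)
               (id2 D (PO F c) (PO F d) (P1 F c d h)) (PComp F a b c g f)
             \<cdot>\<^bsub>BHom D (PO F a) (PO F d)\<^esub>
             BAssoc D (PO F a) (PO F b) (PO F c) (PO F d) (P1 F c d h) (P1 F b c g) (P1 F a b f))"
    and P_lun: "\<lbrakk>a \<in> BOb C; b \<in> BOb C; f \<in> Ob (BHom C a b)\<rbrakk>
      \<Longrightarrow> P2 F a b (BLun C a b f) \<cdot>\<^bsub>BHom D (PO F a) (PO F b)\<^esub>
            (PComp F a b b (BId C b) f \<cdot>\<^bsub>BHom D (PO F a) (PO F b)\<^esub>
             comp2 D (PO F a) (PO F b) (PO F b)
               (PUnit F b) (id2 D (PO F a) (PO F b) (P1 F a b f)))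
        = BLun D (PO F a) (PO F b) (P1 F a b f)"
    and P_run: "\<lbrakk>a \<in> BOb C; b \<in> BOb C; f \<in> Ob (BHom C a b)\<rbrakk>
      \<Longrightarrow> P2 F a b (BRun C a b f) \<cdot>\<^bsub>BHom D (PO F a) (PO F b)\<^esub>
            (PComp F a a b f (BId C a) \<cdot>\<^bsub>BHom D (PO F a) (PO F b)\<^esub>
             comp2 D (PO F a) (PO F a) (PO F b)
               (id2 D (PO F a) (PO F b) (P1 F a b f)) (PUnit F a))
        = BRun D (PO F a) (PO F b) (P1 F a b f)"

section \<open>The 2-category of groupoids and its sub-bicategory of finite covers\<close>

text \<open>Smallness: the type \<open>'u\<close> plays the role of the universe; the small groupoids are those
  whose objects and arrows are elements of \<open>'u\<close>.\<close>

type_synonym 'u grpd = "('u, 'u) cat"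
type_synonym 'u gfun = "('u, 'u, 'u, 'u) fctr"
type_synonym 'u gnat = "('u gfun, 'u \<Rightarrow> 'u) cell"

definition comp_nat :: "'u grpd \<Rightarrow> 'u grpd \<Rightarrow> 'u gnat \<Rightarrow> 'u gnat \<Rightarrow> 'u gnat" where
  "comp_nat K G \<beta> \<alpha> = \<lparr>csrc = comp_fctr K (csrc \<beta>) (csrc \<alpha>), ctgt = comp_fctr K (ctgt \<beta>) (ctgt \<alpha>),
     cmpt = (\<lambda>\<kappa>\<in>Ob K. cmpt \<beta> (FO (ctgt \<alpha>) \<kappa>) \<cdot>\<^bsub>G\<^esub> FA (csrc \<beta>) (cmpt \<alpha> \<kappa>))\<rparr>"

definition Grpd :: "('u grpd, 'u gfun, 'u gnat) bicat" where
  "Grpd = \<lparr>BOb = {G. groupoid G}, BHom = functor_cat,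
     BComp = (\<lambda>K H G. \<lparr>FO = (\<lambda>(p, q). comp_fctr K p q), FA = (\<lambda>(\<beta>, \<alpha>). comp_nat K G \<beta> \<alpha>)\<rparr>),
     BId = id_fctr,
     BAssoc = (\<lambda>L K H G p q r. Idt (functor_cat L G) (comp_fctr L p (comp_fctr L q r))),
     BLun = (\<lambda>H G p. Idt (functor_cat H G) p),
     BRun = (\<lambda>H G p. Idt (functor_cat H G) p)\<rparr>"

definition cover :: "'u grpd \<Rightarrow> 'u grpd \<Rightarrow> 'u gfun \<Rightarrow> bool" where
  "cover H G p \<longleftrightarrow> p \<in> functors H G \<and>
     (\<forall>\<eta>'\<in>Ob H. \<forall>\<gamma>\<in>Ob G. \<forall>g\<in>homset G (FO p \<eta>') \<gamma>.
        \<exists>!(\<eta>, h). \<eta> \<in> Ob H \<and> h \<in> homset H \<eta>' \<eta> \<and> FA p h = g)"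

definition finite_cover :: "'u grpd \<Rightarrow> 'u grpd \<Rightarrow> 'u gfun \<Rightarrow> bool" where
  "finite_cover H G p \<longleftrightarrow> cover H G p \<and> (\<forall>\<gamma>\<in>Ob G. finite {\<eta> \<in> Ob H. FO p \<eta> = \<gamma>})"

definition Grpd_fc :: "('u grpd, 'u gfun, 'u gnat) bicat" where
  "Grpd_fc = sub_bicat Grpd finite_cover"

section \<open>Set-valued functors\<close>

record ('o, 'a, 'x) cset =
  Val :: "'o \<Rightarrow> 'x set"
  Act :: "'a \<Rightarrow> 'x \<Rightarrow> 'x"

locale set_functor = category C for C :: "('o, 'a) cat" +
  fixes X :: "('o, 'a, 'x) cset"
  assumes act_val: "\<lbrakk>f \<in> homset C a b; x \<in> Val X a\<rbrakk> \<Longrightarrow> Act X f x \<in> Val X b"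
    and act_idt: "\<lbrakk>a \<in> Ob C; x \<in> Val X a\<rbrakk> \<Longrightarrow> Act X (Idt C a) x = x"
    and act_cmp: "\<lbrakk>f \<in> homset C a b; g \<in> homset C b c; x \<in> Val X a\<rbrakk>
      \<Longrightarrow> Act X (g \<cdot>\<^bsub>C\<^esub> f) x = Act X g (Act X f x)"

definition cset_trim :: "('o, 'a) cat \<Rightarrow> ('o, 'a, 'x) cset \<Rightarrow> ('o, 'a, 'x) cset" where
  "cset_trim C X = \<lparr>Val = restrict (Val X) (Ob C),
     Act = (\<lambda>f\<in>Ar C. restrict (Act X f) (Val X (Src C f)))\<rparr>"

definition set_functors :: "('o, 'a) cat \<Rightarrow> ('o, 'a, 'x) cset set" where
  "set_functors C = {X. set_functor C X \<and> cset_trim C X = X}"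

definition gen_equiv :: "'x set \<Rightarrow> ('x \<times> 'x) set \<Rightarrow> ('x \<times> 'x) set" where
  "gen_equiv A R = (R \<union> R\<inverse>)\<^sup>* \<inter> A \<times> A"

text \<open>The colimit of a set-valued functor, as the standard quotient of the coproduct.\<close>

definition set_colim :: "('o, 'a) cat \<Rightarrow> ('o, 'a, 'x) cset \<Rightarrow> ('o \<times> 'x) set set" where
  "set_colim C X = Sigma (Ob C) (Val X) // gen_equiv (Sigma (Ob C) (Val X))
     {((Src C f, x), (Tgt C f, Act X f x)) | f x. f \<in> Ar C \<and> x \<in> Val X (Src C f)}"

definition free_set :: "('o, 'a) cat \<Rightarrow> ('o, 'a, 'x) cset \<Rightarrow> bool" where
  "free_set G X \<longleftrightarrow>
     (\<forall>\<gamma>\<in>Ob G. \<forall>\<gamma>'\<in>Ob G. \<forall>x\<in>Val X \<gamma>'. inj_on (\<lambda>g. Act X g x) (homset G \<gamma>' \<gamma>))"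

definition fin_gen :: "('o, 'a) cat \<Rightarrow> ('o, 'a, 'x) cset \<Rightarrow> bool" where
  "fin_gen G X \<longleftrightarrow> finite (set_colim G X)"

text \<open>Tensor product of a right \<open>H\<close>-set (a set-valued functor on \<open>op_cat H\<close>) and a left
  \<open>H\<close>-set: a set of equivalence classes of triples \<open>(\<eta>, x, y)\<close>.\<close>

definition tensor_pts ::
  "('o, 'a) cat \<Rightarrow> ('o, 'a, 'x) cset \<Rightarrow> ('o, 'a, 'y) cset \<Rightarrow> ('o \<times> 'x \<times> 'y) set" where
  "tensor_pts H X Y = (SIGMA \<eta>:Ob H. Val X \<eta> \<times> Val Y \<eta>)"

definition tensor_rel ::
  "('o, 'a) cat \<Rightarrow> ('o, 'a, 'x) cset \<Rightarrow> ('o, 'a, 'y) cset \<Rightarrow> (('o \<times> 'x \<times> 'y) \<times> ('o \<times> 'x \<times> 'y)) set" where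
  "tensor_rel H X Y = gen_equiv (tensor_pts H X Y)
     {((Src H h, Act X h x, y), (Tgt H h, x, Act Y h y)) | h x y.
        h \<in> Ar H \<and> x \<in> Val X (Tgt H h) \<and> y \<in> Val Y (Src H h)}"

definition tensor_set ::
  "('o, 'a) cat \<Rightarrow> ('o, 'a, 'x) cset \<Rightarrow> ('o, 'a, 'y) cset \<Rightarrow> ('o \<times> 'x \<times> 'y) set set" where
  "tensor_set H X Y = tensor_pts H X Y // tensor_rel H X Y"

definition tensor_class ::
  "('o, 'a) cat \<Rightarrow> ('o, 'a, 'x) cset \<Rightarrow> ('o, 'a, 'y) cset \<Rightarrow> 'o \<times> 'x \<times> 'y \<Rightarrow> ('o \<times> 'x \<times> 'y) set" where
  "tensor_class H X Y t = tensor_rel H X Y `` {t}"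

section \<open>The Burnside bicategory\<close>

text \<open>Bi-sets take values in subsets of the universe \<open>'u\<close>.  To make \<open>\<otimes>\<close> an operation on such
  bi-sets, an equivalence class of triples is replaced by an element of \<open>'u\<close>: a chosen element of
  the class, encoded by an injection \<open>'u \<times> 'u \<times> 'u \<rightarrow> 'u\<close>, which exists as \<open>'u\<close> is infinite.
  The map \<open>code_class\<close> is injective on every set of classes of an equivalence relation, and
  \<open>class_rep\<close> recovers the chosen element of a class from its code.\<close>

definition triple_code :: "'u::infinite \<times> 'u \<times> 'u \<Rightarrow> 'u" where
  "triple_code = (SOME c. inj c)"

lemma inj_triple_code: "inj (triple_code :: 'u::infinite \<times> 'u \<times> 'u \<Rightarrow> 'u)"
proof -
  include cardinal_syntax
  have "|UNIV \<times> UNIV :: ('u \<times> 'u) set| =o |UNIV :: 'u set|"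
    by (rule card_of_Times_same_infinite[OF infinite_UNIV])
  then obtain p :: "'u \<times> 'u \<Rightarrow> 'u" where "bij_betw p (UNIV \<times> UNIV) UNIV"
    using card_of_ordIso by blast
  then have p: "inj p"
    by (simp add: bij_betw_def)
  have "inj (\<lambda>t. p (fst t, p (snd t)))"
    by (rule injI) (metis p injD prod.collapse prod.inject)
  then show ?thesis
    unfolding triple_code_def by (rule someI[where P = inj])
qed

definition code_class :: "('u::infinite \<times> 'u \<times> 'u) set \<Rightarrow> 'u" where
  "code_class c = triple_code (SOME t. t \<in> c)"

definition class_rep :: "'u::infinite \<Rightarrow> 'u \<times> 'u \<times> 'u" where
  "class_rep = inv triple_code"

lemma class_rep_code_class: "c \<noteq> {} \<Longrightarrow> class_rep (code_class c) \<in> c"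
  by (simp add: class_rep_def code_class_def inj_triple_code some_in_eq)

type_synonym 'u biset = "('u \<times> 'u, 'u \<times> 'u, 'u) cset"
type_synonym 'u biset_map = "('u biset, 'u \<times> 'u \<Rightarrow> 'u \<Rightarrow> 'u) cell"

abbreviation bicar :: "'u grpd \<Rightarrow> 'u grpd \<Rightarrow> ('u \<times> 'u, 'u \<times> 'u) cat" where
  "bicar H G \<equiv> prod_cat (op_cat H) G"

definition bisets :: "'u grpd \<Rightarrow> 'u grpd \<Rightarrow> 'u biset set" where
  "bisets H G = set_functors (bicar H G)"

definition left_part :: "'u grpd \<Rightarrow> 'u biset \<Rightarrow> 'u \<Rightarrow> ('u, 'u, 'u) cset" where
  "left_part H X \<eta> = \<lparr>Val = (\<lambda>\<gamma>. Val X (\<eta>, \<gamma>)), Act = (\<lambda>g. Act X (Idt H \<eta>, g))\<rparr>"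

definition right_part :: "'u grpd \<Rightarrow> 'u biset \<Rightarrow> 'u \<Rightarrow> ('u, 'u, 'u) cset" where
  "right_part G X \<gamma> = \<lparr>Val = (\<lambda>\<eta>. Val X (\<eta>, \<gamma>)), Act = (\<lambda>h. Act X (h, Idt G \<gamma>))\<rparr>"

definition admissible :: "'u grpd \<Rightarrow> 'u grpd \<Rightarrow> 'u biset \<Rightarrow> bool" where
  "admissible H G X \<longleftrightarrow>
     (\<forall>\<eta>\<in>Ob H. free_set G (left_part H X \<eta>) \<and> fin_gen G (left_part H X \<eta>))"

definition biset_isos :: "'u grpd \<Rightarrow> 'u grpd \<Rightarrow> 'u biset_map set" where
  "biset_isos H G = {t. csrc t \<in> bisets H G \<and> ctgt t \<in> bisets H G \<and>
     cmpt t \<in> extensional (Ob (bicar H G)) \<and>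
     (\<forall>c\<in>Ob (bicar H G). cmpt t c \<in> extensional (Val (csrc t) c) \<and>
        bij_betw (cmpt t c) (Val (csrc t) c) (Val (ctgt t) c)) \<and>
     (\<forall>f\<in>Ar (bicar H G). \<forall>x\<in>Val (csrc t) (Src (bicar H G) f).
        cmpt t (Tgt (bicar H G) f) (Act (csrc t) f x)
        = Act (ctgt t) f (cmpt t (Src (bicar H G) f) x))}"

text \<open>A transformation of bi-sets from given component functions, extensional by construction.\<close>

definition mk_map ::
  "'u grpd \<Rightarrow> 'u grpd \<Rightarrow> 'u biset \<Rightarrow> 'u biset \<Rightarrow> ('u \<Rightarrow> 'u \<Rightarrow> 'u \<Rightarrow> 'u) \<Rightarrow> 'u biset_map" where
  "mk_map H G X Y t = \<lparr>csrc = X, ctgt = Y,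
     cmpt = (\<lambda>c\<in>Ob (bicar H G). restrict (t (fst c) (snd c)) (Val X c))\<rparr>"

definition burnside_hom :: "'u grpd \<Rightarrow> 'u grpd \<Rightarrow> ('u biset, 'u biset_map) cat" where
  "burnside_hom H G =
     \<lparr>Ob = {X \<in> bisets H G. admissible H G X},
      Ar = {t \<in> biset_isos H G. admissible H G (csrc t) \<and> admissible H G (ctgt t)},
      Src = csrc, Tgt = ctgt,
      Idt = (\<lambda>X. mk_map H G X X (\<lambda>\<eta> \<gamma> x. x)),
      Cmp = (\<lambda>t s. mk_map H G (csrc s) (ctgt t) (\<lambda>\<eta> \<gamma> x. cmpt t (\<eta>, \<gamma>) (cmpt s (\<eta>, \<gamma>) x)))\<rparr>"

text \<open>For an \<open>(H,G)\<close>-bi-set \<open>X\<close> and a \<open>(K,H)\<close>-bi-set \<open>Y\<close>, \<open>tens K H G X Y \<kappa> \<gamma> (\<eta>, x, y)\<close>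
  is the element \<open>[x, y]\<close> of the tensor product at \<open>(\<kappa>, \<gamma>)\<close>, where \<open>x\<close> and \<open>y\<close> lie
  over \<open>\<eta>\<close>.\<close>

definition tens :: "'u::infinite grpd \<Rightarrow> 'u grpd \<Rightarrow> 'u grpd \<Rightarrow> 'u biset \<Rightarrow> 'u biset \<Rightarrow>
    'u \<Rightarrow> 'u \<Rightarrow> 'u \<times> 'u \<times> 'u \<Rightarrow> 'u" where
  "tens K H G X Y \<kappa> \<gamma> t =
     code_class (tensor_class H (right_part G X \<gamma>) (left_part K Y \<kappa>) t)"

definition tensor ::
  "'u::infinite grpd \<Rightarrow> 'u grpd \<Rightarrow> 'u grpd \<Rightarrow> 'u biset \<Rightarrow> 'u biset \<Rightarrow> 'u biset" where
  "tensor K H G X Y = cset_trim (bicar K G)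
     \<lparr>Val = (\<lambda>(\<kappa>, \<gamma>). code_class ` tensor_set H (right_part G X \<gamma>) (left_part K Y \<kappa>)),
      Act = (\<lambda>(k, g) z. case class_rep z of (\<eta>, x, y) \<Rightarrow>
        tens K H G X Y (Src K k) (Tgt G g) (\<eta>, Act X (Idt H \<eta>, g) x, Act Y (k, Idt H \<eta>) y))\<rparr>"

definition tensor_map ::
  "'u::infinite grpd \<Rightarrow> 'u grpd \<Rightarrow> 'u grpd \<Rightarrow> 'u biset_map \<Rightarrow> 'u biset_map \<Rightarrow> 'u biset_map" where
  "tensor_map K H G s t =
     mk_map K G (tensor K H G (csrc s) (csrc t)) (tensor K H G (ctgt s) (ctgt t))
       (\<lambda>\<kappa> \<gamma> z. case class_rep z of (\<eta>, x, y) \<Rightarrow>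
          tens K H G (ctgt s) (ctgt t) \<kappa> \<gamma> (\<eta>, cmpt s (\<eta>, \<gamma>) x, cmpt t (\<kappa>, \<eta>) y))"

definition id_biset :: "'u grpd \<Rightarrow> 'u biset" where
  "id_biset G = cset_trim (bicar G G)
     \<lparr>Val = (\<lambda>(\<gamma>', \<gamma>). homset G \<gamma>' \<gamma>), Act = (\<lambda>(g', g) f. g \<cdot>\<^bsub>G\<^esub> f \<cdot>\<^bsub>G\<^esub> g')\<rparr>"

text \<open>The unitors are \<open>[g, x] \<mapsto> gx\<close> and \<open>[x, h] \<mapsto> xh\<close>; the associator is
  \<open>[[x, y], z] \<mapsto> [x, [y, z]]\<close>.\<close>

definition burnside_lun :: "'u::infinite grpd \<Rightarrow> 'u grpd \<Rightarrow> 'u biset \<Rightarrow> 'u biset_map" where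
  "burnside_lun H G X = mk_map H G (tensor H G G (id_biset G) X) X
     (\<lambda>\<eta> \<gamma> z. case class_rep z of (\<gamma>', g, x) \<Rightarrow> Act X (Idt H \<eta>, g) x)"

definition burnside_run :: "'u::infinite grpd \<Rightarrow> 'u grpd \<Rightarrow> 'u biset \<Rightarrow> 'u biset_map" where
  "burnside_run H G X = mk_map H G (tensor H H G X (id_biset H)) X
     (\<lambda>\<eta> \<gamma> z. case class_rep z of (\<eta>', x, h) \<Rightarrow> Act X (h, Idt G \<gamma>) x)"

definition burnside_assoc :: "'u::infinite grpd \<Rightarrow> 'u grpd \<Rightarrow> 'u grpd \<Rightarrow> 'u grpd \<Rightarrow>
    'u biset \<Rightarrow> 'u biset \<Rightarrow> 'u biset \<Rightarrow> 'u biset_map" where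
  "burnside_assoc L K H G X Y Z =
     mk_map L G (tensor L K G (tensor K H G X Y) Z) (tensor L H G X (tensor L K H Y Z))
       (\<lambda>l \<gamma> w. case class_rep w of (\<kappa>, v, z) \<Rightarrow> case class_rep v of (\<eta>, x, y) \<Rightarrow>
          tens L H G X (tensor L K H Y Z) l \<gamma> (\<eta>, x, tens L K H Y Z l \<eta> (\<kappa>, y, z)))"

definition Burnside :: "('u::infinite grpd, 'u biset, 'u biset_map) bicat" where
  "Burnside = \<lparr>BOb = {G. groupoid G}, BHom = burnside_hom,
     BComp = (\<lambda>K H G. \<lparr>FO = (\<lambda>(X, Y). tensor K H G X Y), FA = (\<lambda>(s, t). tensor_map K H G s t)\<rparr>),
     BId = id_biset,
     BAssoc = burnside_assoc, BLun = burnside_lun, BRun = burnside_run\<rparr>"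

section \<open>The bi-sets of a functor\<close>

definition S_biset :: "'u grpd \<Rightarrow> 'u grpd \<Rightarrow> 'u gfun \<Rightarrow> 'u biset" where
  "S_biset H G p = cset_trim (bicar H G)
     \<lparr>Val = (\<lambda>(\<eta>, \<gamma>). homset G (FO p \<eta>) \<gamma>), Act = (\<lambda>(h, g) f. g \<cdot>\<^bsub>G\<^esub> f \<cdot>\<^bsub>G\<^esub> FA p h)\<rparr>"

definition T_biset :: "'u grpd \<Rightarrow> 'u grpd \<Rightarrow> 'u gfun \<Rightarrow> 'u biset" where
  "T_biset H G p = cset_trim (bicar G H)
     \<lparr>Val = (\<lambda>(\<gamma>, \<eta>). homset G \<gamma> (FO p \<eta>)), Act = (\<lambda>(g, h) f. FA p h \<cdot>\<^bsub>G\<^esub> f \<cdot>\<^bsub>G\<^esub> g)\<rparr>"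

end

(* As H is a groupoid, [x, y] = [x', y'] in X \<otimes>\<^sub>H Y holds iff x = x'h and y' = hy for a
   single arrow h.  So a map out of a tensor product is an isomorphism of bi-sets as soon as it is
   compatible with sliding, natural, surjective and separates pairs that do not differ by such an h,
   and every coherence law can be checked on representatives.  A free set is finitely generated iff
   finitely many elements meet every orbit; orbit representatives of X \<otimes>\<^sub>H Y are the [x, y] with
   y an orbit representative of Y and x one of X over the same object, and freeness of Y makes h an
   identity, whence the tensor product is free. *)

theory Submission
  imports Defs
begin

section \<open>Categories and groupoids\<close>

text \<open>An element of a tensor product is a code that hides one arbitrarily chosen triple. Maps
  out of a tensor product are therefore written on that triple and computed by
  \<open>tens_case\<close>, which asks only for invariance under sliding. Groupoids, and after them
  the opposite of the finite covers, are treated as strict bicategories: their structural cells are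
  identities, and strictness passes to locally full sub-bicategories and to opposites. The identity
  bi-set is literally the bi-set of an identity functor, so the unit comparisons of both
  pseudo-functors can be identities. The composition comparisons are the co-Yoneda isomorphism G(p-,
  \<gamma>) \<otimes> H(q \<kappa>, -) = G(p q \<kappa>, \<gamma>) and its dual. As G(p \<eta>,
  \<gamma>) is contravariant in p, S acts on 2-cells through inverses, whereas T acts directly.
  Admissibility of S(p) comes from representability of G(p \<eta>, -). For T(p), uniqueness of lifts
  along a cover gives freeness, and existence of lifts together with finite fibres gives finite
  generation.\<close>

lemma homset_iff: "f \<in> homset C a b \<longleftrightarrow> f \<in> Ar C \<and> Src C f = a \<and> Tgt C f = b"
  by (auto simp: homset_def)

context category
begin

lemma ar_ob [simp]: "f \<in> Ar C \<Longrightarrow> Src C f \<in> Ob C" "f \<in> Ar C \<Longrightarrow> Tgt C f \<in> Ob C"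
  by (rule src_ob tgt_ob; assumption)+

lemma idt [simp]:
  "a \<in> Ob C \<Longrightarrow> Idt C a \<in> Ar C" "a \<in> Ob C \<Longrightarrow> Src C (Idt C a) = a" "a \<in> Ob C \<Longrightarrow> Tgt C (Idt C a) = a"
  using idt_hom by (auto simp: homset_iff)

lemma cmp [simp]:
  assumes "f \<in> Ar C" "g \<in> Ar C" "Tgt C f = Src C g"
  shows "g \<cdot>\<^bsub>C\<^esub> f \<in> Ar C" "Src C (g \<cdot>\<^bsub>C\<^esub> f) = Src C f" "Tgt C (g \<cdot>\<^bsub>C\<^esub> f) = Tgt C g"
  using cmp_hom[of f "Src C f" "Tgt C f" g "Tgt C g"] assms by (auto simp: homset_iff)

lemma idt_left [simp]: "f \<in> Ar C \<Longrightarrow> Tgt C f = b \<Longrightarrow> Idt C b \<cdot>\<^bsub>C\<^esub> f = f"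
  using cmp_idt_left by (auto simp: homset_iff)

lemma idt_right [simp]: "f \<in> Ar C \<Longrightarrow> Src C f = a \<Longrightarrow> f \<cdot>\<^bsub>C\<^esub> Idt C a = f"
  using cmp_idt_right by (auto simp: homset_iff)

lemma assoc [simp]:
  "\<lbrakk>f \<in> Ar C; g \<in> Ar C; h \<in> Ar C; Tgt C f = Src C g; Tgt C g = Src C h\<rbrakk>
    \<Longrightarrow> (h \<cdot>\<^bsub>C\<^esub> g) \<cdot>\<^bsub>C\<^esub> f = h \<cdot>\<^bsub>C\<^esub> (g \<cdot>\<^bsub>C\<^esub> f)"
  using cmp_assoc by (auto simp: homset_iff)

lemma inverse_arrows_unique:
  assumes "inverse_arrows C f g" "inverse_arrows C f g'"
  shows "g = g'"
proof -
  have "g \<cdot>\<^bsub>C\<^esub> (f \<cdot>\<^bsub>C\<^esub> g') = (g \<cdot>\<^bsub>C\<^esub> f) \<cdot>\<^bsub>C\<^esub> g'"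
    using assms by (subst assoc) (auto simp: inverse_arrows_def homset_iff)
  then show ?thesis
    using assms by (auto simp: inverse_arrows_def homset_iff)
qed

lemma inv_arrow_eqI: "inverse_arrows C f g \<Longrightarrow> inv_arrow C f = g"
  unfolding inv_arrow_def using inverse_arrows_unique by blast

lemma inverse_arrows_idt: "a \<in> Ob C \<Longrightarrow> inverse_arrows C (Idt C a) (Idt C a)"
  by (auto simp: inverse_arrows_def homset_iff)

lemma inv_arrow_idt [simp]: "a \<in> Ob C \<Longrightarrow> inv_arrow C (Idt C a) = Idt C a"
  by (rule inv_arrow_eqI[OF inverse_arrows_idt])

lemma idt_isos: "a \<in> Ob C \<Longrightarrow> Idt C a \<in> isos C a a"
  using inverse_arrows_idt by (auto simp: isos_def homset_iff)

end

context groupoid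
begin

lemma inverse_arrows_inv: "f \<in> Ar C \<Longrightarrow> inverse_arrows C f (inv_arrow C f)"
  using invertible inv_arrow_eqI by metis

lemma inv [simp]:
  assumes "f \<in> Ar C"
  shows "inv_arrow C f \<in> Ar C" "Src C (inv_arrow C f) = Tgt C f" "Tgt C (inv_arrow C f) = Src C f"
    "inv_arrow C f \<cdot>\<^bsub>C\<^esub> f = Idt C (Src C f)" "f \<cdot>\<^bsub>C\<^esub> inv_arrow C f = Idt C (Tgt C f)"
  using inverse_arrows_inv[OF assms] by (auto simp: inverse_arrows_def homset_iff)

lemma inv_cancel [simp]:
  assumes "f \<in> Ar C" "g \<in> Ar C"
  shows "Tgt C g = Src C f \<Longrightarrow> inv_arrow C f \<cdot>\<^bsub>C\<^esub> (f \<cdot>\<^bsub>C\<^esub> g) = g"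
    and "Tgt C g = Tgt C f \<Longrightarrow> f \<cdot>\<^bsub>C\<^esub> (inv_arrow C f \<cdot>\<^bsub>C\<^esub> g) = g"
  using assms by (simp_all flip: assoc)

text \<open>A left inverse suffices: \<open>f\<close> already has a two-sided inverse, and inserting
  it on the right of \<open>g\<close> identifies the two.\<close>

lemma inv_unique:
  assumes "f \<in> Ar C" "g \<in> Ar C" "Src C g = Tgt C f" "Tgt C g = Src C f"
    and "g \<cdot>\<^bsub>C\<^esub> f = Idt C (Src C f)"
  shows "inv_arrow C f = g"
proof -
  have "g \<cdot>\<^bsub>C\<^esub> (f \<cdot>\<^bsub>C\<^esub> inv_arrow C f) = (g \<cdot>\<^bsub>C\<^esub> f) \<cdot>\<^bsub>C\<^esub> inv_arrow C f"
    using assms(1-4) by (subst assoc) simp_all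
  then show ?thesis
    using assms by simp
qed

lemma inv_inv [simp]: "f \<in> Ar C \<Longrightarrow> inv_arrow C (inv_arrow C f) = f"
  by (rule inv_unique) simp_all

lemma inv_cmp [simp]:
  "\<lbrakk>f \<in> Ar C; g \<in> Ar C; Tgt C f = Src C g\<rbrakk>
    \<Longrightarrow> inv_arrow C (g \<cdot>\<^bsub>C\<^esub> f) = inv_arrow C f \<cdot>\<^bsub>C\<^esub> inv_arrow C g"
  by (rule inv_unique) simp_all

text \<open>Every arrow of a groupoid is epic. Freeness of the identity bi-set and of the bi-sets
  S(p) and T(p) rests on this, since the action there is by post-composition.\<close>

lemma right_cancel:
  assumes "f \<in> Ar C" "g \<in> Ar C" "h \<in> Ar C" "Src C f = Tgt C h" "Src C g = Tgt C h"
  shows "f \<cdot>\<^bsub>C\<^esub> h = g \<cdot>\<^bsub>C\<^esub> h \<longleftrightarrow> f = g"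
proof
  assume "f \<cdot>\<^bsub>C\<^esub> h = g \<cdot>\<^bsub>C\<^esub> h"
  then have "(f \<cdot>\<^bsub>C\<^esub> h) \<cdot>\<^bsub>C\<^esub> inv_arrow C h = (g \<cdot>\<^bsub>C\<^esub> h) \<cdot>\<^bsub>C\<^esub> inv_arrow C h"
    by simp
  then show "f = g"
    using assms by simp
qed simp

lemma isos_eq_homset: "isos C a b = homset C a b"
  using invertible by (auto simp: isos_def homset_iff)

end

text \<open>Equations between sources and targets can be discharged by rewriting, unlike
  \<open>homset\<close> membership with endpoints still to be found.\<close>

lemma categoryI:
  assumes "\<And>f. f \<in> Ar C \<Longrightarrow> Src C f \<in> Ob C \<and> Tgt C f \<in> Ob C"
    and "\<And>a. a \<in> Ob C \<Longrightarrow> Idt C a \<in> Ar C \<and> Src C (Idt C a) = a \<and> Tgt C (Idt C a) = a"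
    and "\<And>f g. \<lbrakk>f \<in> Ar C; g \<in> Ar C; Tgt C f = Src C g\<rbrakk>
      \<Longrightarrow> g \<cdot>\<^bsub>C\<^esub> f \<in> Ar C \<and> Src C (g \<cdot>\<^bsub>C\<^esub> f) = Src C f \<and> Tgt C (g \<cdot>\<^bsub>C\<^esub> f) = Tgt C g"
    and "\<And>f. f \<in> Ar C \<Longrightarrow> Idt C (Tgt C f) \<cdot>\<^bsub>C\<^esub> f = f"
    and "\<And>f. f \<in> Ar C \<Longrightarrow> f \<cdot>\<^bsub>C\<^esub> Idt C (Src C f) = f"
    and "\<And>f g h. \<lbrakk>f \<in> Ar C; g \<in> Ar C; h \<in> Ar C; Tgt C f = Src C g; Tgt C g = Src C h\<rbrakk>
      \<Longrightarrow> (h \<cdot>\<^bsub>C\<^esub> g) \<cdot>\<^bsub>C\<^esub> f = h \<cdot>\<^bsub>C\<^esub> (g \<cdot>\<^bsub>C\<^esub> f)"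
  shows "category C"
  by standard (use assms in \<open>auto simp: homset_iff\<close>)

lemma category_op_cat:
  assumes "category C"
  shows "category (op_cat C)"
proof -
  interpret category C by fact
  show ?thesis
    by (rule categoryI) (simp_all add: op_cat_def)
qed

lemma category_prod_cat:
  assumes "category C" "category D"
  shows "category (prod_cat C D)"
proof -
  interpret C: category C by fact
  interpret D: category D by fact
  show ?thesis
    by (rule categoryI) (auto simp: prod_cat_def)
qed

lemma category_full_subcat:
  assumes "category C"
  shows "category (full_subcat C P)"
proof -
  interpret category C by fact
  show ?thesis
    by (rule categoryI) (auto simp: full_subcat_def)
qed

lemma prod_cat_simps [simp]:
  "Ob (prod_cat C D) = Ob C \<times> Ob D" "Ar (prod_cat C D) = Ar C \<times> Ar D"
  "Src (prod_cat C D) (f, g) = (Src C f, Src D g)" "Tgt (prod_cat C D) (f, g) = (Tgt C f, Tgt D g)"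
  "Idt (prod_cat C D) (a, b) = (Idt C a, Idt D b)"
  "(f', g') \<cdot>\<^bsub>prod_cat C D\<^esub> (f, g) = (f' \<cdot>\<^bsub>C\<^esub> f, g' \<cdot>\<^bsub>D\<^esub> g)"
  by (simp_all add: prod_cat_def)

lemma op_cat_simps [simp]:
  "Ob (op_cat C) = Ob C" "Ar (op_cat C) = Ar C" "Src (op_cat C) = Tgt C" "Tgt (op_cat C) = Src C"
  "Idt (op_cat C) = Idt C" "g \<cdot>\<^bsub>op_cat C\<^esub> f = f \<cdot>\<^bsub>C\<^esub> g"
  by (simp_all add: op_cat_def)

lemma full_subcat_simps [simp]:
  "Ob (full_subcat C P) = {a \<in> Ob C. P a}"
  "Ar (full_subcat C P) = {f \<in> Ar C. P (Src C f) \<and> P (Tgt C f)}"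
  "Src (full_subcat C P) = Src C" "Tgt (full_subcat C P) = Tgt C"
  "Idt (full_subcat C P) = Idt C" "Cmp (full_subcat C P) = Cmp C"
  by (simp_all add: full_subcat_def)

section \<open>Functors and transformations\<close>

lemma is_functorI:
  assumes "category C" "category D"
    and "\<And>a. a \<in> Ob C \<Longrightarrow> FO F a \<in> Ob D"
    and "\<And>f. f \<in> Ar C \<Longrightarrow>
      FA F f \<in> Ar D \<and> Src D (FA F f) = FO F (Src C f) \<and> Tgt D (FA F f) = FO F (Tgt C f)"
    and "\<And>a. a \<in> Ob C \<Longrightarrow> FA F (Idt C a) = Idt D (FO F a)"
    and "\<And>f g. \<lbrakk>f \<in> Ar C; g \<in> Ar C; Tgt C f = Src C g\<rbrakk>
      \<Longrightarrow> FA F (g \<cdot>\<^bsub>C\<^esub> f) = FA F g \<cdot>\<^bsub>D\<^esub> FA F f"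
  shows "is_functor C D F"
proof -
  interpret C: category C by fact
  interpret D: category D by fact
  show ?thesis
    by standard (use assms(3-) in \<open>auto simp: homset_iff\<close>)
qed

context is_functor
begin

lemma ob [simp]: "a \<in> Ob C \<Longrightarrow> FO F a \<in> Ob D"
  by (rule FO_ob)

lemma ar [simp]:
  assumes "f \<in> Ar C"
  shows "FA F f \<in> Ar D" "Src D (FA F f) = FO F (Src C f)" "Tgt D (FA F f) = FO F (Tgt C f)"
  using FA_hom[of f "Src C f" "Tgt C f"] assms by (auto simp: homset_iff)

lemma map_idt [simp]: "a \<in> Ob C \<Longrightarrow> FA F (Idt C a) = Idt D (FO F a)"
  by (rule FA_idt)

lemma map_cmp [simp]:
  "\<lbrakk>f \<in> Ar C; g \<in> Ar C; Tgt C f = Src C g\<rbrakk> \<Longrightarrow> FA F (g \<cdot>\<^bsub>C\<^esub> f) = FA F g \<cdot>\<^bsub>D\<^esub> FA F f"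
  using FA_cmp by (auto simp: homset_iff)

lemma map_inv:
  assumes "groupoid C" "groupoid D" "f \<in> Ar C"
  shows "FA F (inv_arrow C f) = inv_arrow D (FA F f)"
proof -
  interpret C': groupoid C by fact
  interpret D': groupoid D by fact
  show ?thesis
    by (rule D'.inv_unique[symmetric]) (use assms in \<open>simp_all flip: map_cmp\<close>)
qed

end

lemma fctr_trim_simps [simp]:
  "a \<in> Ob C \<Longrightarrow> FO (fctr_trim C F) a = FO F a" "f \<in> Ar C \<Longrightarrow> FA (fctr_trim C F) f = FA F f"
  by (simp_all add: fctr_trim_def)

lemma fctr_trim_idem: "fctr_trim C (fctr_trim C F) = fctr_trim C F"
  by (simp add: fctr_trim_def)

lemma is_functor_trim:
  assumes "is_functor C D F"
  shows "fctr_trim C F \<in> functors C D"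
proof -
  interpret is_functor C D F by fact
  have "is_functor C D (fctr_trim C F)"
    by (rule is_functorI) (simp_all add: C.category_axioms D.category_axioms)
  then show ?thesis
    by (simp add: functors_def fctr_trim_idem)
qed

lemma functors_is_functor: "F \<in> functors C D \<Longrightarrow> is_functor C D F"
  by (simp add: functors_def)

text \<open>Members of \<open>functors\<close> are fixed points of \<open>fctr_trim\<close>, and
  trimming sees only the values on \<open>Ob C\<close> and \<open>Ar C\<close>.\<close>

lemma functors_eqI:
  assumes "F \<in> functors C D" "F' \<in> functors C D"
    and "\<And>a. a \<in> Ob C \<Longrightarrow> FO F a = FO F' a" "\<And>f. f \<in> Ar C \<Longrightarrow> FA F f = FA F' f"
  shows "F = F'"
proof -
  have "fctr_trim C F = fctr_trim C F'"
    using assms(3,4) by (auto simp: fctr_trim_def intro!: restrict_ext)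
  then show ?thesis
    using assms(1,2) by (simp add: functors_def)
qed

lemma id_fctr_simps [simp]:
  "a \<in> Ob C \<Longrightarrow> FO (id_fctr C) a = a" "f \<in> Ar C \<Longrightarrow> FA (id_fctr C) f = f"
  by (simp_all add: id_fctr_def)

lemma id_fctr_functors:
  assumes "category C"
  shows "id_fctr C \<in> functors C C"
  unfolding id_fctr_def by (rule is_functor_trim, rule is_functorI) (simp_all add: assms)

lemma comp_fctr_simps [simp]:
  "a \<in> Ob C \<Longrightarrow> FO (comp_fctr C F' F) a = FO F' (FO F a)"
  "f \<in> Ar C \<Longrightarrow> FA (comp_fctr C F' F) f = FA F' (FA F f)"
  by (simp_all add: comp_fctr_def)

lemma comp_fctr_functors:
  assumes "F \<in> functors C D" "F' \<in> functors D E"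
  shows "comp_fctr C F' F \<in> functors C E"
proof -
  interpret F: is_functor C D F by (rule functors_is_functor) fact
  interpret F': is_functor D E F' by (rule functors_is_functor) fact
  show ?thesis
    unfolding comp_fctr_def
    by (rule is_functor_trim, rule is_functorI)
      (simp_all add: F.C.category_axioms F'.D.category_axioms)
qed

text \<open>Trimming makes this an equality of records and not merely an isomorphism. Together with
  the two unit laws below it is the source of the strictness of \<open>Grpd\<close>.\<close>

lemma comp_fctr_assoc:
  assumes "F \<in> functors C D" "F' \<in> functors D E" "F'' \<in> functors E E'"
  shows "comp_fctr C (comp_fctr D F'' F') F = comp_fctr C F'' (comp_fctr C F' F)"
proof -
  interpret F: is_functor C D F by (rule functors_is_functor) fact
  show ?thesis
    by (rule functors_eqI[of _ C E']) (use assms in \<open>auto intro: comp_fctr_functors\<close>)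
qed

lemma comp_fctr_id_left:
  assumes "F \<in> functors C D"
  shows "comp_fctr C (id_fctr D) F = F"
proof -
  interpret F: is_functor C D F by (rule functors_is_functor) fact
  show ?thesis
    by (rule functors_eqI[of _ C D])
      (use assms in \<open>auto intro!: comp_fctr_functors id_fctr_functors F.D.category_axioms\<close>)
qed

lemma comp_fctr_id_right:
  assumes "F \<in> functors C D"
  shows "comp_fctr C F (id_fctr C) = F"
proof -
  interpret F: is_functor C D F by (rule functors_is_functor) fact
  show ?thesis
    by (rule functors_eqI[of _ C D])
      (use assms in \<open>auto intro!: comp_fctr_functors id_fctr_functors F.C.category_axioms\<close>)
qed

text \<open>The endpoints are parameters of their own, so that an interpretation may name them by
  any terms equal to \<open>csrc t\<close> and \<open>ctgt t\<close>, such as composites of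
  functors.\<close>

locale transformation = F: is_functor C D F + F': is_functor C D F'
  for C :: "('o, 'a) cat" and D :: "('p, 'b) cat" and F F' :: "('o, 'a, 'p, 'b) fctr" +
  fixes t :: "(('o, 'a, 'p, 'b) fctr, 'o \<Rightarrow> 'b) cell"
  assumes nat_trans: "t \<in> nat_trans C D" and csrc: "csrc t = F" and ctgt: "ctgt t = F'"
begin

lemma functors [simp]: "F \<in> functors C D" "F' \<in> functors C D"
  using nat_trans by (auto simp: nat_trans_def csrc ctgt)

lemma component [simp]:
  assumes "a \<in> Ob C"
  shows "cmpt t a \<in> Ar D" "Src D (cmpt t a) = FO F a" "Tgt D (cmpt t a) = FO F' a"
  using nat_trans assms by (auto simp: nat_trans_def homset_iff csrc ctgt)

lemma natural:
  "\<lbrakk>f \<in> Ar C; Tgt C f = b\<rbrakk> \<Longrightarrow> cmpt t b \<cdot>\<^bsub>D\<^esub> FA F f = FA F' f \<cdot>\<^bsub>D\<^esub> cmpt t (Src C f)"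
  using nat_trans by (auto simp: nat_trans_def csrc ctgt)

end

lemma transformationI:
  assumes "t \<in> nat_trans C D" "csrc t = F" "ctgt t = F'"
  shows "transformation C D F F' t"
proof -
  have "csrc t \<in> functors C D" "ctgt t \<in> functors C D"
    using assms(1) by (simp_all add: nat_trans_def)
  then show ?thesis
    unfolding transformation_def transformation_axioms_def
    using assms functors_is_functor[of _ C D] by auto
qed

lemma nat_trans_eqI:
  assumes "s \<in> nat_trans C D" "t \<in> nat_trans C D" "csrc s = csrc t" "ctgt s = ctgt t"
    and "\<And>a. a \<in> Ob C \<Longrightarrow> cmpt s a = cmpt t a"
  shows "s = t"
proof -
  have "cmpt s = cmpt t"
    using assms by (intro extensionalityI[of _ "Ob C"]) (auto simp: nat_trans_def)
  then show ?thesis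
    using assms by (cases s, cases t) auto
qed

section \<open>Vertical composition and functor categories\<close>

lemma functor_cat_simps [simp]:
  "Ob (functor_cat C D) = functors C D" "Ar (functor_cat C D) = nat_trans C D"
  "Src (functor_cat C D) = csrc" "Tgt (functor_cat C D) = ctgt"
  by (simp_all add: functor_cat_def)

lemma functor_cat_idt_simps [simp]:
  "csrc (Idt (functor_cat C D) F) = F" "ctgt (Idt (functor_cat C D) F) = F"
  "a \<in> Ob C \<Longrightarrow> cmpt (Idt (functor_cat C D) F) a = Idt D (FO F a)"
  by (simp_all add: functor_cat_def)

lemma functor_cat_cmp_simps [simp]:
  "csrc (t \<cdot>\<^bsub>functor_cat C D\<^esub> s) = csrc s" "ctgt (t \<cdot>\<^bsub>functor_cat C D\<^esub> s) = ctgt t"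
  "a \<in> Ob C \<Longrightarrow> cmpt (t \<cdot>\<^bsub>functor_cat C D\<^esub> s) a = cmpt t a \<cdot>\<^bsub>D\<^esub> cmpt s a"
  by (simp_all add: functor_cat_def)

lemma functor_cat_idt:
  assumes "F \<in> functors C D"
  shows "Idt (functor_cat C D) F \<in> nat_trans C D"
proof -
  interpret is_functor C D F by (rule functors_is_functor) fact
  show ?thesis
    by (auto simp: nat_trans_def homset_iff assms functor_cat_def)
qed

lemma functor_cat_cmp:
  assumes "s \<in> nat_trans C D" "t \<in> nat_trans C D" "ctgt s = csrc t"
  shows "t \<cdot>\<^bsub>functor_cat C D\<^esub> s \<in> nat_trans C D"
proof -
  interpret s: transformation C D "csrc s" "ctgt s" s
    using assms by (intro transformationI) auto
  interpret t: transformation C D "csrc t" "ctgt t" t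
    using assms by (intro transformationI) auto
  have "cmpt (t \<cdot>\<^bsub>functor_cat C D\<^esub> s) \<in> extensional (Ob C)"
    by (simp add: functor_cat_def)
  moreover have "(cmpt t (Tgt C f) \<cdot>\<^bsub>D\<^esub> cmpt s (Tgt C f)) \<cdot>\<^bsub>D\<^esub> FA (csrc s) f
      = FA (ctgt t) f \<cdot>\<^bsub>D\<^esub> cmpt t (Src C f) \<cdot>\<^bsub>D\<^esub> cmpt s (Src C f)" if f: "f \<in> Ar C" for f
  proof -
    \<comment> \<open>The naturality squares of \<open>s\<close> and \<open>t\<close> are pasted,
      with the brackets shifted in between so that \<open>t.natural\<close> applies.\<close>
    have "(cmpt t (Tgt C f) \<cdot>\<^bsub>D\<^esub> cmpt s (Tgt C f)) \<cdot>\<^bsub>D\<^esub> FA (csrc s) f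
        = cmpt t (Tgt C f) \<cdot>\<^bsub>D\<^esub> FA (csrc t) f \<cdot>\<^bsub>D\<^esub> cmpt s (Src C f)"
      using f assms(3) by (simp add: s.natural)
    also have "\<dots> = (cmpt t (Tgt C f) \<cdot>\<^bsub>D\<^esub> FA (csrc t) f) \<cdot>\<^bsub>D\<^esub> cmpt s (Src C f)"
      using f assms(3) by simp
    also have "\<dots> = FA (ctgt t) f \<cdot>\<^bsub>D\<^esub> cmpt t (Src C f) \<cdot>\<^bsub>D\<^esub> cmpt s (Src C f)"
      using f assms(3) by (subst t.natural) simp_all
    finally show ?thesis .
  qed
  ultimately show ?thesis
    using assms(3) by (auto simp: nat_trans_def homset_iff)
qed

lemma category_functor_cat: "category (functor_cat C D)"
proof (rule categoryI)
  show "Src (functor_cat C D) f \<in> Ob (functor_cat C D) \<and> Tgt (functor_cat C D) f \<in> Ob (functor_cat C D)"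
    if "f \<in> Ar (functor_cat C D)" for f
    using that by (auto simp: nat_trans_def)
next
  fix f assume "f \<in> Ar (functor_cat C D)"
  then interpret transformation C D "csrc f" "ctgt f" f
    by (intro transformationI) auto
  show "Idt (functor_cat C D) (Tgt (functor_cat C D) f) \<cdot>\<^bsub>functor_cat C D\<^esub> f = f"
    by (rule nat_trans_eqI[of _ C D]) (simp_all add: nat_trans functor_cat_cmp functor_cat_idt)
  show "f \<cdot>\<^bsub>functor_cat C D\<^esub> Idt (functor_cat C D) (Src (functor_cat C D) f) = f"
    by (rule nat_trans_eqI[of _ C D]) (simp_all add: nat_trans functor_cat_cmp functor_cat_idt)
next
  fix f g h
  assume *: "f \<in> Ar (functor_cat C D)" "g \<in> Ar (functor_cat C D)" "h \<in> Ar (functor_cat C D)"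
    "Tgt (functor_cat C D) f = Src (functor_cat C D) g" "Tgt (functor_cat C D) g = Src (functor_cat C D) h"
  interpret f: transformation C D "csrc f" "ctgt f" f
    using * by (intro transformationI) auto
  interpret g: transformation C D "csrc g" "ctgt g" g
    using * by (intro transformationI) auto
  interpret h: transformation C D "csrc h" "ctgt h" h
    using * by (intro transformationI) auto
  show "(h \<cdot>\<^bsub>functor_cat C D\<^esub> g) \<cdot>\<^bsub>functor_cat C D\<^esub> f = h \<cdot>\<^bsub>functor_cat C D\<^esub> (g \<cdot>\<^bsub>functor_cat C D\<^esub> f)"
    by (rule nat_trans_eqI[of _ C D]) (use * in \<open>simp_all add: functor_cat_cmp\<close>)
qed (simp_all add: functor_cat_cmp functor_cat_idt)

section \<open>Strict bicategories\<close>

text \<open>A 2-category whose structural cells are asserted to be identities. The notion is stable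
  under opposites and under locally full sub-bicategories, which is how the source of T is reached
  from \<open>Grpd\<close> without checking any coherence law again.\<close>

locale strict_bicategory =
  fixes B :: "('o, 'm, 't) bicat"
  assumes hom_category: "\<lbrakk>a \<in> BOb B; b \<in> BOb B\<rbrakk> \<Longrightarrow> category (BHom B a b)"
    and comp_functor: "\<lbrakk>a \<in> BOb B; b \<in> BOb B; c \<in> BOb B\<rbrakk>
      \<Longrightarrow> is_functor (prod_cat (BHom B b c) (BHom B a b)) (BHom B a c) (BComp B a b c)"
    and id_ob: "a \<in> BOb B \<Longrightarrow> BId B a \<in> Ob (BHom B a a)"
    and comp1_assoc: "\<lbrakk>a \<in> BOb B; b \<in> BOb B; c \<in> BOb B; d \<in> BOb B;
        f \<in> Ob (BHom B a b); g \<in> Ob (BHom B b c); h \<in> Ob (BHom B c d)\<rbrakk>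
      \<Longrightarrow> comp1 B a b d (comp1 B b c d h g) f = comp1 B a c d h (comp1 B a b c g f)"
    and comp2_assoc: "\<lbrakk>a \<in> BOb B; b \<in> BOb B; c \<in> BOb B; d \<in> BOb B;
        \<alpha> \<in> Ar (BHom B a b); \<beta> \<in> Ar (BHom B b c); \<gamma> \<in> Ar (BHom B c d)\<rbrakk>
      \<Longrightarrow> comp2 B a b d (comp2 B b c d \<gamma> \<beta>) \<alpha> = comp2 B a c d \<gamma> (comp2 B a b c \<beta> \<alpha>)"
    and comp1_id_left: "\<lbrakk>a \<in> BOb B; b \<in> BOb B; f \<in> Ob (BHom B a b)\<rbrakk>
      \<Longrightarrow> comp1 B a b b (BId B b) f = f"
    and comp1_id_right: "\<lbrakk>a \<in> BOb B; b \<in> BOb B; f \<in> Ob (BHom B a b)\<rbrakk>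
      \<Longrightarrow> comp1 B a a b f (BId B a) = f"
    and comp2_id_left: "\<lbrakk>a \<in> BOb B; b \<in> BOb B; \<alpha> \<in> Ar (BHom B a b)\<rbrakk>
      \<Longrightarrow> comp2 B a b b (id2 B b b (BId B b)) \<alpha> = \<alpha>"
    and comp2_id_right: "\<lbrakk>a \<in> BOb B; b \<in> BOb B; \<alpha> \<in> Ar (BHom B a b)\<rbrakk>
      \<Longrightarrow> comp2 B a a b \<alpha> (id2 B a a (BId B a)) = \<alpha>"
    and assoc_eq: "\<lbrakk>a \<in> BOb B; b \<in> BOb B; c \<in> BOb B; d \<in> BOb B;
        f \<in> Ob (BHom B a b); g \<in> Ob (BHom B b c); h \<in> Ob (BHom B c d)\<rbrakk>
      \<Longrightarrow> BAssoc B a b c d h g f = id2 B a d (comp1 B a c d h (comp1 B a b c g f))"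
    and lun_eq: "\<lbrakk>a \<in> BOb B; b \<in> BOb B; f \<in> Ob (BHom B a b)\<rbrakk> \<Longrightarrow> BLun B a b f = id2 B a b f"
    and run_eq: "\<lbrakk>a \<in> BOb B; b \<in> BOb B; f \<in> Ob (BHom B a b)\<rbrakk> \<Longrightarrow> BRun B a b f = id2 B a b f"
begin

lemma comp1_ob [simp]:
  assumes "a \<in> BOb B" "b \<in> BOb B" "c \<in> BOb B" "f \<in> Ob (BHom B a b)" "g \<in> Ob (BHom B b c)"
  shows "comp1 B a b c g f \<in> Ob (BHom B a c)"
    "comp2 B a b c (id2 B b c g) (id2 B a b f) = id2 B a c (comp1 B a b c g f)"
proof -
  interpret is_functor "prod_cat (BHom B b c) (BHom B a b)" "BHom B a c" "BComp B a b c"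
    using assms by (intro comp_functor)
  show "comp1 B a b c g f \<in> Ob (BHom B a c)"
    "comp2 B a b c (id2 B b c g) (id2 B a b f) = id2 B a c (comp1 B a b c g f)"
    using assms map_idt[of "(g, f)"] by simp_all
qed

lemma comp2_ar [simp]:
  assumes "a \<in> BOb B" "b \<in> BOb B" "c \<in> BOb B" "\<alpha> \<in> Ar (BHom B a b)" "\<beta> \<in> Ar (BHom B b c)"
  shows "comp2 B a b c \<beta> \<alpha> \<in> Ar (BHom B a c)"
    "Src (BHom B a c) (comp2 B a b c \<beta> \<alpha>) = comp1 B a b c (Src (BHom B b c) \<beta>) (Src (BHom B a b) \<alpha>)"
    "Tgt (BHom B a c) (comp2 B a b c \<beta> \<alpha>) = comp1 B a b c (Tgt (BHom B b c) \<beta>) (Tgt (BHom B a b) \<alpha>)"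
proof -
  interpret is_functor "prod_cat (BHom B b c) (BHom B a b)" "BHom B a c" "BComp B a b c"
    using assms by (intro comp_functor)
  show "comp2 B a b c \<beta> \<alpha> \<in> Ar (BHom B a c)"
    "Src (BHom B a c) (comp2 B a b c \<beta> \<alpha>) = comp1 B a b c (Src (BHom B b c) \<beta>) (Src (BHom B a b) \<alpha>)"
    "Tgt (BHom B a c) (comp2 B a b c \<beta> \<alpha>) = comp1 B a b c (Tgt (BHom B b c) \<beta>) (Tgt (BHom B a b) \<alpha>)"
    using assms by simp_all
qed

lemma comp2_cmp:
  assumes "a \<in> BOb B" "b \<in> BOb B" "c \<in> BOb B" "\<alpha> \<in> Ar (BHom B a b)" "\<beta> \<in> Ar (BHom B b c)"
    "\<alpha>' \<in> Ar (BHom B a b)" "\<beta>' \<in> Ar (BHom B b c)"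
    "Tgt (BHom B a b) \<alpha> = Src (BHom B a b) \<alpha>'" "Tgt (BHom B b c) \<beta> = Src (BHom B b c) \<beta>'"
  shows "comp2 B a b c (\<beta>' \<cdot>\<^bsub>BHom B b c\<^esub> \<beta>) (\<alpha>' \<cdot>\<^bsub>BHom B a b\<^esub> \<alpha>)
    = comp2 B a b c \<beta>' \<alpha>' \<cdot>\<^bsub>BHom B a c\<^esub> comp2 B a b c \<beta> \<alpha>"
proof -
  interpret is_functor "prod_cat (BHom B b c) (BHom B a b)" "BHom B a c" "BComp B a b c"
    using assms by (intro comp_functor)
  show ?thesis
    using assms map_cmp[of "(\<beta>, \<alpha>)" "(\<beta>', \<alpha>')"] by simp
qed

text \<open>With identities as associators and unitors, the naturality clauses become the strict
  associativity and unit laws of \<open>comp2\<close>, while pentagon and triangle compare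
  composites of identities.\<close>

lemma bicategory: "bicategory B"
proof (rule bicategory.intro, goal_cases)
  case 4
  then show ?case
    by (simp add: assoc_eq comp1_assoc category.idt_isos[OF hom_category])
next
  case (5 a b c d \<alpha> f f' \<beta> g g' \<gamma> h h')
  interpret ad: category "BHom B a d" using 5 by (intro hom_category)
  interpret ab: category "BHom B a b" using 5 by (intro hom_category)
  interpret bc: category "BHom B b c" using 5 by (intro hom_category)
  interpret cd: category "BHom B c d" using 5 by (intro hom_category)
  have "f \<in> Ob (BHom B a b)" "f' \<in> Ob (BHom B a b)" "g \<in> Ob (BHom B b c)" "g' \<in> Ob (BHom B b c)"
    "h \<in> Ob (BHom B c d)" "h' \<in> Ob (BHom B c d)"
    using 5 by (auto simp: homset_iff)
  then show ?case
    using 5 by (simp add: assoc_eq comp1_assoc comp2_assoc homset_iff)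
next
  case 6
  then show ?case
    by (simp add: lun_eq comp1_id_left category.idt_isos[OF hom_category])
next
  case (7 a b \<alpha> f f')
  interpret ab: category "BHom B a b" using 7 by (intro hom_category)
  have "f \<in> Ob (BHom B a b)" "f' \<in> Ob (BHom B a b)"
    using 7 by (auto simp: homset_iff)
  then show ?case
    using 7 by (simp add: lun_eq comp2_id_left homset_iff)
next
  case 8
  then show ?case
    by (simp add: run_eq comp1_id_right category.idt_isos[OF hom_category])
next
  case (9 a b \<alpha> f f')
  interpret ab: category "BHom B a b" using 9 by (intro hom_category)
  have "f \<in> Ob (BHom B a b)" "f' \<in> Ob (BHom B a b)"
    using 9 by (auto simp: homset_iff)
  then show ?case
    using 9 by (simp add: run_eq comp2_id_right homset_iff)
next
  case (10 a b c d e f g h k)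
  interpret ae: category "BHom B a e" using 10 by (intro hom_category)
  show ?case
    using 10 by (simp add: assoc_eq comp1_assoc)
next
  case (11 a b c f g)
  interpret ac: category "BHom B a c" using 11 by (intro hom_category)
  show ?case
    using 11 by (simp add: assoc_eq lun_eq run_eq comp1_id_left comp1_id_right id_ob)
qed (simp_all add: hom_category comp_functor id_ob)

lemma strict_op_bicat: "strict_bicategory (op_bicat B)"
proof (rule strict_bicategory.intro, goal_cases)
  case (2 a b c)
  then have obs: "a \<in> BOb B" "b \<in> BOb B" "c \<in> BOb B"
    by (simp_all add: op_bicat_def)
  show ?case
    unfolding op_bicat_def
    by (rule is_functorI)
      (use obs in \<open>auto simp: category_prod_cat hom_category comp2_cmp category.ar_ob\<close>)
next
  \<comment> \<open>\<open>op_bicat\<close> takes inverses of associators, and the inverse of an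
    identity is that identity.\<close>
  case (10 a b c d f g h)
  then have obs: "a \<in> BOb B" "b \<in> BOb B" "c \<in> BOb B" "d \<in> BOb B"
    by (simp_all add: op_bicat_def)
  then interpret category "BHom B d a"
    by (intro hom_category)
  show ?case
    using 10 obs by (simp add: op_bicat_def assoc_eq comp1_assoc)
qed (simp_all add: op_bicat_def hom_category id_ob comp1_assoc comp2_assoc comp1_id_left
    comp1_id_right comp2_id_left comp2_id_right lun_eq run_eq)

text \<open>All 2-cells between selected 1-cells are kept, so closure of \<open>P\<close> under
  identities and composites is all that has to be supplied; every equation is inherited.\<close>

lemma strict_sub_bicat:
  assumes P_id: "\<And>a. a \<in> BOb B \<Longrightarrow> P a a (BId B a)"
    and P_comp: "\<And>a b c f g. \<lbrakk>a \<in> BOb B; b \<in> BOb B; c \<in> BOb B; f \<in> Ob (BHom B a b);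
      g \<in> Ob (BHom B b c); P a b f; P b c g\<rbrakk> \<Longrightarrow> P a c (comp1 B a b c g f)"
  shows "strict_bicategory (sub_bicat B P)"
proof (rule strict_bicategory.intro, goal_cases)
  case (2 a b c)
  then have obs: "a \<in> BOb B" "b \<in> BOb B" "c \<in> BOb B"
    by (simp_all add: sub_bicat_def)
  then interpret ab: category "BHom B a b" by (intro hom_category)
  interpret bc: category "BHom B b c" using obs by (intro hom_category)
  show ?case
    unfolding sub_bicat_def
    by (rule is_functorI)
      (use obs in \<open>auto simp: category_prod_cat category_full_subcat hom_category comp2_cmp P_comp\<close>)
qed (simp_all add: sub_bicat_def hom_category category_full_subcat id_ob P_id comp1_assoc comp2_assoc
    comp1_id_left comp1_id_right comp2_id_left comp2_id_right lun_eq run_eq assoc_eq)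

end

section \<open>Groupoids and finite covers\<close>

lemma comp_nat_simps [simp]:
  "csrc (comp_nat K G \<beta> \<alpha>) = comp_fctr K (csrc \<beta>) (csrc \<alpha>)"
  "ctgt (comp_nat K G \<beta> \<alpha>) = comp_fctr K (ctgt \<beta>) (ctgt \<alpha>)"
  "\<kappa> \<in> Ob K \<Longrightarrow> cmpt (comp_nat K G \<beta> \<alpha>) \<kappa> = cmpt \<beta> (FO (ctgt \<alpha>) \<kappa>) \<cdot>\<^bsub>G\<^esub> FA (csrc \<beta>) (cmpt \<alpha> \<kappa>)"
  by (simp_all add: comp_nat_def)

lemma comp_nat_nat_trans:
  assumes "\<alpha> \<in> nat_trans K H" "\<beta> \<in> nat_trans H G"
  shows "comp_nat K G \<beta> \<alpha> \<in> nat_trans K G"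
proof -
  interpret \<alpha>: transformation K H "csrc \<alpha>" "ctgt \<alpha>" \<alpha>
    using assms by (intro transformationI) auto
  interpret \<beta>: transformation H G "csrc \<beta>" "ctgt \<beta>" \<beta>
    using assms by (intro transformationI) auto
  have natural: "(cmpt \<beta> (FO (ctgt \<alpha>) (Tgt K k)) \<cdot>\<^bsub>G\<^esub> FA (csrc \<beta>) (cmpt \<alpha> (Tgt K k))) \<cdot>\<^bsub>G\<^esub> FA (csrc \<beta>) (FA (csrc \<alpha>) k)
    = FA (ctgt \<beta>) (FA (ctgt \<alpha>) k) \<cdot>\<^bsub>G\<^esub> cmpt \<beta> (FO (ctgt \<alpha>) (Src K k)) \<cdot>\<^bsub>G\<^esub> FA (csrc \<beta>) (cmpt \<alpha> (Src K k))"
    if k: "k \<in> Ar K" for k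
  proof -
    \<comment> \<open>Functoriality of \<open>csrc \<beta>\<close> gathers two factors so that
      naturality of \<alpha> applies inside it; naturality of \<beta> at the arrow
      \<open>FA (ctgt \<alpha>) k\<close> finishes.\<close>
    have "(cmpt \<beta> (FO (ctgt \<alpha>) (Tgt K k)) \<cdot>\<^bsub>G\<^esub> FA (csrc \<beta>) (cmpt \<alpha> (Tgt K k))) \<cdot>\<^bsub>G\<^esub> FA (csrc \<beta>) (FA (csrc \<alpha>) k)
      = cmpt \<beta> (FO (ctgt \<alpha>) (Tgt K k)) \<cdot>\<^bsub>G\<^esub> FA (csrc \<beta>) (cmpt \<alpha> (Tgt K k) \<cdot>\<^bsub>H\<^esub> FA (csrc \<alpha>) k)"
      using k by simp
    also have "\<dots> = (cmpt \<beta> (FO (ctgt \<alpha>) (Tgt K k)) \<cdot>\<^bsub>G\<^esub> FA (csrc \<beta>) (FA (ctgt \<alpha>) k)) \<cdot>\<^bsub>G\<^esub> FA (csrc \<beta>) (cmpt \<alpha> (Src K k))"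
      using k by (simp add: \<alpha>.natural)
    also have "\<dots> = (FA (ctgt \<beta>) (FA (ctgt \<alpha>) k) \<cdot>\<^bsub>G\<^esub> cmpt \<beta> (FO (ctgt \<alpha>) (Src K k))) \<cdot>\<^bsub>G\<^esub> FA (csrc \<beta>) (cmpt \<alpha> (Src K k))"
      using k by (subst \<beta>.natural) simp_all
    finally show ?thesis
      using k by simp
  qed
  show ?thesis
    using natural comp_fctr_functors[of _ K H _ G]
    by (auto simp: nat_trans_def homset_iff) (simp_all add: comp_nat_def)
qed

lemma comp_nat_assoc:
  assumes "\<alpha> \<in> nat_trans L K" "\<beta> \<in> nat_trans K H" "\<gamma> \<in> nat_trans H G"
  shows "comp_nat L G (comp_nat K G \<gamma> \<beta>) \<alpha> = comp_nat L G \<gamma> (comp_nat L H \<beta> \<alpha>)"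
proof -
  interpret \<alpha>: transformation L K "csrc \<alpha>" "ctgt \<alpha>" \<alpha>
    using assms by (intro transformationI) auto
  interpret \<beta>: transformation K H "csrc \<beta>" "ctgt \<beta>" \<beta>
    using assms by (intro transformationI) auto
  interpret \<gamma>: transformation H G "csrc \<gamma>" "ctgt \<gamma>" \<gamma>
    using assms by (intro transformationI) auto
  show ?thesis
    by (rule nat_trans_eqI[of _ L G])
      (use assms in \<open>auto intro: comp_nat_nat_trans comp_fctr_assoc[of _ L K _ H _ G]\<close>)
qed

text \<open>The interchange law. The two sides differ by moving a component of \<beta> past the
  image of \<open>cmpt \<alpha>' \<kappa>\<close>, which is naturality of \<beta> at that
  arrow.\<close>

lemma comp_nat_cmp:
  assumes "\<alpha> \<in> nat_trans K H" "\<alpha>' \<in> nat_trans K H" "ctgt \<alpha> = csrc \<alpha>'"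
    and "\<beta> \<in> nat_trans H G" "\<beta>' \<in> nat_trans H G" "ctgt \<beta> = csrc \<beta>'"
  shows "comp_nat K G (\<beta>' \<cdot>\<^bsub>functor_cat H G\<^esub> \<beta>) (\<alpha>' \<cdot>\<^bsub>functor_cat K H\<^esub> \<alpha>)
    = comp_nat K G \<beta>' \<alpha>' \<cdot>\<^bsub>functor_cat K G\<^esub> comp_nat K G \<beta> \<alpha>"
proof -
  interpret \<alpha>: transformation K H "csrc \<alpha>" "ctgt \<alpha>" \<alpha>
    using assms by (intro transformationI) auto
  interpret \<alpha>': transformation K H "csrc \<alpha>'" "ctgt \<alpha>'" \<alpha>'
    using assms by (intro transformationI) auto
  interpret \<beta>: transformation H G "csrc \<beta>" "ctgt \<beta>" \<beta>
    using assms by (intro transformationI) auto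
  interpret \<beta>': transformation H G "csrc \<beta>'" "ctgt \<beta>'" \<beta>'
    using assms by (intro transformationI) auto
  have "cmpt \<beta> (FO (ctgt \<alpha>') \<kappa>) \<cdot>\<^bsub>G\<^esub> FA (csrc \<beta>) (cmpt \<alpha>' \<kappa>) \<cdot>\<^bsub>G\<^esub> FA (csrc \<beta>) (cmpt \<alpha> \<kappa>)
    = FA (csrc \<beta>') (cmpt \<alpha>' \<kappa>) \<cdot>\<^bsub>G\<^esub> cmpt \<beta> (FO (csrc \<alpha>') \<kappa>) \<cdot>\<^bsub>G\<^esub> FA (csrc \<beta>) (cmpt \<alpha> \<kappa>)"
    if k: "\<kappa> \<in> Ob K" for \<kappa>
  proof -
    have "(cmpt \<beta> (FO (ctgt \<alpha>') \<kappa>) \<cdot>\<^bsub>G\<^esub> FA (csrc \<beta>) (cmpt \<alpha>' \<kappa>)) \<cdot>\<^bsub>G\<^esub> FA (csrc \<beta>) (cmpt \<alpha> \<kappa>)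
      = (FA (csrc \<beta>') (cmpt \<alpha>' \<kappa>) \<cdot>\<^bsub>G\<^esub> cmpt \<beta> (FO (csrc \<alpha>') \<kappa>)) \<cdot>\<^bsub>G\<^esub> FA (csrc \<beta>) (cmpt \<alpha> \<kappa>)"
      using k assms by (subst \<beta>.natural) simp_all
    then show ?thesis
      using k assms by simp
  qed
  then show ?thesis
    by (intro nat_trans_eqI[of _ K G])
      (use assms in \<open>auto intro: comp_nat_nat_trans functor_cat_cmp\<close>)
qed

lemma comp_nat_idt:
  assumes "q \<in> functors K H" "p \<in> functors H G"
  shows "comp_nat K G (Idt (functor_cat H G) p) (Idt (functor_cat K H) q)
    = Idt (functor_cat K G) (comp_fctr K p q)"
proof -
  interpret q: is_functor K H q using assms by (intro functors_is_functor)
  interpret p: is_functor H G p using assms by (intro functors_is_functor)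
  show ?thesis
    by (rule nat_trans_eqI[of _ K G])
      (use assms in \<open>auto intro!: comp_nat_nat_trans[of _ K H] comp_fctr_functors functor_cat_idt\<close>)
qed

lemma comp_nat_id_left:
  assumes "\<alpha> \<in> nat_trans H G"
  shows "comp_nat H G (Idt (functor_cat G G) (id_fctr G)) \<alpha> = \<alpha>"
proof -
  interpret \<alpha>: transformation H G "csrc \<alpha>" "ctgt \<alpha>" \<alpha>
    using assms by (intro transformationI) auto
  show ?thesis
    by (rule nat_trans_eqI[of _ H G])
      (use assms in \<open>auto intro!: comp_nat_nat_trans[of _ H G] functor_cat_idt id_fctr_functors
        comp_fctr_id_left[of _ H G] \<alpha>.F.D.category_axioms\<close>)
qed

lemma comp_nat_id_right:
  assumes "\<alpha> \<in> nat_trans H G"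
  shows "comp_nat H G \<alpha> (Idt (functor_cat H H) (id_fctr H)) = \<alpha>"
proof -
  interpret \<alpha>: transformation H G "csrc \<alpha>" "ctgt \<alpha>" \<alpha>
    using assms by (intro transformationI) auto
  show ?thesis
    by (rule nat_trans_eqI[of _ H G])
      (use assms in \<open>auto intro!: comp_nat_nat_trans[of _ H H] functor_cat_idt id_fctr_functors
        comp_fctr_id_right[of _ H G] \<alpha>.F.C.category_axioms\<close>)
qed

section \<open>The strict 2-category of groupoids\<close>

lemma Grpd_simps [simp]:
  "BOb Grpd = {G. groupoid G}" "BHom Grpd = functor_cat" "comp1 Grpd K H G p q = comp_fctr K p q"
  "comp2 Grpd K H G \<beta> \<alpha> = comp_nat K G \<beta> \<alpha>" "BId Grpd = id_fctr"
  by (simp_all add: Grpd_def)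

lemma nat_trans_functors: "t \<in> nat_trans C D \<Longrightarrow> csrc t \<in> functors C D \<and> ctgt t \<in> functors C D"
  by (simp add: nat_trans_def)

lemma strict_bicategory_Grpd: "strict_bicategory Grpd"
proof (rule strict_bicategory.intro, goal_cases)
  case (2 a b c)
  show ?case
  proof (rule is_functorI)
    fix f assume "f \<in> Ar (prod_cat (BHom Grpd b c) (BHom Grpd a b))"
    then obtain \<beta> \<alpha> where "f = (\<beta>, \<alpha>)" "\<alpha> \<in> nat_trans a b" "\<beta> \<in> nat_trans b c"
      by auto
    then show "FA (BComp Grpd a b c) f \<in> Ar (BHom Grpd a c) \<and>
       Src (BHom Grpd a c) (FA (BComp Grpd a b c) f) = FO (BComp Grpd a b c) (Src (prod_cat (BHom Grpd b c) (BHom Grpd a b)) f) \<and>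
       Tgt (BHom Grpd a c) (FA (BComp Grpd a b c) f) = FO (BComp Grpd a b c) (Tgt (prod_cat (BHom Grpd b c) (BHom Grpd a b)) f)"
      by (auto intro: comp_nat_nat_trans)
  qed (auto simp: category_prod_cat category_functor_cat comp_nat_idt comp_nat_cmp
      intro: comp_fctr_functors)
next
  case (10 a b c d f g h)
  then show ?case by (simp add: Grpd_def)
next
  case (11 a b f)
  then show ?case by (simp add: Grpd_def)
next
  case (12 a b f)
  then show ?case by (simp add: Grpd_def)
qed (auto simp: category_functor_cat id_fctr_functors groupoid.axioms(1) comp_fctr_assoc comp_nat_assoc
    comp_fctr_id_left comp_fctr_id_right comp_nat_id_left comp_nat_id_right)

text \<open>The object in the pair of \<open>cover\<close> is the target of the lift, so the
  condition amounts to unique lifting of arrows from a given source object. Functoriality, existence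
  and uniqueness are separated here because they are used at different places.\<close>

lemma coverD:
  assumes "cover H G p"
  shows "p \<in> functors H G"
    and "\<lbrakk>\<eta> \<in> Ob H; g \<in> Ar G; Src G g = FO p \<eta>\<rbrakk> \<Longrightarrow> \<exists>h. h \<in> Ar H \<and> Src H h = \<eta> \<and> FA p h = g"
    and "\<lbrakk>h \<in> Ar H; h' \<in> Ar H; Src H h = Src H h'; FA p h = FA p h'\<rbrakk> \<Longrightarrow> h = h'"
proof -
  show p: "p \<in> functors H G"
    using assms by (simp add: cover_def)
  interpret is_functor H G p by (rule functors_is_functor[OF p])
  have ex1: "\<exists>!(\<eta>', h). \<eta>' \<in> Ob H \<and> h \<in> homset H \<eta> \<eta>' \<and> FA p h = g"
    if g: "\<eta> \<in> Ob H" "g \<in> Ar G" "Src G g = FO p \<eta>" for \<eta> g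
  proof -
    have "g \<in> homset G (FO p \<eta>) (Tgt G g)" "Tgt G g \<in> Ob G"
      using g by (simp_all add: homset_iff)
    with assms g(1) show ?thesis
      unfolding cover_def by blast
  qed
  show "\<exists>h. h \<in> Ar H \<and> Src H h = \<eta> \<and> FA p h = g"
    if "\<eta> \<in> Ob H" "g \<in> Ar G" "Src G g = FO p \<eta>"
    using ex1[OF that] by (auto simp: homset_iff)
  show "h = h'" if h: "h \<in> Ar H" "h' \<in> Ar H" "Src H h = Src H h'" "FA p h = FA p h'"
  proof -
    \<comment> \<open>Both \<open>(Tgt H h, h)\<close> and \<open>(Tgt H h', h')\<close> lift
      \<open>FA p h\<close> from the same source, so each equals the unique pair
      \<open>z\<close>.\<close>
    obtain z where "\<forall>y. (case y of (\<eta>', k) \<Rightarrow> \<eta>' \<in> Ob H \<and> k \<in> homset H (Src H h) \<eta>' \<and> FA p k = FA p h) \<longrightarrow> y = z"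
      using ex1[of "Src H h" "FA p h"] h(1) by (auto simp: Ex1_def)
    from spec[OF this, of "(Tgt H h, h)"] spec[OF this, of "(Tgt H h', h')"] show ?thesis
      using h by (auto simp: homset_iff)
  qed
qed

lemma coverI:
  assumes "p \<in> functors H G"
    and ex: "\<And>\<eta> g. \<lbrakk>\<eta> \<in> Ob H; g \<in> Ar G; Src G g = FO p \<eta>\<rbrakk> \<Longrightarrow> \<exists>h. h \<in> Ar H \<and> Src H h = \<eta> \<and> FA p h = g"
    and unique: "\<And>h h'. \<lbrakk>h \<in> Ar H; h' \<in> Ar H; Src H h = Src H h'; FA p h = FA p h'\<rbrakk> \<Longrightarrow> h = h'"
  shows "cover H G p"
proof -
  interpret is_functor H G p using assms by (intro functors_is_functor)
  have "\<exists>!(\<eta>', h). \<eta>' \<in> Ob H \<and> h \<in> homset H \<eta> \<eta>' \<and> FA p h = g"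
    if g: "\<eta> \<in> Ob H" "\<gamma> \<in> Ob G" "g \<in> homset G (FO p \<eta>) \<gamma>" for \<eta> \<gamma> g
  proof -
    obtain h where h: "h \<in> Ar H" "Src H h = \<eta>" "FA p h = g"
      using ex[of \<eta> g] g by (auto simp: homset_iff)
    then show ?thesis
      by (intro ex1I[of _ "(Tgt H h, h)"]) (use unique in \<open>auto simp: homset_iff\<close>)
  qed
  then show ?thesis
    using assms(1) by (auto simp: cover_def)
qed

lemma finite_cover_id:
  assumes "category G"
  shows "finite_cover G G (id_fctr G)"
proof -
  interpret category G by fact
  have "cover G G (id_fctr G)"
    by (rule coverI) (auto intro: id_fctr_functors category_axioms)
  moreover have "{\<eta> \<in> Ob G. FO (id_fctr G) \<eta> = \<gamma>} \<subseteq> {\<gamma>}" for \<gamma>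
    by auto
  ultimately show ?thesis
    unfolding finite_cover_def by (meson finite.simps finite_subset)
qed

text \<open>An arrow lifts through \<open>p\<close> and then through \<open>q\<close>; the fibre of
  the composite lies in the union of the fibres of \<open>q\<close> over a finite fibre of
  \<open>p\<close>.\<close>

lemma finite_cover_comp:
  assumes "finite_cover K H q" "finite_cover H G p"
  shows "finite_cover K G (comp_fctr K p q)"
proof -
  have q: "cover K H q" and p: "cover H G p"
    using assms by (simp_all add: finite_cover_def)
  interpret q: is_functor K H q using coverD(1)[OF q] by (rule functors_is_functor)
  interpret p: is_functor H G p using coverD(1)[OF p] by (rule functors_is_functor)
  have "cover K G (comp_fctr K p q)"
  proof (rule coverI)
    show "comp_fctr K p q \<in> functors K G"
      using coverD(1) q p by (auto intro: comp_fctr_functors)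
  next
    fix \<kappa> g assume "\<kappa> \<in> Ob K" "g \<in> Ar G" "Src G g = FO (comp_fctr K p q) \<kappa>"
    then obtain h where h: "h \<in> Ar H" "Src H h = FO q \<kappa>" "FA p h = g"
      using coverD(2)[OF p, of "FO q \<kappa>" g] by auto
    then obtain k where "k \<in> Ar K" "Src K k = \<kappa>" "FA q k = h"
      using coverD(2)[OF q, of \<kappa> h] \<open>\<kappa> \<in> Ob K\<close> by auto
    with h show "\<exists>k. k \<in> Ar K \<and> Src K k = \<kappa> \<and> FA (comp_fctr K p q) k = g"
      by auto
  next
    fix k k' assume *: "k \<in> Ar K" "k' \<in> Ar K" "Src K k = Src K k'"
      "FA (comp_fctr K p q) k = FA (comp_fctr K p q) k'"
    then have "FA q k = FA q k'"
      by - (rule coverD(3)[OF p], auto)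
    with * show "k = k'"
      by - (rule coverD(3)[OF q], auto)
  qed
  moreover have "finite {\<kappa> \<in> Ob K. FO (comp_fctr K p q) \<kappa> = \<gamma>}" if "\<gamma> \<in> Ob G" for \<gamma>
  proof -
    have "{\<kappa> \<in> Ob K. FO (comp_fctr K p q) \<kappa> = \<gamma>}
      \<subseteq> (\<Union>\<eta>\<in>{\<eta> \<in> Ob H. FO p \<eta> = \<gamma>}. {\<kappa> \<in> Ob K. FO q \<kappa> = \<eta>})"
      by auto
    then show ?thesis
      by (rule finite_subset) (use assms that in \<open>simp add: finite_cover_def\<close>)
  qed
  ultimately show ?thesis
    by (simp add: finite_cover_def)
qed

lemma strict_bicategory_op_Grpd_fc: "strict_bicategory (op_bicat Grpd_fc)"
proof -
  interpret strict_bicategory Grpd by (rule strict_bicategory_Grpd)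
  have "strict_bicategory Grpd_fc"
    unfolding Grpd_fc_def
    by (rule strict_sub_bicat) (auto intro: finite_cover_id finite_cover_comp groupoid.axioms(1))
  then show ?thesis
    by (rule strict_bicategory.strict_op_bicat)
qed

section \<open>Set-valued functors on groupoids\<close>

context set_functor
begin

lemma act [simp]: "\<lbrakk>f \<in> Ar C; x \<in> Val X (Src C f); Tgt C f = b\<rbrakk> \<Longrightarrow> Act X f x \<in> Val X b"
  using act_val by (auto simp: homset_iff)

lemma act_id [simp]: "\<lbrakk>a \<in> Ob C; x \<in> Val X a\<rbrakk> \<Longrightarrow> Act X (Idt C a) x = x"
  by (rule act_idt)

lemma act_act [simp]:
  "\<lbrakk>f \<in> Ar C; g \<in> Ar C; Tgt C f = Src C g; x \<in> Val X (Src C f)\<rbrakk>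
    \<Longrightarrow> Act X g (Act X f x) = Act X (g \<cdot>\<^bsub>C\<^esub> f) x"
  using act_cmp by (auto simp: homset_iff)

end

lemma set_functorI:
  assumes "category C"
    and "\<And>f x. \<lbrakk>f \<in> Ar C; x \<in> Val X (Src C f)\<rbrakk> \<Longrightarrow> Act X f x \<in> Val X (Tgt C f)"
    and "\<And>a x. \<lbrakk>a \<in> Ob C; x \<in> Val X a\<rbrakk> \<Longrightarrow> Act X (Idt C a) x = x"
    and "\<And>f g x. \<lbrakk>f \<in> Ar C; g \<in> Ar C; Tgt C f = Src C g; x \<in> Val X (Src C f)\<rbrakk>
      \<Longrightarrow> Act X (g \<cdot>\<^bsub>C\<^esub> f) x = Act X g (Act X f x)"
  shows "set_functor C X"
proof -
  interpret category C by fact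
  show ?thesis
    by standard (use assms in \<open>auto simp: homset_iff\<close>)
qed

lemma cset_trim_simps [simp]:
  "a \<in> Ob C \<Longrightarrow> Val (cset_trim C X) a = Val X a"
  "\<lbrakk>f \<in> Ar C; x \<in> Val X (Src C f)\<rbrakk> \<Longrightarrow> Act (cset_trim C X) f x = Act X f x"
  by (simp_all add: cset_trim_def)

lemma cset_trim_cong:
  assumes "category C" "\<And>a. a \<in> Ob C \<Longrightarrow> Val X a = Val Y a"
    and "\<And>f x. \<lbrakk>f \<in> Ar C; x \<in> Val X (Src C f)\<rbrakk> \<Longrightarrow> Act X f x = Act Y f x"
  shows "cset_trim C X = cset_trim C Y"
proof -
  interpret category C by fact
  show ?thesis
    using assms(2,3) by (auto simp: cset_trim_def intro!: restrict_ext)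
qed

lemma set_functor_trim:
  assumes "set_functor C X"
  shows "cset_trim C X \<in> set_functors C"
proof -
  interpret set_functor C X by fact
  have "set_functor C (cset_trim C X)"
    by (rule set_functorI) (simp_all add: category_axioms)
  moreover have "cset_trim C (cset_trim C X) = cset_trim C X"
    by (rule cset_trim_cong) (simp_all add: category_axioms)
  ultimately show ?thesis
    by (simp add: set_functors_def)
qed

text \<open>For a symmetric and transitive \<open>R\<close> the closure adds only identity pairs,
  and cutting down to \<open>A \<times> A\<close> leaves those that \<open>R\<close> contains by
  reflexivity. It is applied to colimits and tensor products over a groupoid, where the generating
  relation is already an equivalence.\<close>

lemma gen_equiv_eq:
  assumes "equiv A R"
  shows "gen_equiv A R = R"
proof -
  have R: "R \<union> R\<inverse> = R" "trans R" "R \<subseteq> A \<times> A" "Id_on A \<subseteq> R"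
    using assms by (auto simp: equiv_def refl_on_def sym_def)
  then show ?thesis
    unfolding gen_equiv_def R(1) rtrancl_trancl_reflcl trancl_id[OF R(2)] by auto
qed

text \<open>Identities, inverses and composites make the generating relation \<open>R\<close> of the
  colimit an equivalence, so the points of the colimit are the orbits, and finiteness is that of a
  set of orbit representatives.\<close>

lemma fin_gen_iff:
  assumes "groupoid C" "set_functor C X"
  shows "fin_gen C X \<longleftrightarrow> (\<exists>F. finite F \<and> F \<subseteq> Sigma (Ob C) (Val X) \<and>
    (\<forall>a\<in>Ob C. \<forall>x\<in>Val X a. \<exists>(b, y)\<in>F. \<exists>f\<in>Ar C. Src C f = b \<and> Tgt C f = a \<and> x = Act X f y))"
    (is "_ \<longleftrightarrow> ?R")
proof -
  interpret groupoid C by fact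
  interpret set_functor C X by fact
  define A where "A = Sigma (Ob C) (Val X)"
  define R where "R = {((Src C f, x), (Tgt C f, Act X f x)) | f x. f \<in> Ar C \<and> x \<in> Val X (Src C f)}"
  have R: "equiv A R"
  proof (rule equivI)
    show "R \<subseteq> A \<times> A"
      by (auto simp: A_def R_def)
    show "refl_on A R"
    proof (rule refl_onI)
      fix t assume "t \<in> A"
      then obtain a x where "t = (a, x)" "a \<in> Ob C" "x \<in> Val X a"
        by (auto simp: A_def)
      then show "(t, t) \<in> R"
        by (auto simp: R_def intro!: exI[of _ "Idt C a"])
    qed
    show "sym R"
    proof (rule symI)
      fix s t assume "(s, t) \<in> R"
      then obtain f x where "f \<in> Ar C" "x \<in> Val X (Src C f)" "s = (Src C f, x)" "t = (Tgt C f, Act X f x)"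
        by (auto simp: R_def)
      then show "(t, s) \<in> R"
        by (auto simp: R_def intro!: exI[of _ "inv_arrow C f"])
    qed
    show "trans R"
    proof (rule transI)
      fix r s t assume "(r, s) \<in> R" "(s, t) \<in> R"
      then obtain f g x where "f \<in> Ar C" "g \<in> Ar C" "x \<in> Val X (Src C f)" "Src C g = Tgt C f"
        "r = (Src C f, x)" "t = (Tgt C g, Act X g (Act X f x))"
        by (auto simp: R_def)
      then show "(r, t) \<in> R"
        by (auto simp: R_def intro!: exI[of _ "g \<cdot>\<^bsub>C\<^esub> f"])
    qed
  qed
  have colim: "set_colim C X = A // R"
    using gen_equiv_eq[OF R] by (simp add: set_colim_def A_def R_def)
  have R_iff: "(t, (a, x)) \<in> R \<longleftrightarrow> t \<in> A \<and> (\<exists>f\<in>Ar C. Src C f = fst t \<and> Tgt C f = a \<and> x = Act X f (snd t))" for t a x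
    by (cases t) (auto simp: R_def A_def)
  show ?thesis
  proof
    assume "fin_gen C X"
    then have fin: "finite (A // R)"
      by (simp add: fin_gen_def colim)
    \<comment> \<open>One representative of each orbit; \<open>F\<close> is finite as an image of
      the finite quotient.\<close>
    define F where "F = (\<lambda>c. SOME t. t \<in> c) ` (A // R)"
    have rep: "(SOME t. t \<in> c) \<in> c" if "c \<in> A // R" for c
      using in_quotient_imp_non_empty[OF R that] by (simp add: some_in_eq)
    have "F \<subseteq> A"
      using rep in_quotient_imp_subset[OF R] unfolding F_def by blast
    moreover have "\<exists>t\<in>F. (t, s) \<in> R" if "s \<in> A" for s
    proof -
      have c: "R `` {s} \<in> A // R"
        using that by (rule quotientI)
      from rep[OF c] have "((SOME t. t \<in> R `` {s}), s) \<in> R"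
        using R by (meson Image_singleton_iff equivE symD)
      with c show ?thesis
        unfolding F_def by blast
    qed
    ultimately show ?R
      using fin by (intro exI[of _ F]) (force simp: A_def R_iff F_def)
  next
    assume ?R
    then obtain F where F: "finite F" "F \<subseteq> A" and gen: "\<forall>a\<in>Ob C. \<forall>x\<in>Val X a.
        \<exists>(b, y)\<in>F. \<exists>f\<in>Ar C. Src C f = b \<and> Tgt C f = a \<and> x = Act X f y"
      unfolding A_def by blast
    have R_F: "\<exists>t\<in>F. (t, s) \<in> R" if s: "s \<in> A" for s
    proof -
      obtain a x where ax: "s = (a, x)" "a \<in> Ob C" "x \<in> Val X a"
        using s by (auto simp: A_def)
      then obtain b y f where "(b, y) \<in> F" "f \<in> Ar C" "Src C f = b" "Tgt C f = a" "x = Act X f y"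
        using gen by blast
      then show ?thesis
        using F(2) ax(1) by (intro bexI[of _ "(b, y)"]) (auto simp: R_iff)
    qed
    \<comment> \<open>Conversely, each orbit is the class of some member of \<open>F\<close>, so the
      finite set \<open>F\<close> bounds the number of orbits.\<close>
    have "A // R \<subseteq> (\<lambda>t. R `` {t}) ` F"
    proof
      fix c assume "c \<in> A // R"
      then obtain s where s: "s \<in> A" "c = R `` {s}"
        by (auto elim: quotientE)
      then obtain t where "t \<in> F" "(t, s) \<in> R"
        using R_F by blast
      then show "c \<in> (\<lambda>t. R `` {t}) ` F"
        using equiv_class_eq[OF R \<open>(t, s) \<in> R\<close>] s(2) by blast
    qed
    then show "fin_gen C X"
      using F(1) by (auto simp: fin_gen_def colim intro: finite_subset)
  qed
qed

section \<open>Bi-sets\<close>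

locale biset = H: groupoid H + G: groupoid G for H G :: "'u grpd" +
  fixes X :: "'u biset"
  assumes biset: "X \<in> bisets H G"
begin

sublocale X: set_functor "bicar H G" X
  using biset by (simp add: bisets_def set_functors_def)

lemma act [simp]:
  "\<lbrakk>h \<in> Ar H; g \<in> Ar G; x \<in> Val X (Tgt H h, Src G g); Src H h = \<eta>; Tgt G g = \<gamma>\<rbrakk>
    \<Longrightarrow> Act X (h, g) x \<in> Val X (\<eta>, \<gamma>)"
  by simp

lemma act_id [simp]:
  "\<lbrakk>\<eta> \<in> Ob H; \<gamma> \<in> Ob G; x \<in> Val X (\<eta>, \<gamma>)\<rbrakk> \<Longrightarrow> Act X (Idt H \<eta>, Idt G \<gamma>) x = x"
  using X.act_id[of "(\<eta>, \<gamma>)" x] by simp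

lemma act_act [simp]:
  "\<lbrakk>h \<in> Ar H; g \<in> Ar G; h' \<in> Ar H; g' \<in> Ar G; Tgt H h' = Src H h; Tgt G g = Src G g';
     x \<in> Val X (Tgt H h, Src G g)\<rbrakk>
    \<Longrightarrow> Act X (h', g') (Act X (h, g) x) = Act X (h \<cdot>\<^bsub>H\<^esub> h', g' \<cdot>\<^bsub>G\<^esub> g) x"
  by simp

lemma set_functor_left_part:
  assumes "\<eta> \<in> Ob H"
  shows "set_functor G (left_part H X \<eta>)"
  by (rule set_functorI) (use assms in \<open>auto simp: left_part_def G.category_axioms\<close>)

text \<open>Unfolds \<open>left_part\<close> and trades the colimit for a finite generating family,
  so that later arguments deal with arrows and elements only.\<close>

lemma admissible_iff:
  "admissible H G X \<longleftrightarrow> (\<forall>\<eta>\<in>Ob H.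
    (\<forall>g\<in>Ar G. \<forall>g'\<in>Ar G. \<forall>x\<in>Val X (\<eta>, Src G g). Src G g = Src G g' \<longrightarrow> Tgt G g = Tgt G g' \<longrightarrow>
      Act X (Idt H \<eta>, g) x = Act X (Idt H \<eta>, g') x \<longrightarrow> g = g') \<and>
    (\<exists>F. finite F \<and> F \<subseteq> (SIGMA \<gamma>:Ob G. Val X (\<eta>, \<gamma>)) \<and>
      (\<forall>\<gamma>\<in>Ob G. \<forall>x\<in>Val X (\<eta>, \<gamma>). \<exists>(\<gamma>', y)\<in>F. \<exists>g\<in>Ar G. Src G g = \<gamma>' \<and> Tgt G g = \<gamma> \<and>
        x = Act X (Idt H \<eta>, g) y)))"
proof -
  have "free_set G (left_part H X \<eta>) \<longleftrightarrow>
    (\<forall>g\<in>Ar G. \<forall>g'\<in>Ar G. \<forall>x\<in>Val X (\<eta>, Src G g). Src G g = Src G g' \<longrightarrow> Tgt G g = Tgt G g' \<longrightarrow>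
      Act X (Idt H \<eta>, g) x = Act X (Idt H \<eta>, g') x \<longrightarrow> g = g')" for \<eta>
    by (force simp: free_set_def left_part_def inj_on_def homset_iff)
  moreover have "fin_gen G (left_part H X \<eta>) \<longleftrightarrow>
    (\<exists>F. finite F \<and> F \<subseteq> (SIGMA \<gamma>:Ob G. Val X (\<eta>, \<gamma>)) \<and>
      (\<forall>\<gamma>\<in>Ob G. \<forall>x\<in>Val X (\<eta>, \<gamma>). \<exists>(\<gamma>', y)\<in>F. \<exists>g\<in>Ar G. Src G g = \<gamma>' \<and> Tgt G g = \<gamma> \<and>
        x = Act X (Idt H \<eta>, g) y))" if "\<eta> \<in> Ob H" for \<eta>
    by (subst fin_gen_iff[OF G.groupoid_axioms set_functor_left_part[OF that]])
      (simp add: left_part_def)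
  ultimately show ?thesis
    by (simp add: admissible_def)
qed

lemma admissible_free:
  "\<lbrakk>admissible H G X; \<eta> \<in> Ob H; g \<in> Ar G; g' \<in> Ar G; Src G g = Src G g'; Tgt G g = Tgt G g';
     x \<in> Val X (\<eta>, Src G g); Act X (Idt H \<eta>, g) x = Act X (Idt H \<eta>, g') x\<rbrakk> \<Longrightarrow> g = g'"
  unfolding admissible_iff by blast

end

text \<open>Tensor products, identity bi-sets, S(p) and T(p) are all trimmed versions of raw total
  functions. The bi-set laws have to hold only on the domain, where trimming changes
  nothing.\<close>

lemma trim_bisets:
  assumes "groupoid H" "groupoid G"
    and "\<And>h g x. \<lbrakk>h \<in> Ar H; g \<in> Ar G; x \<in> V (Tgt H h, Src G g)\<rbrakk> \<Longrightarrow> A (h, g) x \<in> V (Src H h, Tgt G g)"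
    and "\<And>\<eta> \<gamma> x. \<lbrakk>\<eta> \<in> Ob H; \<gamma> \<in> Ob G; x \<in> V (\<eta>, \<gamma>)\<rbrakk> \<Longrightarrow> A (Idt H \<eta>, Idt G \<gamma>) x = x"
    and "\<And>h g h' g' x. \<lbrakk>h \<in> Ar H; g \<in> Ar G; h' \<in> Ar H; g' \<in> Ar G; Tgt H h' = Src H h;
        Tgt G g = Src G g'; x \<in> V (Tgt H h, Src G g)\<rbrakk>
      \<Longrightarrow> A (h \<cdot>\<^bsub>H\<^esub> h', g' \<cdot>\<^bsub>G\<^esub> g) x = A (h', g') (A (h, g) x)"
  shows "biset H G (cset_trim (bicar H G) \<lparr>Val = V, Act = A\<rparr>)"
proof -
  interpret H: groupoid H by fact
  interpret G: groupoid G by fact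
  have "set_functor (bicar H G) \<lparr>Val = V, Act = A\<rparr>"
  proof (rule set_functorI)
    show "category (bicar H G)"
      by (simp add: category_prod_cat category_op_cat H.category_axioms G.category_axioms)
  qed (use assms in auto)
  then show ?thesis
    by unfold_locales (simp add: bisets_def set_functor_trim)
qed

section \<open>The tensor product of bi-sets\<close>

locale tensor_pair = X: biset H G X + Y: biset K H Y
  for K H G :: "'u::infinite grpd" and X Y :: "'u biset"
begin

definition pts :: "'u \<Rightarrow> 'u \<Rightarrow> ('u \<times> 'u \<times> 'u) set" where
  "pts \<kappa> \<gamma> = (SIGMA \<eta>:Ob H. Val X (\<eta>, \<gamma>) \<times> Val Y (\<kappa>, \<eta>))"

text \<open>As \<open>H\<close> is a groupoid, the generating relation of the tensor product is already an
  equivalence relation.\<close>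

definition rel :: "'u \<Rightarrow> 'u \<Rightarrow> (('u \<times> 'u \<times> 'u) \<times> ('u \<times> 'u \<times> 'u)) set" where
  "rel \<kappa> \<gamma> = {((Src H h, Act X (h, Idt G \<gamma>) x, y), (Tgt H h, x, Act Y (Idt K \<kappa>, h) y)) | h x y.
    h \<in> Ar H \<and> x \<in> Val X (Tgt H h, \<gamma>) \<and> y \<in> Val Y (\<kappa>, Src H h)}"

lemma relI:
  "\<lbrakk>h \<in> Ar H; x' \<in> Val X (Tgt H h, \<gamma>); y \<in> Val Y (\<kappa>, Src H h); \<eta> = Src H h; \<eta>' = Tgt H h;
     x = Act X (h, Idt G \<gamma>) x'; y' = Act Y (Idt K \<kappa>, h) y\<rbrakk> \<Longrightarrow> ((\<eta>, x, y), (\<eta>', x', y')) \<in> rel \<kappa> \<gamma>"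
  unfolding rel_def by blast

lemma relE:
  assumes "(s, t) \<in> rel \<kappa> \<gamma>"
  obtains h x y where "h \<in> Ar H" "x \<in> Val X (Tgt H h, \<gamma>)" "y \<in> Val Y (\<kappa>, Src H h)"
    "s = (Src H h, Act X (h, Idt G \<gamma>) x, y)" "t = (Tgt H h, x, Act Y (Idt K \<kappa>, h) y)"
  using assms unfolding rel_def by blast

text \<open>A slide along \<open>h\<close> is undone by one along its inverse, and consecutive
  slides along \<open>h\<close> and \<open>h'\<close> amount to one along their composite.\<close>

lemma equiv_rel:
  assumes "\<kappa> \<in> Ob K" "\<gamma> \<in> Ob G"
  shows "equiv (pts \<kappa> \<gamma>) (rel \<kappa> \<gamma>)"
proof (rule equivI)
  show "rel \<kappa> \<gamma> \<subseteq> pts \<kappa> \<gamma> \<times> pts \<kappa> \<gamma>"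
    using assms by (auto simp: rel_def pts_def)
  show "refl_on (pts \<kappa> \<gamma>) (rel \<kappa> \<gamma>)"
  proof (rule refl_onI)
    fix t assume "t \<in> pts \<kappa> \<gamma>"
    then obtain \<eta> x y where "t = (\<eta>, x, y)" "\<eta> \<in> Ob H" "x \<in> Val X (\<eta>, \<gamma>)" "y \<in> Val Y (\<kappa>, \<eta>)"
      by (auto simp: pts_def)
    then show "(t, t) \<in> rel \<kappa> \<gamma>"
      using assms by (auto intro!: relI[of "Idt H \<eta>"])
  qed
  show "sym (rel \<kappa> \<gamma>)"
  proof (rule symI, elim relE)
    fix s t h x y
    assume "h \<in> Ar H" "x \<in> Val X (Tgt H h, \<gamma>)" "y \<in> Val Y (\<kappa>, Src H h)"
      "s = (Src H h, Act X (h, Idt G \<gamma>) x, y)" "t = (Tgt H h, x, Act Y (Idt K \<kappa>, h) y)"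
    then show "(t, s) \<in> rel \<kappa> \<gamma>"
      using assms by (auto intro!: relI[of "inv_arrow H h"])
  qed
  show "trans (rel \<kappa> \<gamma>)"
  proof (rule transI)
    fix r s t assume "(r, s) \<in> rel \<kappa> \<gamma>" "(s, t) \<in> rel \<kappa> \<gamma>"
    then obtain h h' x y where "h \<in> Ar H" "h' \<in> Ar H" "Src H h' = Tgt H h" "x \<in> Val X (Tgt H h', \<gamma>)"
      "y \<in> Val Y (\<kappa>, Src H h)" "r = (Src H h, Act X (h, Idt G \<gamma>) (Act X (h', Idt G \<gamma>) x), y)"
      "t = (Tgt H h', x, Act Y (Idt K \<kappa>, h') (Act Y (Idt K \<kappa>, h) y))"
      by (auto elim!: relE)
    then show "(r, t) \<in> rel \<kappa> \<gamma>"
      using assms by (auto intro!: relI[of "h' \<cdot>\<^bsub>H\<^esub> h"])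
  qed
qed

lemma tensor_rel_eq:
  assumes "\<kappa> \<in> Ob K" "\<gamma> \<in> Ob G"
  shows "tensor_pts H (right_part G X \<gamma>) (left_part K Y \<kappa>) = pts \<kappa> \<gamma>"
    "tensor_rel H (right_part G X \<gamma>) (left_part K Y \<kappa>) = rel \<kappa> \<gamma>"
proof -
  show pts: "tensor_pts H (right_part G X \<gamma>) (left_part K Y \<kappa>) = pts \<kappa> \<gamma>"
    by (simp add: tensor_pts_def pts_def right_part_def left_part_def)
  show "tensor_rel H (right_part G X \<gamma>) (left_part K Y \<kappa>) = rel \<kappa> \<gamma>"
    using gen_equiv_eq[OF equiv_rel[OF assms]]
    unfolding tensor_rel_def pts by (simp add: rel_def right_part_def left_part_def)
qed

lemma tens_eq: "\<kappa> \<in> Ob K \<Longrightarrow> \<gamma> \<in> Ob G \<Longrightarrow> tens K H G X Y \<kappa> \<gamma> t = code_class (rel \<kappa> \<gamma> `` {t})"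
  by (simp add: tens_def tensor_class_def tensor_rel_eq)

text \<open>The only fact about the choice made in \<open>code_class\<close> that later arguments
  use: the decoded triple is related to the encoded one.\<close>

lemma class_rep_tens:
  assumes "\<kappa> \<in> Ob K" "\<gamma> \<in> Ob G" "t \<in> pts \<kappa> \<gamma>"
  shows "(t, class_rep (tens K H G X Y \<kappa> \<gamma> t)) \<in> rel \<kappa> \<gamma>"
proof -
  have "rel \<kappa> \<gamma> `` {t} \<noteq> {}"
    using equiv_class_self[OF equiv_rel] assms by blast
  from class_rep_code_class[OF this] show ?thesis
    using assms by (simp add: tens_eq)
qed

text \<open>Equal codes decode to one and the same triple, which is related to both \<open>s\<close>
  and \<open>t\<close>.\<close>

lemma tens_eq_iff_rel:
  assumes "\<kappa> \<in> Ob K" "\<gamma> \<in> Ob G" "s \<in> pts \<kappa> \<gamma>" "t \<in> pts \<kappa> \<gamma>"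
  shows "tens K H G X Y \<kappa> \<gamma> s = tens K H G X Y \<kappa> \<gamma> t \<longleftrightarrow> (s, t) \<in> rel \<kappa> \<gamma>"
proof
  assume "tens K H G X Y \<kappa> \<gamma> s = tens K H G X Y \<kappa> \<gamma> t"
  then have "(s, class_rep (tens K H G X Y \<kappa> \<gamma> t)) \<in> rel \<kappa> \<gamma>"
    "(t, class_rep (tens K H G X Y \<kappa> \<gamma> t)) \<in> rel \<kappa> \<gamma>"
    using class_rep_tens[OF assms(1,2)] assms(3,4) by metis+
  then show "(s, t) \<in> rel \<kappa> \<gamma>"
    using equiv_rel[OF assms(1,2)] by (meson equivE symD transD)
next
  assume "(s, t) \<in> rel \<kappa> \<gamma>"
  then show "tens K H G X Y \<kappa> \<gamma> s = tens K H G X Y \<kappa> \<gamma> t"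
    using assms(1,2) equiv_class_eq[OF equiv_rel] by (simp add: tens_eq)
qed

lemma tens_eq_iff:
  assumes "\<kappa> \<in> Ob K" "\<gamma> \<in> Ob G" "\<eta> \<in> Ob H" "x \<in> Val X (\<eta>, \<gamma>)" "y \<in> Val Y (\<kappa>, \<eta>)"
    "\<eta>' \<in> Ob H" "x' \<in> Val X (\<eta>', \<gamma>)" "y' \<in> Val Y (\<kappa>, \<eta>')"
  shows "tens K H G X Y \<kappa> \<gamma> (\<eta>, x, y) = tens K H G X Y \<kappa> \<gamma> (\<eta>', x', y') \<longleftrightarrow>
    (\<exists>h\<in>Ar H. Src H h = \<eta> \<and> Tgt H h = \<eta>' \<and> x = Act X (h, Idt G \<gamma>) x' \<and> y' = Act Y (Idt K \<kappa>, h) y)"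
  using assms by (subst tens_eq_iff_rel) (auto simp: pts_def rel_def)

lemma tens_slide:
  assumes "\<kappa> \<in> Ob K" "\<gamma> \<in> Ob G" "h \<in> Ar H" "x \<in> Val X (Tgt H h, \<gamma>)" "y \<in> Val Y (\<kappa>, Src H h)"
  shows "tens K H G X Y \<kappa> \<gamma> (Src H h, Act X (h, Idt G \<gamma>) x, y)
    = tens K H G X Y \<kappa> \<gamma> (Tgt H h, x, Act Y (Idt K \<kappa>, h) y)"
  using assms by (subst tens_eq_iff) auto

text \<open>The decoded triple differs from \<open>(\<eta>, x, y)\<close> by a single slide, under
  which \<open>F\<close> is invariant. Every operation on tensor products is evaluated through this
  rule.\<close>

lemma tens_case:
  assumes "\<kappa> \<in> Ob K" "\<gamma> \<in> Ob G" "\<eta> \<in> Ob H" "x \<in> Val X (\<eta>, \<gamma>)" "y \<in> Val Y (\<kappa>, \<eta>)"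
    and "\<And>h x y. \<lbrakk>h \<in> Ar H; x \<in> Val X (Tgt H h, \<gamma>); y \<in> Val Y (\<kappa>, Src H h)\<rbrakk>
      \<Longrightarrow> F (Src H h) (Act X (h, Idt G \<gamma>) x) y = F (Tgt H h) x (Act Y (Idt K \<kappa>, h) y)"
  shows "(case class_rep (tens K H G X Y \<kappa> \<gamma> (\<eta>, x, y)) of (\<eta>, x, y) \<Rightarrow> F \<eta> x y) = F \<eta> x y"
proof -
  have "((\<eta>, x, y), class_rep (tens K H G X Y \<kappa> \<gamma> (\<eta>, x, y))) \<in> rel \<kappa> \<gamma>"
    using assms(1-5) by (intro class_rep_tens) (auto simp: pts_def)
  then show ?thesis
    using assms(6) by (auto elim!: relE)
qed

lemma Val_tensor:
  assumes "\<kappa> \<in> Ob K" "\<gamma> \<in> Ob G"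
  shows "Val (tensor K H G X Y) (\<kappa>, \<gamma>) = tens K H G X Y \<kappa> \<gamma> ` pts \<kappa> \<gamma>"
proof -
  have "Val (tensor K H G X Y) (\<kappa>, \<gamma>) = code_class ` (pts \<kappa> \<gamma> // rel \<kappa> \<gamma>)"
    using assms by (simp add: tensor_def tensor_set_def tensor_rel_eq)
  also have "\<dots> = tens K H G X Y \<kappa> \<gamma> ` pts \<kappa> \<gamma>"
    using assms by (auto simp: tens_eq quotient_def)
  finally show ?thesis .
qed

lemma tens_val [simp]:
  "\<lbrakk>\<kappa> \<in> Ob K; \<gamma> \<in> Ob G; \<eta> \<in> Ob H; x \<in> Val X (\<eta>, \<gamma>); y \<in> Val Y (\<kappa>, \<eta>)\<rbrakk>
    \<Longrightarrow> tens K H G X Y \<kappa> \<gamma> (\<eta>, x, y) \<in> Val (tensor K H G X Y) (\<kappa>, \<gamma>)"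
  by (auto simp: Val_tensor pts_def)

lemma tensE:
  assumes "z \<in> Val (tensor K H G X Y) (\<kappa>, \<gamma>)" "\<kappa> \<in> Ob K" "\<gamma> \<in> Ob G"
  obtains \<eta> x y where "\<eta> \<in> Ob H" "x \<in> Val X (\<eta>, \<gamma>)" "y \<in> Val Y (\<kappa>, \<eta>)"
    "z = tens K H G X Y \<kappa> \<gamma> (\<eta>, x, y)"
  using assms by (auto simp: Val_tensor pts_def)

text \<open>Acting by \<open>k\<close> and \<open>g\<close> is compatible with sliding because the
  two actions on a bi-set commute. The bare \<open>case\<close> term is used since the rule also
  serves to prove that the tensor product is a bi-set.\<close>

lemma tens_act_case:
  assumes "k \<in> Ar K" "g \<in> Ar G" "\<eta> \<in> Ob H" "x \<in> Val X (\<eta>, Src G g)" "y \<in> Val Y (Tgt K k, \<eta>)"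
  shows "(case class_rep (tens K H G X Y (Tgt K k) (Src G g) (\<eta>, x, y)) of (\<eta>, x, y) \<Rightarrow>
      tens K H G X Y (Src K k) (Tgt G g) (\<eta>, Act X (Idt H \<eta>, g) x, Act Y (k, Idt H \<eta>) y))
    = tens K H G X Y (Src K k) (Tgt G g) (\<eta>, Act X (Idt H \<eta>, g) x, Act Y (k, Idt H \<eta>) y)"
proof (rule tens_case)
  fix h x y assume "h \<in> Ar H" "x \<in> Val X (Tgt H h, Src G g)" "y \<in> Val Y (Tgt K k, Src H h)"
  with assms show "tens K H G X Y (Src K k) (Tgt G g)
        (Src H h, Act X (Idt H (Src H h), g) (Act X (h, Idt G (Src G g)) x), Act Y (k, Idt H (Src H h)) y) =
       tens K H G X Y (Src K k) (Tgt G g)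
        (Tgt H h, Act X (Idt H (Tgt H h), g) x, Act Y (k, Idt H (Tgt H h)) (Act Y (Idt K (Tgt K k), h) y))"
    using tens_slide[of "Src K k" "Tgt G g" h "Act X (Idt H (Tgt H h), g) x" "Act Y (k, Idt H (Src H h)) y"]
    by simp
qed (use assms in simp_all)

lemma act_tens [simp]:
  assumes "k \<in> Ar K" "g \<in> Ar G" "\<eta> \<in> Ob H" "x \<in> Val X (\<eta>, \<gamma>)" "y \<in> Val Y (\<kappa>, \<eta>)"
    "Tgt K k = \<kappa>" "Src G g = \<gamma>"
  shows "Act (tensor K H G X Y) (k, g) (tens K H G X Y \<kappa> \<gamma> (\<eta>, x, y))
    = tens K H G X Y (Src K k) (Tgt G g) (\<eta>, Act X (Idt H \<eta>, g) x, Act Y (k, Idt H \<eta>) y)"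
proof -
  have "tens K H G X Y \<kappa> \<gamma> (\<eta>, x, y) \<in> Val (tensor K H G X Y) (\<kappa>, \<gamma>)"
    using assms by auto
  then have "Act (tensor K H G X Y) (k, g) (tens K H G X Y \<kappa> \<gamma> (\<eta>, x, y))
    = (case class_rep (tens K H G X Y \<kappa> \<gamma> (\<eta>, x, y)) of (\<eta>, x, y) \<Rightarrow>
      tens K H G X Y (Src K k) (Tgt G g) (\<eta>, Act X (Idt H \<eta>, g) x, Act Y (k, Idt H \<eta>) y))"
    using assms by (auto simp: tensor_def)
  then show ?thesis
    using tens_act_case[of k g \<eta> x y] assms by auto
qed

lemma biset_tensor: "biset K G (tensor K H G X Y)"
proof -
  let ?V = "\<lambda>(\<kappa>, \<gamma>). code_class ` tensor_set H (right_part G X \<gamma>) (left_part K Y \<kappa>)"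
  \<comment> \<open>\<open>trim_bisets\<close> speaks of the untrimmed values; over objects they
    agree with the trimmed ones, for which \<open>tensE\<close> supplies representatives.\<close>
  have V: "?V (\<kappa>, \<gamma>) = Val (tensor K H G X Y) (\<kappa>, \<gamma>)" if "\<kappa> \<in> Ob K" "\<gamma> \<in> Ob G" for \<kappa> \<gamma>
    using that by (simp add: tensor_def)
  show ?thesis
    unfolding tensor_def
  proof (rule trim_bisets)
    fix k g z assume *: "k \<in> Ar K" "g \<in> Ar G" "z \<in> ?V (Tgt K k, Src G g)"
    from * have "z \<in> Val (tensor K H G X Y) (Tgt K k, Src G g)"
      by (subst V[symmetric]) simp_all
    then obtain \<eta> x y where "\<eta> \<in> Ob H" "x \<in> Val X (\<eta>, Src G g)" "y \<in> Val Y (Tgt K k, \<eta>)"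
      "z = tens K H G X Y (Tgt K k) (Src G g) (\<eta>, x, y)"
      using * by (elim tensE) simp_all
    with * show "(case (k, g) of (k, g) \<Rightarrow> \<lambda>z. case class_rep z of (\<eta>, x, y) \<Rightarrow>
        tens K H G X Y (Src K k) (Tgt G g) (\<eta>, Act X (Idt H \<eta>, g) x, Act Y (k, Idt H \<eta>) y)) z
      \<in> ?V (Src K k, Tgt G g)"
      by (subst V) (simp_all add: tens_act_case)
  next
    fix \<kappa> \<gamma> z assume *: "\<kappa> \<in> Ob K" "\<gamma> \<in> Ob G" "z \<in> ?V (\<kappa>, \<gamma>)"
    then have "z \<in> Val (tensor K H G X Y) (\<kappa>, \<gamma>)"
      by (subst V[symmetric]) simp_all
    then obtain \<eta> x y where "\<eta> \<in> Ob H" "x \<in> Val X (\<eta>, \<gamma>)" "y \<in> Val Y (\<kappa>, \<eta>)"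
      "z = tens K H G X Y \<kappa> \<gamma> (\<eta>, x, y)"
      using * by (elim tensE) simp_all
    with * show "(case (Idt K \<kappa>, Idt G \<gamma>) of (k, g) \<Rightarrow> \<lambda>z. case class_rep z of (\<eta>, x, y) \<Rightarrow>
        tens K H G X Y (Src K k) (Tgt G g) (\<eta>, Act X (Idt H \<eta>, g) x, Act Y (k, Idt H \<eta>) y)) z = z"
      using tens_act_case[of "Idt K \<kappa>" "Idt G \<gamma>" \<eta> x y] by simp
  next
    fix k g k' g' z
    assume *: "k \<in> Ar K" "g \<in> Ar G" "k' \<in> Ar K" "g' \<in> Ar G" "Tgt K k' = Src K k" "Tgt G g = Src G g'"
      "z \<in> ?V (Tgt K k, Src G g)"
    then have "z \<in> Val (tensor K H G X Y) (Tgt K k, Src G g)"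
      by (subst V[symmetric]) simp_all
    then obtain \<eta> x y where "\<eta> \<in> Ob H" "x \<in> Val X (\<eta>, Src G g)" "y \<in> Val Y (Tgt K k, \<eta>)"
      "z = tens K H G X Y (Tgt K k) (Src G g) (\<eta>, x, y)"
      using * by (elim tensE) simp_all
    with * show "(case (k \<cdot>\<^bsub>K\<^esub> k', g' \<cdot>\<^bsub>G\<^esub> g) of (k, g) \<Rightarrow> \<lambda>z. case class_rep z of (\<eta>, x, y) \<Rightarrow>
        tens K H G X Y (Src K k) (Tgt G g) (\<eta>, Act X (Idt H \<eta>, g) x, Act Y (k, Idt H \<eta>) y)) z
      = (case (k', g') of (k, g) \<Rightarrow> \<lambda>z. case class_rep z of (\<eta>, x, y) \<Rightarrow>
        tens K H G X Y (Src K k) (Tgt G g) (\<eta>, Act X (Idt H \<eta>, g) x, Act Y (k, Idt H \<eta>) y))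
        ((case (k, g) of (k, g) \<Rightarrow> \<lambda>z. case class_rep z of (\<eta>, x, y) \<Rightarrow>
        tens K H G X Y (Src K k) (Tgt G g) (\<eta>, Act X (Idt H \<eta>, g) x, Act Y (k, Idt H \<eta>) y)) z)"
      using tens_act_case[of "k \<cdot>\<^bsub>K\<^esub> k'" "g' \<cdot>\<^bsub>G\<^esub> g" \<eta> x y] tens_act_case[of k g \<eta> x y]
        tens_act_case[of k' g' \<eta> "Act X (Idt H \<eta>, g) x" "Act Y (k, Idt H \<eta>) y"]
      by simp
  qed (rule Y.H.groupoid_axioms X.G.groupoid_axioms)+
qed

sublocale T: biset K G "tensor K H G X Y"
  by (rule biset_tensor)

lemma admissible_tensor:
  assumes X: "admissible H G X" and Y: "admissible K H Y"
  shows "admissible K G (tensor K H G X Y)"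
  unfolding T.admissible_iff
proof (intro ballI conjI impI)
  fix \<kappa> g g' z
  assume *: "\<kappa> \<in> Ob K" "g \<in> Ar G" "g' \<in> Ar G" "z \<in> Val (tensor K H G X Y) (\<kappa>, Src G g)"
    "Src G g = Src G g'" "Tgt G g = Tgt G g'"
    "Act (tensor K H G X Y) (Idt K \<kappa>, g) z = Act (tensor K H G X Y) (Idt K \<kappa>, g') z"
  then obtain \<eta> x y where z: "\<eta> \<in> Ob H" "x \<in> Val X (\<eta>, Src G g)" "y \<in> Val Y (\<kappa>, \<eta>)"
      "z = tens K H G X Y \<kappa> (Src G g) (\<eta>, x, y)"
    using * by (elim tensE) simp_all
  with * have "tens K H G X Y \<kappa> (Tgt G g) (\<eta>, Act X (Idt H \<eta>, g) x, y)
      = tens K H G X Y \<kappa> (Tgt G g) (\<eta>, Act X (Idt H \<eta>, g') x, y)"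
    by simp
  \<comment> \<open>Both pairs have the same second entry, so \<open>h\<close> is a loop at \<eta>
    that fixes \<open>y\<close>.\<close>
  then obtain h where h: "h \<in> Ar H" "Src H h = \<eta>" "Tgt H h = \<eta>" "y = Act Y (Idt K \<kappa>, h) y"
      "Act X (Idt H \<eta>, g) x = Act X (h, Idt G (Tgt G g)) (Act X (Idt H \<eta>, g') x)"
    using * z by (subst (asm) tens_eq_iff) auto
  have "Act Y (Idt K \<kappa>, h) y = Act Y (Idt K \<kappa>, Idt H \<eta>) y"
    using h(4) z *(1) by simp
  then have "h = Idt H \<eta>"
    by (rule Y.admissible_free[OF Y *(1) h(1), rotated -1]) (use h(2,3) z in simp_all)
  then have "Act X (Idt H \<eta>, g) x = Act X (Idt H \<eta>, g') x"
    using h(5) z * by simp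
  then show "g = g'"
    by (rule X.admissible_free[OF X z(1) *(2,3,5,6) z(2)])
next
  fix \<kappa> assume \<kappa>: "\<kappa> \<in> Ob K"
  obtain F where F: "finite F" "F \<subseteq> (SIGMA \<eta>:Ob H. Val Y (\<kappa>, \<eta>))"
    "\<And>\<eta> y. \<eta> \<in> Ob H \<Longrightarrow> y \<in> Val Y (\<kappa>, \<eta>) \<Longrightarrow>
      \<exists>(\<eta>', y')\<in>F. \<exists>h\<in>Ar H. Src H h = \<eta>' \<and> Tgt H h = \<eta> \<and> y = Act Y (Idt K \<kappa>, h) y'"
    using Y \<kappa> unfolding Y.admissible_iff by meson
  let ?P = "\<lambda>\<eta> E. finite E \<and> E \<subseteq> (SIGMA \<gamma>:Ob G. Val X (\<eta>, \<gamma>)) \<and>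
      (\<forall>\<gamma>\<in>Ob G. \<forall>x\<in>Val X (\<eta>, \<gamma>). \<exists>(\<gamma>', x')\<in>E. \<exists>g\<in>Ar G. Src G g = \<gamma>' \<and> Tgt G g = \<gamma> \<and>
        x = Act X (Idt H \<eta>, g) x')"
  have "\<forall>\<eta>\<in>Ob H. \<exists>E. ?P \<eta> E"
    using X unfolding X.admissible_iff by blast
  \<comment> \<open>A simultaneous choice of finite generating sets of \<open>X\<close> over all
    objects; only those over the finitely many objects that occur in \<open>F\<close> will enter
    \<open>D\<close>.\<close>
  then obtain E where "\<forall>\<eta>\<in>Ob H. ?P \<eta> (E \<eta>)"
    by (rule bchoice[THEN exE])
  then have E: "\<And>\<eta>. \<eta> \<in> Ob H \<Longrightarrow> finite (E \<eta>)"
    "\<And>\<eta>. \<eta> \<in> Ob H \<Longrightarrow> E \<eta> \<subseteq> (SIGMA \<gamma>:Ob G. Val X (\<eta>, \<gamma>))"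
    "\<And>\<eta> \<gamma> x. \<eta> \<in> Ob H \<Longrightarrow> \<gamma> \<in> Ob G \<Longrightarrow> x \<in> Val X (\<eta>, \<gamma>) \<Longrightarrow>
      \<exists>(\<gamma>', x')\<in>E \<eta>. \<exists>g\<in>Ar G. Src G g = \<gamma>' \<and> Tgt G g = \<gamma> \<and> x = Act X (Idt H \<eta>, g) x'"
    by blast+
  define D where "D = (\<Union>(\<eta>, y)\<in>F. (\<lambda>(\<gamma>, x). (\<gamma>, tens K H G X Y \<kappa> \<gamma> (\<eta>, x, y))) ` E \<eta>)"
  have "finite D"
    using F(1,2) E(1) by (auto simp: D_def)
  moreover have "D \<subseteq> (SIGMA \<gamma>:Ob G. Val (tensor K H G X Y) (\<kappa>, \<gamma>))"
    using F(2) E(2) \<kappa> by (fastforce simp: D_def)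
  moreover have "\<exists>(\<gamma>', w)\<in>D. \<exists>g\<in>Ar G. Src G g = \<gamma>' \<and> Tgt G g = \<gamma> \<and> z = Act (tensor K H G X Y) (Idt K \<kappa>, g) w"
    if \<gamma>: "\<gamma> \<in> Ob G" and z: "z \<in> Val (tensor K H G X Y) (\<kappa>, \<gamma>)" for \<gamma> z
  proof -
    obtain \<eta> x y where xy: "\<eta> \<in> Ob H" "x \<in> Val X (\<eta>, \<gamma>)" "y \<in> Val Y (\<kappa>, \<eta>)"
      "z = tens K H G X Y \<kappa> \<gamma> (\<eta>, x, y)"
      using z \<kappa> \<gamma> by (rule tensE)
    then obtain y' h where h: "(Src H h, y') \<in> F" "h \<in> Ar H" "Tgt H h = \<eta>" "y = Act Y (Idt K \<kappa>, h) y'"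
      using F(3)[of \<eta> y] by auto
    have y': "y' \<in> Val Y (\<kappa>, Src H h)"
      using h F(2) by auto
    have "Act X (h, Idt G \<gamma>) x \<in> Val X (Src H h, \<gamma>)"
      using h xy \<gamma> by simp
    then obtain x' g where g: "(Src G g, x') \<in> E (Src H h)" "g \<in> Ar G" "Tgt G g = \<gamma>"
      "Act X (h, Idt G \<gamma>) x = Act X (Idt H (Src H h), g) x'"
      using E(3)[of "Src H h" \<gamma> "Act X (h, Idt G \<gamma>) x"] h \<gamma> by auto
    have x': "x' \<in> Val X (Src H h, Src G g)"
      using E(2)[of "Src H h"] g h by auto
    \<comment> \<open>Sliding \<open>h\<close> back onto \<open>x\<close> leaves the generator
      \<open>y'\<close> in second place. The new first entry is obtained by \<open>g\<close> from a
      generator \<open>x'\<close> over the source of \<open>h\<close>, and \<open>g\<close> then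
      acts on the whole class.\<close>
    have "z = tens K H G X Y \<kappa> \<gamma> (Src H h, Act X (h, Idt G \<gamma>) x, y')"
      using tens_slide[of \<kappa> \<gamma> h x y'] h xy \<kappa> \<gamma> y' by simp
    also have "\<dots> = Act (tensor K H G X Y) (Idt K \<kappa>, g) (tens K H G X Y \<kappa> (Src G g) (Src H h, x', y'))"
      using g h \<kappa> x' y' by simp
    finally have "z = \<dots>" .
    moreover have "(Src G g, tens K H G X Y \<kappa> (Src G g) (Src H h, x', y')) \<in> D"
      unfolding D_def using h(1) g(1) by (force intro!: UN_I[of "(Src H h, y')"])
    ultimately show ?thesis
      using g(2,3) by auto
  qed
  ultimately show "\<exists>F. finite F \<and> F \<subseteq> (SIGMA \<gamma>:Ob G. Val (tensor K H G X Y) (\<kappa>, \<gamma>)) \<and>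
      (\<forall>\<gamma>\<in>Ob G. \<forall>x\<in>Val (tensor K H G X Y) (\<kappa>, \<gamma>). \<exists>(\<gamma>', y)\<in>F. \<exists>g\<in>Ar G. Src G g = \<gamma>' \<and> Tgt G g = \<gamma> \<and>
        x = Act (tensor K H G X Y) (Idt K \<kappa>, g) y)"
    by (intro exI[of _ D]) simp
qed

end

section \<open>Isomorphisms of bi-sets\<close>

lemma mk_map_simps [simp]:
  "csrc (mk_map H G X Y t) = X" "ctgt (mk_map H G X Y t) = Y"
  "\<lbrakk>\<eta> \<in> Ob H; \<gamma> \<in> Ob G; x \<in> Val X (\<eta>, \<gamma>)\<rbrakk> \<Longrightarrow> cmpt (mk_map H G X Y t) (\<eta>, \<gamma>) x = t \<eta> \<gamma> x"
  by (simp_all add: mk_map_def)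

lemma mk_map_cong:
  assumes "\<And>\<eta> \<gamma> x. \<lbrakk>\<eta> \<in> Ob H; \<gamma> \<in> Ob G; x \<in> Val X (\<eta>, \<gamma>)\<rbrakk> \<Longrightarrow> s \<eta> \<gamma> x = t \<eta> \<gamma> x"
  shows "mk_map H G X Y s = mk_map H G X Y t"
  using assms by (auto simp: mk_map_def intro!: restrict_ext)

locale biset_iso = X: biset H G X + Y: biset H G Y for H G :: "'u grpd" and X Y +
  fixes t :: "'u biset_map"
  assumes iso: "t \<in> biset_isos H G" and csrc: "csrc t = X" and ctgt: "ctgt t = Y"
begin

lemma bij: "\<eta> \<in> Ob H \<Longrightarrow> \<gamma> \<in> Ob G \<Longrightarrow> bij_betw (cmpt t (\<eta>, \<gamma>)) (Val X (\<eta>, \<gamma>)) (Val Y (\<eta>, \<gamma>))"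
  using iso by (auto simp: biset_isos_def csrc ctgt)

lemma map_val [simp]:
  "\<lbrakk>\<eta> \<in> Ob H; \<gamma> \<in> Ob G; x \<in> Val X (\<eta>, \<gamma>)\<rbrakk> \<Longrightarrow> cmpt t (\<eta>, \<gamma>) x \<in> Val Y (\<eta>, \<gamma>)"
  using bij bij_betwE by blast

lemma map_act [simp]:
  "\<lbrakk>h \<in> Ar H; g \<in> Ar G; x \<in> Val X (Tgt H h, Src G g); Src H h = \<eta>; Tgt G g = \<gamma>\<rbrakk>
    \<Longrightarrow> cmpt t (\<eta>, \<gamma>) (Act X (h, g) x) = Act Y (h, g) (cmpt t (Tgt H h, Src G g) x)"
  using iso by (auto simp: biset_isos_def csrc ctgt)

lemma map_inj:
  "\<lbrakk>\<eta> \<in> Ob H; \<gamma> \<in> Ob G; x \<in> Val X (\<eta>, \<gamma>); x' \<in> Val X (\<eta>, \<gamma>)\<rbrakk>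
    \<Longrightarrow> cmpt t (\<eta>, \<gamma>) x = cmpt t (\<eta>, \<gamma>) x' \<longleftrightarrow> x = x'"
  using bij by (meson bij_betw_imp_inj_on inj_on_eq_iff)

lemma map_surj:
  assumes "\<eta> \<in> Ob H" "\<gamma> \<in> Ob G" "y \<in> Val Y (\<eta>, \<gamma>)"
  obtains x where "x \<in> Val X (\<eta>, \<gamma>)" "y = cmpt t (\<eta>, \<gamma>) x"
  using bij[of \<eta> \<gamma>] assms by (auto simp: bij_betw_def)

text \<open>Membership in \<open>biset_isos\<close> imposes extensionality both in the object and in
  the element, which are exactly the two restrictions that \<open>mk_map\<close> performs.\<close>

lemma mk_map_eta: "mk_map H G X Y (\<lambda>\<eta> \<gamma>. cmpt t (\<eta>, \<gamma>)) = t"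
proof -
  have "cmpt t \<in> extensional (Ob (bicar H G))"
    "\<And>c. c \<in> Ob (bicar H G) \<Longrightarrow> cmpt t c \<in> extensional (Val X c)"
    using iso by (auto simp: biset_isos_def csrc)
  then have "(\<lambda>c\<in>Ob (bicar H G). restrict (cmpt t c) (Val X c)) = cmpt t"
    by (intro extensionalityI[of _ "Ob (bicar H G)"]) (auto simp: extensional_restrict)
  then show ?thesis
    using csrc ctgt by (cases t) (simp add: mk_map_def)
qed

end

lemma biset_iso_eqI:
  assumes "biset_iso H G X Y s" "biset_iso H G X Y t"
    and "\<And>\<eta> \<gamma> x. \<lbrakk>\<eta> \<in> Ob H; \<gamma> \<in> Ob G; x \<in> Val X (\<eta>, \<gamma>)\<rbrakk> \<Longrightarrow> cmpt s (\<eta>, \<gamma>) x = cmpt t (\<eta>, \<gamma>) x"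
  shows "s = t"
  using mk_map_cong[of H G X "\<lambda>\<eta> \<gamma>. cmpt s (\<eta>, \<gamma>)" "\<lambda>\<eta> \<gamma>. cmpt t (\<eta>, \<gamma>)" Y] assms
  by (simp add: biset_iso.mk_map_eta)

lemma biset_isoI:
  assumes "biset H G X" "biset H G Y"
    and bij: "\<And>\<eta> \<gamma>. \<lbrakk>\<eta> \<in> Ob H; \<gamma> \<in> Ob G\<rbrakk> \<Longrightarrow> bij_betw (t \<eta> \<gamma>) (Val X (\<eta>, \<gamma>)) (Val Y (\<eta>, \<gamma>))"
    and natural: "\<And>h g x. \<lbrakk>h \<in> Ar H; g \<in> Ar G; x \<in> Val X (Tgt H h, Src G g)\<rbrakk>
      \<Longrightarrow> t (Src H h) (Tgt G g) (Act X (h, g) x) = Act Y (h, g) (t (Tgt H h) (Src G g) x)"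
  shows "biset_iso H G X Y (mk_map H G X Y t)"
proof -
  interpret X: biset H G X by fact
  interpret Y: biset H G Y by fact
  have "mk_map H G X Y t \<in> biset_isos H G"
    using natural bij X.biset Y.biset bij_betw_cong[of "Val X c" "restrict s (Val X c)" s for c s]
    by (auto simp: biset_isos_def mk_map_def)
  then show ?thesis
    by unfold_locales simp_all
qed

section \<open>The groupoids of bi-sets\<close>

lemma burnside_hom_simps [simp]:
  "Src (burnside_hom H G) = csrc" "Tgt (burnside_hom H G) = ctgt"
  "csrc (Idt (burnside_hom H G) X) = X" "ctgt (Idt (burnside_hom H G) X) = X"
  "csrc (t \<cdot>\<^bsub>burnside_hom H G\<^esub> s) = csrc s" "ctgt (t \<cdot>\<^bsub>burnside_hom H G\<^esub> s) = ctgt t"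
  by (simp_all add: burnside_hom_def)

lemma burnside_idt_cmpt [simp]:
  "\<lbrakk>\<eta> \<in> Ob H; \<gamma> \<in> Ob G; x \<in> Val X (\<eta>, \<gamma>)\<rbrakk> \<Longrightarrow> cmpt (Idt (burnside_hom H G) X) (\<eta>, \<gamma>) x = x"
  by (simp add: burnside_hom_def)

lemma burnside_cmp_cmpt [simp]:
  "\<lbrakk>\<eta> \<in> Ob H; \<gamma> \<in> Ob G; x \<in> Val (csrc s) (\<eta>, \<gamma>)\<rbrakk>
    \<Longrightarrow> cmpt (t \<cdot>\<^bsub>burnside_hom H G\<^esub> s) (\<eta>, \<gamma>) x = cmpt t (\<eta>, \<gamma>) (cmpt s (\<eta>, \<gamma>) x)"
  by (simp add: burnside_hom_def)

lemma burnside_hom_ob: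
  assumes "groupoid H" "groupoid G"
  shows "X \<in> Ob (burnside_hom H G) \<longleftrightarrow> biset H G X \<and> admissible H G X"
  using assms by (auto simp: burnside_hom_def biset_def biset_axioms_def)

lemma burnside_hom_homset:
  assumes "groupoid H" "groupoid G"
  shows "t \<in> homset (burnside_hom H G) X Y \<longleftrightarrow> biset_iso H G X Y t \<and> admissible H G X \<and> admissible H G Y"
  using assms
  by (auto simp: homset_iff burnside_hom_def biset_iso_def biset_def biset_axioms_def
      biset_iso_axioms_def biset_isos_def)

lemma burnside_hom_ar:
  assumes "groupoid H" "groupoid G"
  shows "t \<in> Ar (burnside_hom H G) \<longleftrightarrow>
    biset_iso H G (csrc t) (ctgt t) t \<and> admissible H G (csrc t) \<and> admissible H G (ctgt t)"
  using burnside_hom_homset[OF assms, of t "csrc t" "ctgt t"] by (simp add: homset_iff)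

lemma biset_iso_idt:
  assumes "biset H G X"
  shows "biset_iso H G X X (Idt (burnside_hom H G) X)"
proof -
  have "biset_iso H G X X (mk_map H G X X (\<lambda>\<eta> \<gamma> x. x))"
    using assms by (intro biset_isoI) (auto simp: bij_betw_def)
  then show ?thesis
    by (simp add: burnside_hom_def)
qed

lemma biset_iso_cmp:
  assumes "biset_iso H G X Y s" "biset_iso H G Y Z t"
  shows "biset_iso H G X Z (t \<cdot>\<^bsub>burnside_hom H G\<^esub> s)"
proof -
  interpret s: biset_iso H G X Y s by fact
  interpret t: biset_iso H G Y Z t by fact
  have "biset_iso H G X Z (mk_map H G X Z (\<lambda>\<eta> \<gamma> x. cmpt t (\<eta>, \<gamma>) (cmpt s (\<eta>, \<gamma>) x)))"
    by (intro biset_isoI)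
      (auto intro: s.X.biset_axioms t.Y.biset_axioms bij_betw_trans[OF s.bij t.bij, unfolded o_def])
  then show ?thesis
    by (simp add: burnside_hom_def s.csrc t.ctgt)
qed

lemma biset_iso_inverse:
  assumes "biset_iso H G X Y t"
  obtains s where "biset_iso H G Y X s" "s \<cdot>\<^bsub>burnside_hom H G\<^esub> t = Idt (burnside_hom H G) X"
    "t \<cdot>\<^bsub>burnside_hom H G\<^esub> s = Idt (burnside_hom H G) Y"
proof -
  interpret biset_iso H G X Y t by fact
  let ?i = "\<lambda>\<eta> \<gamma>. inv_into (Val X (\<eta>, \<gamma>)) (cmpt t (\<eta>, \<gamma>))"
  let ?s = "mk_map H G Y X ?i"
  have inv: "?i \<eta> \<gamma> (cmpt t (\<eta>, \<gamma>) x) = x" if "\<eta> \<in> Ob H" "\<gamma> \<in> Ob G" "x \<in> Val X (\<eta>, \<gamma>)" for \<eta> \<gamma> x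
    using bij that by (meson bij_betw_inv_into_left)
  have s: "biset_iso H G Y X ?s"
  proof (rule biset_isoI)
    fix h g y assume *: "h \<in> Ar H" "g \<in> Ar G" "y \<in> Val Y (Tgt H h, Src G g)"
    then obtain x where x: "x \<in> Val X (Tgt H h, Src G g)" "y = cmpt t (Tgt H h, Src G g) x"
      by (elim map_surj[rotated -1]) simp_all
    \<comment> \<open>Naturality of the inverse: once \<open>y\<close> is written as the image of
      \<open>x\<close>, naturality of \<open>t\<close> at \<open>x\<close> is all that is
      needed.\<close>
    have "Act Y (h, g) y = cmpt t (Src H h, Tgt G g) (Act X (h, g) x)"
      using * x by simp
    then show "?i (Src H h) (Tgt G g) (Act Y (h, g) y) = Act X (h, g) (?i (Tgt H h) (Src G g) y)"
      using * x by (simp add: inv del: map_act)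
  qed (auto intro: X.biset_axioms Y.biset_axioms bij_betw_inv_into bij)
  show thesis
  proof (rule that[OF s])
    show "?s \<cdot>\<^bsub>burnside_hom H G\<^esub> t = Idt (burnside_hom H G) X"
      using s by (intro biset_iso_eqI[of H G X X] biset_iso_cmp biset_iso_idt)
        (simp_all add: biset_iso_axioms X.biset_axioms csrc inv)
    show "t \<cdot>\<^bsub>burnside_hom H G\<^esub> ?s = Idt (burnside_hom H G) Y"
    proof (intro biset_iso_eqI[of H G Y Y] biset_iso_cmp biset_iso_idt)
      fix \<eta> \<gamma> y assume *: "\<eta> \<in> Ob H" "\<gamma> \<in> Ob G" "y \<in> Val Y (\<eta>, \<gamma>)"
      then obtain x where "x \<in> Val X (\<eta>, \<gamma>)" "y = cmpt t (\<eta>, \<gamma>) x"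
        by (rule map_surj)
      then show "cmpt (t \<cdot>\<^bsub>burnside_hom H G\<^esub> ?s) (\<eta>, \<gamma>) y = cmpt (Idt (burnside_hom H G) Y) (\<eta>, \<gamma>) y"
        using * by (simp add: inv)
    qed (use s biset_iso_axioms Y.biset_axioms in simp_all)
  qed
qed

lemma groupoid_burnside_hom:
  assumes "groupoid H" "groupoid G"
  shows "groupoid (burnside_hom H G)"
proof -
  note iffs = burnside_hom_ob[OF assms] burnside_hom_ar[OF assms]
  have "category (burnside_hom H G)"
  proof (rule categoryI)
    fix f assume "f \<in> Ar (burnside_hom H G)"
    then interpret biset_iso H G "csrc f" "ctgt f" f
      by (simp add: iffs)
    show "Idt (burnside_hom H G) (Tgt (burnside_hom H G) f) \<cdot>\<^bsub>burnside_hom H G\<^esub> f = f"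
      by (rule biset_iso_eqI[of H G "csrc f" "ctgt f"])
        (auto intro!: biset_iso_cmp[of H G _ "ctgt f"] biset_iso_idt biset_iso_axioms Y.biset_axioms)
    show "f \<cdot>\<^bsub>burnside_hom H G\<^esub> Idt (burnside_hom H G) (Src (burnside_hom H G) f) = f"
      by (rule biset_iso_eqI[of H G "csrc f" "ctgt f"])
        (auto intro!: biset_iso_cmp[of H G _ "csrc f"] biset_iso_idt biset_iso_axioms X.biset_axioms)
  next
    fix f g h
    assume *: "f \<in> Ar (burnside_hom H G)" "g \<in> Ar (burnside_hom H G)" "h \<in> Ar (burnside_hom H G)"
      "Tgt (burnside_hom H G) f = Src (burnside_hom H G) g"
      "Tgt (burnside_hom H G) g = Src (burnside_hom H G) h"
    interpret f: biset_iso H G "csrc f" "csrc g" f using * by (simp add: iffs)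
    interpret g: biset_iso H G "csrc g" "csrc h" g using * by (simp add: iffs)
    interpret h: biset_iso H G "csrc h" "ctgt h" h using * by (simp add: iffs)
    show "(h \<cdot>\<^bsub>burnside_hom H G\<^esub> g) \<cdot>\<^bsub>burnside_hom H G\<^esub> f = h \<cdot>\<^bsub>burnside_hom H G\<^esub> (g \<cdot>\<^bsub>burnside_hom H G\<^esub> f)"
      by (rule biset_iso_eqI[of H G "csrc f" "ctgt h"])
        (auto intro: biset_iso_cmp f.biset_iso_axioms g.biset_iso_axioms h.biset_iso_axioms)
  qed (auto simp: iffs biset_iso_idt intro: biset_iso_cmp biset_iso.axioms(1,2))
  moreover have "\<exists>g. inverse_arrows (burnside_hom H G) f g" if f: "f \<in> Ar (burnside_hom H G)" for f
  proof -
    obtain g where g: "biset_iso H G (ctgt f) (csrc f) g"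
      "g \<cdot>\<^bsub>burnside_hom H G\<^esub> f = Idt (burnside_hom H G) (csrc f)"
      "f \<cdot>\<^bsub>burnside_hom H G\<^esub> g = Idt (burnside_hom H G) (ctgt f)"
      using f biset_iso_inverse[of H G "csrc f" "ctgt f" f] by (auto simp: iffs)
    then have "inverse_arrows (burnside_hom H G) f g"
      using f by (simp add: inverse_arrows_def burnside_hom_homset[OF assms] iffs)
    then show ?thesis ..
  qed
  ultimately show ?thesis
    by (simp add: groupoid_def groupoid_axioms_def)
qed

text \<open>All 2-cells are invertible, so the invertibility clauses of \<open>bicategory\<close>
  and \<open>pseudofunctor\<close> come down to exhibiting a bi-set isomorphism between admissible
  bi-sets.\<close>

lemma burnside_hom_isos:
  assumes "groupoid H" "groupoid G"
  shows "t \<in> isos (burnside_hom H G) X Y \<longleftrightarrow> biset_iso H G X Y t \<and> admissible H G X \<and> admissible H G Y"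
  using groupoid.isos_eq_homset[OF groupoid_burnside_hom[OF assms]] burnside_hom_homset[OF assms] by simp

text \<open>Composites are formed by \<open>mk_map\<close>, so pointwise agreement already decides
  equality. Coherence laws with a composite on both sides go this way; those with a single cell on
  one side use \<open>biset_iso_eqI\<close>.\<close>

lemma burnside_cmp_eqI:
  assumes "csrc s = X" "csrc s' = X" "ctgt t = ctgt t'"
    and "\<And>\<eta> \<gamma> x. \<lbrakk>\<eta> \<in> Ob H; \<gamma> \<in> Ob G; x \<in> Val X (\<eta>, \<gamma>)\<rbrakk>
      \<Longrightarrow> cmpt t (\<eta>, \<gamma>) (cmpt s (\<eta>, \<gamma>) x) = cmpt t' (\<eta>, \<gamma>) (cmpt s' (\<eta>, \<gamma>) x)"
  shows "t \<cdot>\<^bsub>burnside_hom H G\<^esub> s = t' \<cdot>\<^bsub>burnside_hom H G\<^esub> s'"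
  using assms by (auto simp: burnside_hom_def intro!: mk_map_cong)

section \<open>Maps out of tensor products\<close>

context tensor_pair
begin

context
  fixes Z :: "'u biset" and F :: "'u \<Rightarrow> 'u \<Rightarrow> 'u \<Rightarrow> 'u \<Rightarrow> 'u \<Rightarrow> 'u"
  assumes slide: "\<And>\<kappa> \<gamma> h x y. \<lbrakk>\<kappa> \<in> Ob K; \<gamma> \<in> Ob G; h \<in> Ar H; x \<in> Val X (Tgt H h, \<gamma>); y \<in> Val Y (\<kappa>, Src H h)\<rbrakk>
    \<Longrightarrow> F \<kappa> \<gamma> (Src H h) (Act X (h, Idt G \<gamma>) x) y = F \<kappa> \<gamma> (Tgt H h) x (Act Y (Idt K \<kappa>, h) y)"
begin

lemma case_tens:
  "\<lbrakk>\<kappa> \<in> Ob K; \<gamma> \<in> Ob G; \<eta> \<in> Ob H; x \<in> Val X (\<eta>, \<gamma>); y \<in> Val Y (\<kappa>, \<eta>)\<rbrakk>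
    \<Longrightarrow> (case class_rep (tens K H G X Y \<kappa> \<gamma> (\<eta>, x, y)) of (\<eta>, x, y) \<Rightarrow> F \<kappa> \<gamma> \<eta> x y) = F \<kappa> \<gamma> \<eta> x y"
  by (rule tens_case) (auto intro: slide)

lemma mk_map_tens:
  "\<lbrakk>\<kappa> \<in> Ob K; \<gamma> \<in> Ob G; \<eta> \<in> Ob H; x \<in> Val X (\<eta>, \<gamma>); y \<in> Val Y (\<kappa>, \<eta>)\<rbrakk>
    \<Longrightarrow> cmpt (mk_map K G (tensor K H G X Y) Z (\<lambda>\<kappa> \<gamma> z. case class_rep z of (\<eta>, x, y) \<Rightarrow> F \<kappa> \<gamma> \<eta> x y))
        (\<kappa>, \<gamma>) (tens K H G X Y \<kappa> \<gamma> (\<eta>, x, y)) = F \<kappa> \<gamma> \<eta> x y"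
  by (simp add: case_tens)

text \<open>\<open>slide\<close> makes the map well defined on classes, \<open>F_inj\<close>
  concludes equality of classes and \<open>F_surj\<close> reaches every value, so bijectivity
  follows without an inverse being written down.\<close>

lemma biset_iso_tensorI:
  assumes "biset K G Z"
    and F_val: "\<And>\<kappa> \<gamma> \<eta> x y. \<lbrakk>\<kappa> \<in> Ob K; \<gamma> \<in> Ob G; \<eta> \<in> Ob H; x \<in> Val X (\<eta>, \<gamma>); y \<in> Val Y (\<kappa>, \<eta>)\<rbrakk>
      \<Longrightarrow> F \<kappa> \<gamma> \<eta> x y \<in> Val Z (\<kappa>, \<gamma>)"
    and F_inj: "\<And>\<kappa> \<gamma> \<eta> x y \<eta>' x' y'. \<lbrakk>\<kappa> \<in> Ob K; \<gamma> \<in> Ob G; \<eta> \<in> Ob H; x \<in> Val X (\<eta>, \<gamma>); y \<in> Val Y (\<kappa>, \<eta>);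
        \<eta>' \<in> Ob H; x' \<in> Val X (\<eta>', \<gamma>); y' \<in> Val Y (\<kappa>, \<eta>'); F \<kappa> \<gamma> \<eta> x y = F \<kappa> \<gamma> \<eta>' x' y'\<rbrakk>
      \<Longrightarrow> tens K H G X Y \<kappa> \<gamma> (\<eta>, x, y) = tens K H G X Y \<kappa> \<gamma> (\<eta>', x', y')"
    and F_surj: "\<And>\<kappa> \<gamma> z. \<lbrakk>\<kappa> \<in> Ob K; \<gamma> \<in> Ob G; z \<in> Val Z (\<kappa>, \<gamma>)\<rbrakk>
      \<Longrightarrow> \<exists>\<eta>\<in>Ob H. \<exists>x\<in>Val X (\<eta>, \<gamma>). \<exists>y\<in>Val Y (\<kappa>, \<eta>). z = F \<kappa> \<gamma> \<eta> x y"
    and F_natural: "\<And>k g \<eta> x y. \<lbrakk>k \<in> Ar K; g \<in> Ar G; \<eta> \<in> Ob H; x \<in> Val X (\<eta>, Src G g); y \<in> Val Y (Tgt K k, \<eta>)\<rbrakk>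
      \<Longrightarrow> F (Src K k) (Tgt G g) \<eta> (Act X (Idt H \<eta>, g) x) (Act Y (k, Idt H \<eta>) y)
        = Act Z (k, g) (F (Tgt K k) (Src G g) \<eta> x y)"
  shows "biset_iso K G (tensor K H G X Y) Z
    (mk_map K G (tensor K H G X Y) Z (\<lambda>\<kappa> \<gamma> z. case class_rep z of (\<eta>, x, y) \<Rightarrow> F \<kappa> \<gamma> \<eta> x y))"
proof (rule biset_isoI[OF biset_tensor \<open>biset K G Z\<close>])
  fix \<kappa> \<gamma> assume ob: "\<kappa> \<in> Ob K" "\<gamma> \<in> Ob G"
  let ?F = "\<lambda>z. case class_rep z of (\<eta>, x, y) \<Rightarrow> F \<kappa> \<gamma> \<eta> x y"
  show "bij_betw ?F (Val (tensor K H G X Y) (\<kappa>, \<gamma>)) (Val Z (\<kappa>, \<gamma>))"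
    unfolding bij_betw_def
  proof
    show "inj_on ?F (Val (tensor K H G X Y) (\<kappa>, \<gamma>))"
    proof (rule inj_onI)
      fix z z' assume z: "z \<in> Val (tensor K H G X Y) (\<kappa>, \<gamma>)" "z' \<in> Val (tensor K H G X Y) (\<kappa>, \<gamma>)"
        "?F z = ?F z'"
      from z(1) ob obtain \<eta> x y where xy: "\<eta> \<in> Ob H" "x \<in> Val X (\<eta>, \<gamma>)" "y \<in> Val Y (\<kappa>, \<eta>)"
        "z = tens K H G X Y \<kappa> \<gamma> (\<eta>, x, y)" by (rule tensE)
      from z(2) ob obtain \<eta>' x' y' where xy': "\<eta>' \<in> Ob H" "x' \<in> Val X (\<eta>', \<gamma>)" "y' \<in> Val Y (\<kappa>, \<eta>')"
        "z' = tens K H G X Y \<kappa> \<gamma> (\<eta>', x', y')" by (rule tensE)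
      show "z = z'"
        unfolding xy(4) xy'(4)
        by (rule F_inj) (use z(3) ob xy xy' case_tens in simp_all)
    qed
    show "?F ` Val (tensor K H G X Y) (\<kappa>, \<gamma>) = Val Z (\<kappa>, \<gamma>)"
    proof
      show "?F ` Val (tensor K H G X Y) (\<kappa>, \<gamma>) \<subseteq> Val Z (\<kappa>, \<gamma>)"
        using ob F_val by (auto elim!: tensE simp: case_tens)
      show "Val Z (\<kappa>, \<gamma>) \<subseteq> ?F ` Val (tensor K H G X Y) (\<kappa>, \<gamma>)"
      proof
        fix z assume "z \<in> Val Z (\<kappa>, \<gamma>)"
        then obtain \<eta> x y where "\<eta> \<in> Ob H" "x \<in> Val X (\<eta>, \<gamma>)" "y \<in> Val Y (\<kappa>, \<eta>)" "z = F \<kappa> \<gamma> \<eta> x y"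
          using F_surj ob by blast
        then show "z \<in> ?F ` Val (tensor K H G X Y) (\<kappa>, \<gamma>)"
          using ob by (intro image_eqI[of _ _ "tens K H G X Y \<kappa> \<gamma> (\<eta>, x, y)"]) (simp_all add: case_tens)
      qed
    qed
  qed
next
  fix k g z assume *: "k \<in> Ar K" "g \<in> Ar G" "z \<in> Val (tensor K H G X Y) (Tgt K k, Src G g)"
  then obtain \<eta> x y where "\<eta> \<in> Ob H" "x \<in> Val X (\<eta>, Src G g)" "y \<in> Val Y (Tgt K k, \<eta>)"
    "z = tens K H G X Y (Tgt K k) (Src G g) (\<eta>, x, y)"
    by (elim tensE) simp_all
  with * show "(case class_rep (Act (tensor K H G X Y) (k, g) z) of (\<eta>, x, y) \<Rightarrow> F (Src K k) (Tgt G g) \<eta> x y)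
      = Act Z (k, g) (case class_rep z of (\<eta>, x, y) \<Rightarrow> F (Tgt K k) (Src G g) \<eta> x y)"
    by (simp add: case_tens F_natural)
qed

end

end

locale tensor_iso = s: biset_iso H G X X' s + t: biset_iso K H Y Y' t
  for K H G :: "'u::infinite grpd" and X X' Y Y' s t
begin

sublocale XY: tensor_pair K H G X Y ..
sublocale XY': tensor_pair K H G X' Y' ..

lemma slide:
  assumes "\<kappa> \<in> Ob K" "\<gamma> \<in> Ob G" "h \<in> Ar H" "x \<in> Val X (Tgt H h, \<gamma>)" "y \<in> Val Y (\<kappa>, Src H h)"
  shows "tens K H G X' Y' \<kappa> \<gamma> (Src H h, cmpt s (Src H h, \<gamma>) (Act X (h, Idt G \<gamma>) x), cmpt t (\<kappa>, Src H h) y)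
    = tens K H G X' Y' \<kappa> \<gamma> (Tgt H h, cmpt s (Tgt H h, \<gamma>) x, cmpt t (\<kappa>, Tgt H h) (Act Y (Idt K \<kappa>, h) y))"
  using assms XY'.tens_slide[of \<kappa> \<gamma> h "cmpt s (Tgt H h, \<gamma>) x" "cmpt t (\<kappa>, Src H h) y"] by simp

lemma tensor_map_tens [simp]:
  "\<lbrakk>\<kappa> \<in> Ob K; \<gamma> \<in> Ob G; \<eta> \<in> Ob H; x \<in> Val X (\<eta>, \<gamma>); y \<in> Val Y (\<kappa>, \<eta>)\<rbrakk>
    \<Longrightarrow> cmpt (tensor_map K H G s t) (\<kappa>, \<gamma>) (tens K H G X Y \<kappa> \<gamma> (\<eta>, x, y))
      = tens K H G X' Y' \<kappa> \<gamma> (\<eta>, cmpt s (\<eta>, \<gamma>) x, cmpt t (\<kappa>, \<eta>) y)"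
  unfolding tensor_map_def s.csrc s.ctgt t.csrc t.ctgt by (rule XY.mk_map_tens[OF slide])

lemma biset_iso_tensor_map:
  "biset_iso K G (tensor K H G X Y) (tensor K H G X' Y') (tensor_map K H G s t)"
  unfolding tensor_map_def s.csrc s.ctgt t.csrc t.ctgt
proof (rule XY.biset_iso_tensorI[OF slide])
  fix \<kappa> \<gamma> \<eta> x y \<eta>' x' y'
  assume *: "\<kappa> \<in> Ob K" "\<gamma> \<in> Ob G" "\<eta> \<in> Ob H" "x \<in> Val X (\<eta>, \<gamma>)" "y \<in> Val Y (\<kappa>, \<eta>)"
    "\<eta>' \<in> Ob H" "x' \<in> Val X (\<eta>', \<gamma>)" "y' \<in> Val Y (\<kappa>, \<eta>')"
    "tens K H G X' Y' \<kappa> \<gamma> (\<eta>, cmpt s (\<eta>, \<gamma>) x, cmpt t (\<kappa>, \<eta>) y)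
      = tens K H G X' Y' \<kappa> \<gamma> (\<eta>', cmpt s (\<eta>', \<gamma>) x', cmpt t (\<kappa>, \<eta>') y')"
  then obtain h where h: "h \<in> Ar H" "Src H h = \<eta>" "Tgt H h = \<eta>'"
    "cmpt s (\<eta>, \<gamma>) x = Act X' (h, Idt G \<gamma>) (cmpt s (\<eta>', \<gamma>) x')"
    "cmpt t (\<kappa>, \<eta>') y' = Act Y' (Idt K \<kappa>, h) (cmpt t (\<kappa>, \<eta>) y)"
    by (subst (asm) XY'.tens_eq_iff) auto
  \<comment> \<open>The arrow \<open>h\<close> that relates the images relates the originals too:
    \<open>s\<close> and \<open>t\<close> commute with the actions and are injective.\<close>
  have "x = Act X (h, Idt G \<gamma>) x'"
    using s.map_inj[of \<eta> \<gamma> x "Act X (h, Idt G \<gamma>) x'"] * h(1-4) by simp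
  moreover have "y' = Act Y (Idt K \<kappa>, h) y"
    using t.map_inj[of \<kappa> \<eta>' y' "Act Y (Idt K \<kappa>, h) y"] * h(1-3,5) by simp
  ultimately show "tens K H G X Y \<kappa> \<gamma> (\<eta>, x, y) = tens K H G X Y \<kappa> \<gamma> (\<eta>', x', y')"
    using * h by (subst XY.tens_eq_iff) auto
next
  fix \<kappa> \<gamma> z assume *: "\<kappa> \<in> Ob K" "\<gamma> \<in> Ob G" "z \<in> Val (tensor K H G X' Y') (\<kappa>, \<gamma>)"
  then obtain \<eta> x' y' where \<eta>: "\<eta> \<in> Ob H" "x' \<in> Val X' (\<eta>, \<gamma>)" "y' \<in> Val Y' (\<kappa>, \<eta>)"
    "z = tens K H G X' Y' \<kappa> \<gamma> (\<eta>, x', y')"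
    by (elim XY'.tensE)
  moreover obtain x where "x \<in> Val X (\<eta>, \<gamma>)" "x' = cmpt s (\<eta>, \<gamma>) x"
    using \<eta> * by (elim s.map_surj[rotated -1])
  moreover obtain y where "y \<in> Val Y (\<kappa>, \<eta>)" "y' = cmpt t (\<kappa>, \<eta>) y"
    using \<eta> * by (elim t.map_surj[rotated -1])
  ultimately show "\<exists>\<eta>\<in>Ob H. \<exists>x\<in>Val X (\<eta>, \<gamma>). \<exists>y\<in>Val Y (\<kappa>, \<eta>).
      z = tens K H G X' Y' \<kappa> \<gamma> (\<eta>, cmpt s (\<eta>, \<gamma>) x, cmpt t (\<kappa>, \<eta>) y)"
    by blast
qed (simp_all add: XY'.biset_tensor)

end

section \<open>Unitors and associator\<close>

lemma id_biset_simps [simp]: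
  assumes "\<gamma>' \<in> Ob G" "\<gamma> \<in> Ob G"
  shows "f \<in> Val (id_biset G) (\<gamma>', \<gamma>) \<longleftrightarrow> f \<in> Ar G \<and> Src G f = \<gamma>' \<and> Tgt G f = \<gamma>"
  using assms by (simp add: id_biset_def homset_iff)

lemma act_id_biset [simp]:
  assumes "g \<in> Ar G" "g' \<in> Ar G" "f \<in> Ar G" "Src G f = Tgt G g'" "Tgt G f = Src G g"
  shows "Act (id_biset G) (g', g) f = g \<cdot>\<^bsub>G\<^esub> f \<cdot>\<^bsub>G\<^esub> g'"
  using assms by (simp add: id_biset_def homset_iff)

lemma biset_id_biset:
  assumes "groupoid G"
  shows "biset G G (id_biset G)"
proof -
  interpret groupoid G by fact
  show ?thesis
    unfolding id_biset_def by (rule trim_bisets) (auto simp: homset_iff groupoid_axioms)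
qed

lemma admissible_id_biset:
  assumes "groupoid G"
  shows "admissible G G (id_biset G)"
proof -
  interpret biset G G "id_biset G" using assms by (rule biset_id_biset)
  show ?thesis
    unfolding admissible_iff
  proof (intro ballI conjI)
    fix \<gamma> g g' f assume "\<gamma> \<in> Ob G" "g \<in> Ar G" "g' \<in> Ar G" "f \<in> Val (id_biset G) (\<gamma>, Src G g)"
    then show "Src G g = Src G g' \<longrightarrow> Tgt G g = Tgt G g' \<longrightarrow>
      Act (id_biset G) (Idt G \<gamma>, g) f = Act (id_biset G) (Idt G \<gamma>, g') f \<longrightarrow> g = g'"
      using H.right_cancel[of g g' f] by auto
  next
    fix \<gamma> assume "\<gamma> \<in> Ob G"
    then show "\<exists>F. finite F \<and> F \<subseteq> (SIGMA \<gamma>':Ob G. Val (id_biset G) (\<gamma>, \<gamma>')) \<and>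
      (\<forall>\<gamma>'\<in>Ob G. \<forall>x\<in>Val (id_biset G) (\<gamma>, \<gamma>'). \<exists>(\<gamma>'', y)\<in>F. \<exists>g\<in>Ar G. Src G g = \<gamma>'' \<and> Tgt G g = \<gamma>' \<and>
        x = Act (id_biset G) (Idt G \<gamma>, g) y)"
      \<comment> \<open>There is a single orbit: G(\<gamma>, -) is generated by the identity at
        \<gamma>.\<close>
      by (intro exI[of _ "{(\<gamma>, Idt G \<gamma>)}"]) auto
  qed
qed

lemma tensor_pair_lun:
  assumes "biset H G (X :: 'u::infinite biset)"
  shows "tensor_pair H G G (id_biset G) X"
  using assms biset_id_biset[of G] by (simp add: tensor_pair_def biset_def)

lemma tensor_pair_run:
  assumes "biset H G (X :: 'u::infinite biset)"
  shows "tensor_pair H H G X (id_biset H)"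
  using assms biset_id_biset[of H] by (simp add: tensor_pair_def biset_def)

context
  fixes H G :: "'u::infinite grpd" and X :: "'u biset"
  assumes X: "biset H G X"
begin

interpretation X: biset H G X by (rule X)
interpretation L: tensor_pair H G G "id_biset G" X using X by (rule tensor_pair_lun)
interpretation R: tensor_pair H H G X "id_biset H" using X by (rule tensor_pair_run)

lemma burnside_lun_tens [simp]:
  "\<lbrakk>\<eta> \<in> Ob H; g \<in> Ar G; x \<in> Val X (\<eta>, Src G g); \<gamma>' = Src G g; \<gamma> = Tgt G g\<rbrakk>
    \<Longrightarrow> cmpt (burnside_lun H G X) (\<eta>, \<gamma>) (tens H G G (id_biset G) X \<eta> \<gamma> (\<gamma>', g, x)) = Act X (Idt H \<eta>, g) x"
  unfolding burnside_lun_def by (subst L.mk_map_tens) auto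

lemma biset_iso_lun: "biset_iso H G (tensor H G G (id_biset G) X) X (burnside_lun H G X)"
  unfolding burnside_lun_def
proof (rule L.biset_iso_tensorI)
  fix \<eta> \<gamma> \<gamma>' g x \<gamma>'' g' x'
  assume *: "\<eta> \<in> Ob H" "\<gamma> \<in> Ob G" "\<gamma>' \<in> Ob G" "g \<in> Val (id_biset G) (\<gamma>', \<gamma>)" "x \<in> Val X (\<eta>, \<gamma>')"
    "\<gamma>'' \<in> Ob G" "g' \<in> Val (id_biset G) (\<gamma>'', \<gamma>)" "x' \<in> Val X (\<eta>, \<gamma>'')"
    "Act X (Idt H \<eta>, g) x = Act X (Idt H \<eta>, g') x'"
  \<comment> \<open>From g x = g' x' follows x' = (g'^-1 g) x, while g = g' (g'^-1 g); so the two
    pairs differ by a slide along g'^-1 g.\<close>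
  have "x' = Act X (Idt H \<eta>, inv_arrow G g') (Act X (Idt H \<eta>, g') x')"
    using * by simp
  also have "\<dots> = Act X (Idt H \<eta>, inv_arrow G g' \<cdot>\<^bsub>G\<^esub> g) x"
    using * by (simp flip: *(9))
  finally show "tens H G G (id_biset G) X \<eta> \<gamma> (\<gamma>', g, x) = tens H G G (id_biset G) X \<eta> \<gamma> (\<gamma>'', g', x')"
    using * by (subst L.tens_eq_iff) (auto intro!: bexI[of _ "inv_arrow G g' \<cdot>\<^bsub>G\<^esub> g"])
next
  fix \<eta> \<gamma> x assume "\<eta> \<in> Ob H" "\<gamma> \<in> Ob G" "x \<in> Val X (\<eta>, \<gamma>)"
  then show "\<exists>\<gamma>'\<in>Ob G. \<exists>g\<in>Val (id_biset G) (\<gamma>', \<gamma>). \<exists>y\<in>Val X (\<eta>, \<gamma>'). x = Act X (Idt H \<eta>, g) y"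
    by (intro bexI[of _ \<gamma>] bexI[of _ "Idt G \<gamma>"] bexI[of _ x]) auto
qed (auto simp: X)

lemma burnside_run_tens [simp]:
  "\<lbrakk>\<gamma> \<in> Ob G; h \<in> Ar H; x \<in> Val X (Tgt H h, \<gamma>); \<eta> = Src H h; \<eta>' = Tgt H h\<rbrakk>
    \<Longrightarrow> cmpt (burnside_run H G X) (\<eta>, \<gamma>) (tens H H G X (id_biset H) \<eta> \<gamma> (\<eta>', x, h)) = Act X (h, Idt G \<gamma>) x"
  unfolding burnside_run_def by (subst R.mk_map_tens) auto

lemma biset_iso_run: "biset_iso H G (tensor H H G X (id_biset H)) X (burnside_run H G X)"
  unfolding burnside_run_def
proof (rule R.biset_iso_tensorI)
  fix \<eta> \<gamma> \<eta>' x h \<eta>'' x' h'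
  assume *: "\<eta> \<in> Ob H" "\<gamma> \<in> Ob G" "\<eta>' \<in> Ob H" "x \<in> Val X (\<eta>', \<gamma>)" "h \<in> Val (id_biset H) (\<eta>, \<eta>')"
    "\<eta>'' \<in> Ob H" "x' \<in> Val X (\<eta>'', \<gamma>)" "h' \<in> Val (id_biset H) (\<eta>, \<eta>'')"
    "Act X (h, Idt G \<gamma>) x = Act X (h', Idt G \<gamma>) x'"
  \<comment> \<open>Here x h = x' h' gives x = x' (h' h^-1), so the slide is along h' h^-1.\<close>
  have "x = Act X (inv_arrow H h, Idt G \<gamma>) (Act X (h, Idt G \<gamma>) x)"
    using *(1-8) by simp
  also have "\<dots> = Act X (h' \<cdot>\<^bsub>H\<^esub> inv_arrow H h, Idt G \<gamma>) x'"
    using *(1-8) unfolding *(9) by simp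
  finally have "x = Act X (h' \<cdot>\<^bsub>H\<^esub> inv_arrow H h, Idt G \<gamma>) x'" .
  with *(1-8) show "tens H H G X (id_biset H) \<eta> \<gamma> (\<eta>', x, h) = tens H H G X (id_biset H) \<eta> \<gamma> (\<eta>'', x', h')"
    by (subst R.tens_eq_iff) (auto intro!: bexI[of _ "h' \<cdot>\<^bsub>H\<^esub> inv_arrow H h"])
next
  fix \<eta> \<gamma> x assume "\<eta> \<in> Ob H" "\<gamma> \<in> Ob G" "x \<in> Val X (\<eta>, \<gamma>)"
  then show "\<exists>\<eta>'\<in>Ob H. \<exists>y\<in>Val X (\<eta>', \<gamma>). \<exists>h\<in>Val (id_biset H) (\<eta>, \<eta>'). x = Act X (h, Idt G \<gamma>) y"
    by (intro bexI[of _ \<eta>] bexI[of _ "Idt H \<eta>"] bexI[of _ x]) auto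
qed (auto simp: X)

end

locale tensor_triple = XY: tensor_pair K H G X Y + YZ: tensor_pair L K H Y Z
  for L K H G :: "'u::infinite grpd" and X Y Z
begin

sublocale XY_Z: tensor_pair L K G "tensor K H G X Y" Z ..
sublocale X_YZ: tensor_pair L H G X "tensor L K H Y Z" ..

text \<open>The associator decodes twice, first the outer class and then \<open>v\<close>. The inner
  decoding is legitimate because [x h, [y, z]] = [x, h [y, z]] = [x, [h y, z]].\<close>

lemma case_XY:
  assumes "l \<in> Ob L" "\<kappa> \<in> Ob K" "\<gamma> \<in> Ob G" "\<eta> \<in> Ob H" "x \<in> Val X (\<eta>, \<gamma>)" "y \<in> Val Y (\<kappa>, \<eta>)" "z \<in> Val Z (l, \<kappa>)"
  shows "(case class_rep (tens K H G X Y \<kappa> \<gamma> (\<eta>, x, y)) of (\<eta>, x, y) \<Rightarrow>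
        tens L H G X (tensor L K H Y Z) l \<gamma> (\<eta>, x, tens L K H Y Z l \<eta> (\<kappa>, y, z)))
    = tens L H G X (tensor L K H Y Z) l \<gamma> (\<eta>, x, tens L K H Y Z l \<eta> (\<kappa>, y, z))"
proof (rule XY.tens_case)
  fix h x y assume "h \<in> Ar H" "x \<in> Val X (Tgt H h, \<gamma>)" "y \<in> Val Y (\<kappa>, Src H h)"
  then show "tens L H G X (tensor L K H Y Z) l \<gamma>
        (Src H h, Act X (h, Idt G \<gamma>) x, tens L K H Y Z l (Src H h) (\<kappa>, y, z)) =
       tens L H G X (tensor L K H Y Z) l \<gamma>
        (Tgt H h, x, tens L K H Y Z l (Tgt H h) (\<kappa>, Act Y (Idt K \<kappa>, h) y, z))"
    using assms X_YZ.tens_slide[of l \<gamma> h x "tens L K H Y Z l (Src H h) (\<kappa>, y, z)"] by simp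
qed (use assms in auto)

text \<open>This legitimates the outer decoding: an arrow \<open>k\<close> acting on
  \<open>v\<close> acts on its entry \<open>y\<close>, and [y k, z] = [y, k z] in the inner tensor
  product.\<close>

lemma assoc_slide:
  assumes "l \<in> Ob L" "\<gamma> \<in> Ob G" "k \<in> Ar K" "v \<in> Val (tensor K H G X Y) (Tgt K k, \<gamma>)" "z \<in> Val Z (l, Src K k)"
  shows "(case class_rep (Act (tensor K H G X Y) (k, Idt G \<gamma>) v) of (\<eta>, x, y) \<Rightarrow>
        tens L H G X (tensor L K H Y Z) l \<gamma> (\<eta>, x, tens L K H Y Z l \<eta> (Src K k, y, z)))
    = (case class_rep v of (\<eta>, x, y) \<Rightarrow>
        tens L H G X (tensor L K H Y Z) l \<gamma> (\<eta>, x, tens L K H Y Z l \<eta> (Tgt K k, y, Act Z (Idt L l, k) z)))"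
proof -
  obtain \<eta> x y where "\<eta> \<in> Ob H" "x \<in> Val X (\<eta>, \<gamma>)" "y \<in> Val Y (Tgt K k, \<eta>)"
    "v = tens K H G X Y (Tgt K k) \<gamma> (\<eta>, x, y)"
    using assms by (elim XY.tensE) simp_all
  then show ?thesis
    using assms YZ.tens_slide[of l \<eta> k y z] by (simp add: case_XY)
qed

lemma assoc_tens [simp]:
  assumes "l \<in> Ob L" "\<kappa> \<in> Ob K" "\<gamma> \<in> Ob G" "\<eta> \<in> Ob H" "x \<in> Val X (\<eta>, \<gamma>)" "y \<in> Val Y (\<kappa>, \<eta>)" "z \<in> Val Z (l, \<kappa>)"
  shows "cmpt (burnside_assoc L K H G X Y Z) (l, \<gamma>)
      (tens L K G (tensor K H G X Y) Z l \<gamma> (\<kappa>, tens K H G X Y \<kappa> \<gamma> (\<eta>, x, y), z))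
    = tens L H G X (tensor L K H Y Z) l \<gamma> (\<eta>, x, tens L K H Y Z l \<eta> (\<kappa>, y, z))"
  unfolding burnside_assoc_def by (subst XY_Z.mk_map_tens[OF assoc_slide]) (simp_all add: assms case_XY)

lemma biset_iso_assoc:
  "biset_iso L G (tensor L K G (tensor K H G X Y) Z) (tensor L H G X (tensor L K H Y Z))
    (burnside_assoc L K H G X Y Z)"
  unfolding burnside_assoc_def
proof (rule XY_Z.biset_iso_tensorI[OF assoc_slide])
  fix l \<gamma> \<kappa> v z
  assume *: "l \<in> Ob L" "\<gamma> \<in> Ob G" "\<kappa> \<in> Ob K" "v \<in> Val (tensor K H G X Y) (\<kappa>, \<gamma>)" "z \<in> Val Z (l, \<kappa>)"
  then obtain \<eta> x y where "\<eta> \<in> Ob H" "x \<in> Val X (\<eta>, \<gamma>)" "y \<in> Val Y (\<kappa>, \<eta>)"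
    "v = tens K H G X Y \<kappa> \<gamma> (\<eta>, x, y)"
    by (elim XY.tensE) simp_all
  with * show "(case class_rep v of (\<eta>, x, y) \<Rightarrow>
        tens L H G X (tensor L K H Y Z) l \<gamma> (\<eta>, x, tens L K H Y Z l \<eta> (\<kappa>, y, z)))
      \<in> Val (tensor L H G X (tensor L K H Y Z)) (l, \<gamma>)"
    by (simp add: case_XY)
next
  fix l \<gamma> \<kappa> v z \<kappa>' v' z'
  assume *: "l \<in> Ob L" "\<gamma> \<in> Ob G" "\<kappa> \<in> Ob K" "v \<in> Val (tensor K H G X Y) (\<kappa>, \<gamma>)" "z \<in> Val Z (l, \<kappa>)"
    "\<kappa>' \<in> Ob K" "v' \<in> Val (tensor K H G X Y) (\<kappa>', \<gamma>)" "z' \<in> Val Z (l, \<kappa>')"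
    and eq: "(case class_rep v of (\<eta>, x, y) \<Rightarrow>
        tens L H G X (tensor L K H Y Z) l \<gamma> (\<eta>, x, tens L K H Y Z l \<eta> (\<kappa>, y, z))) =
      (case class_rep v' of (\<eta>, x, y) \<Rightarrow>
        tens L H G X (tensor L K H Y Z) l \<gamma> (\<eta>, x, tens L K H Y Z l \<eta> (\<kappa>', y, z')))"
  obtain \<eta> x y where v: "\<eta> \<in> Ob H" "x \<in> Val X (\<eta>, \<gamma>)" "y \<in> Val Y (\<kappa>, \<eta>)"
    "v = tens K H G X Y \<kappa> \<gamma> (\<eta>, x, y)"
    using *(4) by (rule XY.tensE) (use * in simp_all)
  obtain \<eta>' x' y' where v': "\<eta>' \<in> Ob H" "x' \<in> Val X (\<eta>', \<gamma>)" "y' \<in> Val Y (\<kappa>', \<eta>')"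
    "v' = tens K H G X Y \<kappa>' \<gamma> (\<eta>', x', y')"
    using *(7) by (rule XY.tensE) (use * in simp_all)
  have "tens L H G X (tensor L K H Y Z) l \<gamma> (\<eta>, x, tens L K H Y Z l \<eta> (\<kappa>, y, z))
      = tens L H G X (tensor L K H Y Z) l \<gamma> (\<eta>', x', tens L K H Y Z l \<eta>' (\<kappa>', y', z'))"
    using eq * v v' by (simp add: case_XY)
  \<comment> \<open>The equality is peeled from the outside: \<open>h\<close> relates the pairs in X
    \<otimes> (Y \<otimes> Z), and then \<open>k\<close> relates the remaining pairs in Y \<otimes>
    Z.\<close>
  then obtain h where h: "h \<in> Ar H" "Src H h = \<eta>" "Tgt H h = \<eta>'" and x: "x = Act X (h, Idt G \<gamma>) x'"
    and "tens L K H Y Z l \<eta>' (\<kappa>', y', z') = Act (tensor L K H Y Z) (Idt L l, h) (tens L K H Y Z l \<eta> (\<kappa>, y, z))"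
    using * v v' by (subst (asm) X_YZ.tens_eq_iff) auto
  then have "tens L K H Y Z l \<eta>' (\<kappa>', y', z') = tens L K H Y Z l \<eta>' (\<kappa>, Act Y (Idt K \<kappa>, h) y, z)"
    using * v by simp
  then obtain k where k: "k \<in> Ar K" "Src K k = \<kappa>'" "Tgt K k = \<kappa>"
    and y': "y' = Act Y (k, Idt H \<eta>') (Act Y (Idt K \<kappa>, h) y)" and z: "z = Act Z (Idt L l, k) z'"
    using * v v' h by (subst (asm) YZ.tens_eq_iff) auto
  \<comment> \<open>Reassembly with the other bracketing: v = [x', h y] and v' = [x', h y] k = v k,
    while z = k z', so \<open>k\<close> alone relates (v, z) and (v', z').\<close>
  have "v = tens K H G X Y \<kappa> \<gamma> (\<eta>', x', Act Y (Idt K \<kappa>, h) y)"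
    unfolding v(4) x using XY.tens_slide[of \<kappa> \<gamma> h x' y] h * v v' by simp
  moreover have "v' = Act (tensor K H G X Y) (k, Idt G \<gamma>) (tens K H G X Y \<kappa> \<gamma> (\<eta>', x', Act Y (Idt K \<kappa>, h) y))"
    unfolding v'(4) y' using k h * v v' by simp
  ultimately have "v' = Act (tensor K H G X Y) (k, Idt G \<gamma>) v"
    by simp
  then show "tens L K G (tensor K H G X Y) Z l \<gamma> (\<kappa>, v, z) = tens L K G (tensor K H G X Y) Z l \<gamma> (\<kappa>', v', z')"
    unfolding z using XY_Z.tens_slide[of l \<gamma> k v z'] k * by simp
next
  fix l \<gamma> w assume *: "l \<in> Ob L" "\<gamma> \<in> Ob G" "w \<in> Val (tensor L H G X (tensor L K H Y Z)) (l, \<gamma>)"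
  then obtain \<eta> x v where w: "\<eta> \<in> Ob H" "x \<in> Val X (\<eta>, \<gamma>)" "v \<in> Val (tensor L K H Y Z) (l, \<eta>)"
    "w = tens L H G X (tensor L K H Y Z) l \<gamma> (\<eta>, x, v)"
    by (elim X_YZ.tensE)
  moreover obtain \<kappa> y z where "\<kappa> \<in> Ob K" "y \<in> Val Y (\<kappa>, \<eta>)" "z \<in> Val Z (l, \<kappa>)" "v = tens L K H Y Z l \<eta> (\<kappa>, y, z)"
    using w(3) *(1) w(1) by (rule YZ.tensE)
  ultimately show "\<exists>\<kappa>\<in>Ob K. \<exists>v\<in>Val (tensor K H G X Y) (\<kappa>, \<gamma>). \<exists>z\<in>Val Z (l, \<kappa>).
      w = (case class_rep v of (\<eta>, x, y) \<Rightarrow>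
        tens L H G X (tensor L K H Y Z) l \<gamma> (\<eta>, x, tens L K H Y Z l \<eta> (\<kappa>, y, z)))"
    using * by (intro bexI[of _ \<kappa>] bexI[of _ "tens K H G X Y \<kappa> \<gamma> (\<eta>, x, y)"] bexI[of _ z]) (simp_all add: case_XY)
next
  fix l' g \<kappa> v z
  assume *: "l' \<in> Ar L" "g \<in> Ar G" "\<kappa> \<in> Ob K" "v \<in> Val (tensor K H G X Y) (\<kappa>, Src G g)" "z \<in> Val Z (Tgt L l', \<kappa>)"
  then obtain \<eta> x y where "\<eta> \<in> Ob H" "x \<in> Val X (\<eta>, Src G g)" "y \<in> Val Y (\<kappa>, \<eta>)"
    "v = tens K H G X Y \<kappa> (Src G g) (\<eta>, x, y)"
    by (elim XY.tensE) simp_all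
  with * show "(case class_rep (Act (tensor K H G X Y) (Idt K \<kappa>, g) v) of (\<eta>, x, y) \<Rightarrow>
        tens L H G X (tensor L K H Y Z) (Src L l') (Tgt G g)
          (\<eta>, x, tens L K H Y Z (Src L l') \<eta> (\<kappa>, y, Act Z (l', Idt K \<kappa>) z)))
      = Act (tensor L H G X (tensor L K H Y Z)) (l', g) (case class_rep v of (\<eta>, x, y) \<Rightarrow>
        tens L H G X (tensor L K H Y Z) (Tgt L l') (Src G g) (\<eta>, x, tens L K H Y Z (Tgt L l') \<eta> (\<kappa>, y, z)))"
    by (simp add: case_XY)
qed (simp_all add: X_YZ.biset_tensor)

end

section \<open>The Burnside bicategory\<close>

lemma Burnside_simps [simp]:
  "BOb Burnside = {G. groupoid G}" "BHom Burnside = burnside_hom"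
  "comp1 Burnside K H G X Y = tensor K H G X Y" "comp2 Burnside K H G s t = tensor_map K H G s t"
  "BId Burnside = id_biset" "BAssoc Burnside = burnside_assoc" "BLun Burnside = burnside_lun"
  "BRun Burnside = burnside_run"
  by (simp_all add: Burnside_def)

lemma tensor_map_simps [simp]:
  "csrc (tensor_map K H G s t) = tensor K H G (csrc s) (csrc t)"
  "ctgt (tensor_map K H G s t) = tensor K H G (ctgt s) (ctgt t)"
  by (simp_all add: tensor_map_def)

lemma burnside_assoc_simps [simp]:
  "csrc (burnside_assoc L K H G X Y Z) = tensor L K G (tensor K H G X Y) Z"
  "ctgt (burnside_assoc L K H G X Y Z) = tensor L H G X (tensor L K H Y Z)"
  by (simp_all add: burnside_assoc_def)

lemma burnside_unitor_simps [simp]: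
  "csrc (burnside_lun H G X) = tensor H G G (id_biset G) X" "ctgt (burnside_lun H G X) = X"
  "csrc (burnside_run H G X) = tensor H H G X (id_biset H)" "ctgt (burnside_run H G X) = X"
  by (simp_all add: burnside_lun_def burnside_run_def)

lemma tensor_map_idt:
  assumes "biset H G X" "biset K H Y"
  shows "tensor_map K H G (Idt (burnside_hom H G) X) (Idt (burnside_hom K H) Y)
    = Idt (burnside_hom K G) (tensor K H G X Y)"
proof -
  interpret tensor_iso K H G X X Y Y "Idt (burnside_hom H G) X" "Idt (burnside_hom K H) Y"
    using assms by (intro tensor_iso.intro biset_iso_idt)
  show ?thesis
    by (rule biset_iso_eqI[OF biset_iso_tensor_map biset_iso_idt[OF XY.biset_tensor]])
      (auto elim!: XY.tensE)
qed

lemma tensor_map_cmp: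
  assumes "biset_iso H G X X' s" "biset_iso H G X' X'' s'" "biset_iso K H Y Y' t" "biset_iso K H Y' Y'' t'"
  shows "tensor_map K H G (s' \<cdot>\<^bsub>burnside_hom H G\<^esub> s) (t' \<cdot>\<^bsub>burnside_hom K H\<^esub> t)
    = tensor_map K H G s' t' \<cdot>\<^bsub>burnside_hom K G\<^esub> tensor_map K H G s t"
proof -
  interpret st: tensor_iso K H G X X' Y Y' s t
    using assms by (intro tensor_iso.intro)
  interpret st': tensor_iso K H G X' X'' Y' Y'' s' t'
    using assms by (intro tensor_iso.intro)
  interpret c: tensor_iso K H G X X'' Y Y'' "s' \<cdot>\<^bsub>burnside_hom H G\<^esub> s" "t' \<cdot>\<^bsub>burnside_hom K H\<^esub> t"
    using assms by (intro tensor_iso.intro biset_iso_cmp)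
  show ?thesis
    by (rule biset_iso_eqI[OF c.biset_iso_tensor_map
          biset_iso_cmp[OF st.biset_iso_tensor_map st'.biset_iso_tensor_map]])
      (auto elim!: st.XY.tensE simp: st.s.csrc st.t.csrc)
qed

lemma bicategory_Burnside: "bicategory (Burnside :: ('u::infinite grpd, 'u biset, 'u biset_map) bicat)"
proof (rule bicategory.intro, goal_cases)
  case 1
  then show ?case
    by (simp add: groupoid.axioms(1)[OF groupoid_burnside_hom])
next
  case (2 a b c)
  then have g: "groupoid a" "groupoid b" "groupoid c" by simp_all
  note iffs = burnside_hom_ob[OF g(1,2)] burnside_hom_ar[OF g(1,2)] burnside_hom_ob[OF g(2,3)]
    burnside_hom_ar[OF g(2,3)] burnside_hom_ob[OF g(1,3)] burnside_hom_ar[OF g(1,3)]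
  show ?case
  proof (rule is_functorI)
    fix X assume "X \<in> Ob (prod_cat (BHom Burnside b c) (BHom Burnside a b))"
    then show "FO (BComp Burnside a b c) X \<in> Ob (BHom Burnside a c)"
      by (auto simp: iffs tensor_pair_def tensor_pair.biset_tensor tensor_pair.admissible_tensor)
  next
    fix f assume "f \<in> Ar (prod_cat (BHom Burnside b c) (BHom Burnside a b))"
    then obtain s t where f: "f = (s, t)" "biset_iso b c (csrc s) (ctgt s) s" "biset_iso a b (csrc t) (ctgt t) t"
      and adm: "admissible b c (csrc s)" "admissible b c (ctgt s)" "admissible a b (csrc t)" "admissible a b (ctgt t)"
      by (auto simp: iffs)
    interpret tensor_iso a b c "csrc s" "ctgt s" "csrc t" "ctgt t" s t
      using f by (intro tensor_iso.intro)
    show "FA (BComp Burnside a b c) f \<in> Ar (BHom Burnside a c) \<and>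
      Src (BHom Burnside a c) (FA (BComp Burnside a b c) f)
        = FO (BComp Burnside a b c) (Src (prod_cat (BHom Burnside b c) (BHom Burnside a b)) f) \<and>
      Tgt (BHom Burnside a c) (FA (BComp Burnside a b c) f)
        = FO (BComp Burnside a b c) (Tgt (prod_cat (BHom Burnside b c) (BHom Burnside a b)) f)"
      using adm by (simp add: f(1) iffs biset_iso_tensor_map XY.admissible_tensor XY'.admissible_tensor)
  next
    fix f g assume "f \<in> Ar (prod_cat (BHom Burnside b c) (BHom Burnside a b))"
      "g \<in> Ar (prod_cat (BHom Burnside b c) (BHom Burnside a b))"
      "Tgt (prod_cat (BHom Burnside b c) (BHom Burnside a b)) f = Src (prod_cat (BHom Burnside b c) (BHom Burnside a b)) g"
    then show "FA (BComp Burnside a b c) (g \<cdot>\<^bsub>prod_cat (BHom Burnside b c) (BHom Burnside a b)\<^esub> f) =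
      FA (BComp Burnside a b c) g \<cdot>\<^bsub>BHom Burnside a c\<^esub> FA (BComp Burnside a b c) f"
      by (auto simp: iffs intro!: tensor_map_cmp)
  qed (use g in \<open>auto simp: iffs tensor_map_idt category_prod_cat groupoid.axioms(1)[OF groupoid_burnside_hom]\<close>)
next
  case 3
  then show ?case
    by (simp add: burnside_hom_ob biset_id_biset admissible_id_biset)
next
  case (4 a b c d f g h)
  then have bi: "biset a b f" "biset b c g" "biset c d h"
    and adm: "admissible a b f" "admissible b c g" "admissible c d h"
    by (simp_all add: burnside_hom_ob)
  interpret tensor_triple a b c d h g f
    using bi by (intro tensor_triple.intro tensor_pair.intro)
  show ?case
    using 4 adm by (simp add: burnside_hom_isos biset_iso_assoc XY.admissible_tensor YZ.admissible_tensor
        XY_Z.admissible_tensor X_YZ.admissible_tensor)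
next
  case (5 a b c d \<alpha> f f' \<beta> g g' \<gamma> h h')
  then have isos: "biset_iso a b f f' \<alpha>" "biset_iso b c g g' \<beta>" "biset_iso c d h h' \<gamma>"
    by (simp_all add: burnside_hom_homset)
  interpret \<gamma>\<beta>: tensor_iso b c d h h' g g' \<gamma> \<beta>
    using isos by (intro tensor_iso.intro)
  interpret \<beta>\<alpha>: tensor_iso a b c g g' f f' \<beta> \<alpha>
    using isos by (intro tensor_iso.intro)
  interpret \<gamma>\<beta>_\<alpha>: tensor_iso a b d "tensor b c d h g" "tensor b c d h' g'" f f' "tensor_map b c d \<gamma> \<beta>" \<alpha>
    using isos by (intro tensor_iso.intro \<gamma>\<beta>.biset_iso_tensor_map)
  interpret \<gamma>_\<beta>\<alpha>: tensor_iso a c d h h' "tensor a b c g f" "tensor a b c g' f'" \<gamma> "tensor_map a b c \<beta> \<alpha>"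
    using isos by (intro tensor_iso.intro \<beta>\<alpha>.biset_iso_tensor_map)
  interpret A: tensor_triple a b c d h g f
    by (intro tensor_triple.intro \<gamma>\<beta>.XY.tensor_pair_axioms \<beta>\<alpha>.XY.tensor_pair_axioms)
  interpret A': tensor_triple a b c d h' g' f'
    by (intro tensor_triple.intro \<gamma>\<beta>.XY'.tensor_pair_axioms \<beta>\<alpha>.XY'.tensor_pair_axioms)
  note src_tgt = \<gamma>\<beta>.s.csrc \<gamma>\<beta>.s.ctgt \<gamma>\<beta>.t.csrc \<gamma>\<beta>.t.ctgt \<beta>\<alpha>.t.csrc \<beta>\<alpha>.t.ctgt
  show ?case
    unfolding Burnside_simps
  proof (rule burnside_cmp_eqI)
    fix \<eta> \<gamma>' x assume *: "\<eta> \<in> Ob a" "\<gamma>' \<in> Ob d" "x \<in> Val (tensor a b d (tensor b c d h g) f) (\<eta>, \<gamma>')"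
    then show "cmpt (burnside_assoc a b c d h' g' f') (\<eta>, \<gamma>')
        (cmpt (tensor_map a b d (tensor_map b c d \<gamma> \<beta>) \<alpha>) (\<eta>, \<gamma>') x)
      = cmpt (tensor_map a c d \<gamma> (tensor_map a b c \<beta> \<alpha>)) (\<eta>, \<gamma>')
        (cmpt (burnside_assoc a b c d h g f) (\<eta>, \<gamma>') x)"
      by (auto elim!: \<gamma>\<beta>_\<alpha>.XY.tensE \<gamma>\<beta>.XY.tensE)
  qed (simp_all add: src_tgt)
next
  case (6 a b f)
  then have f: "biset a b f" "admissible a b f"
    by (simp_all add: burnside_hom_ob)
  interpret tensor_pair a b b "id_biset b" f
    using f(1) by (rule tensor_pair_lun)
  show ?case
    using 6 f by (simp add: burnside_hom_isos biset_iso_lun admissible_tensor admissible_id_biset)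
next
  case (7 a b \<alpha> f f')
  then have \<alpha>: "biset_iso a b f f' \<alpha>"
    by (simp add: burnside_hom_homset)
  then interpret \<alpha>: biset_iso a b f f' \<alpha> .
  interpret tensor_iso a b b "id_biset b" "id_biset b" f f' "Idt (burnside_hom b b) (id_biset b)" \<alpha>
    using \<alpha> 7 by (intro tensor_iso.intro biset_iso_idt biset_id_biset) simp_all
  show ?case
    unfolding Burnside_simps
    by (rule burnside_cmp_eqI[of _ "tensor a b b (id_biset b) f"])
      (auto elim!: XY.tensE simp: \<alpha>.csrc \<alpha>.ctgt burnside_lun_tens[OF \<alpha>.X.biset_axioms] burnside_lun_tens[OF \<alpha>.Y.biset_axioms])
next
  case (8 a b f)
  then have f: "biset a b f" "admissible a b f"
    by (simp_all add: burnside_hom_ob)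
  interpret tensor_pair a a b f "id_biset a"
    using f(1) by (rule tensor_pair_run)
  show ?case
    using 8 f by (simp add: burnside_hom_isos biset_iso_run admissible_tensor admissible_id_biset)
next
  case (9 a b \<alpha> f f')
  then have \<alpha>: "biset_iso a b f f' \<alpha>"
    by (simp add: burnside_hom_homset)
  then interpret \<alpha>: biset_iso a b f f' \<alpha> .
  interpret tensor_iso a a b f f' "id_biset a" "id_biset a" \<alpha> "Idt (burnside_hom a a) (id_biset a)"
    using \<alpha> 9 by (intro tensor_iso.intro biset_iso_idt biset_id_biset) simp_all
  show ?case
    unfolding Burnside_simps
    by (rule burnside_cmp_eqI[of _ "tensor a a b f (id_biset a)"])
      (auto elim!: XY.tensE simp: \<alpha>.csrc \<alpha>.ctgt burnside_run_tens[OF \<alpha>.X.biset_axioms] burnside_run_tens[OF \<alpha>.Y.biset_axioms])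
next
  \<comment> \<open>The pentagon: both routes send [[[x, y], z], w] to [x, [y, [z, w]]]. Each of the
    five associators is evaluated through its own \<open>tensor_triple\<close>, and the two
    whiskered ones also through a \<open>tensor_iso\<close>.\<close>
  case (10 a b c d e f g h k)
  then have bi: "biset a b f" "biset b c g" "biset c d h" "biset d e k"
    by (simp_all add: burnside_hom_ob)
  interpret khg: tensor_triple b c d e k h g
    using bi by (intro tensor_triple.intro tensor_pair.intro)
  interpret hgf: tensor_triple a b c d h g f
    using bi by (intro tensor_triple.intro tensor_pair.intro)
  interpret t1: tensor_triple a b c e "tensor c d e k h" g f
    using bi by (intro tensor_triple.intro tensor_pair.intro khg.XY.biset_tensor)
  interpret t2: tensor_triple a c d e k h "tensor a b c g f"
    using bi by (intro tensor_triple.intro tensor_pair.intro hgf.YZ.biset_tensor)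
  interpret t3: tensor_triple a b d e k "tensor b c d h g" f
    using bi by (intro tensor_triple.intro tensor_pair.intro khg.YZ.biset_tensor)
  interpret i1: tensor_iso a b e "tensor b c e (tensor c d e k h) g" "tensor b d e k (tensor b c d h g)" f f
    "burnside_assoc b c d e k h g" "Idt (burnside_hom a b) f"
    using bi by (intro tensor_iso.intro khg.biset_iso_assoc biset_iso_idt)
  interpret i2: tensor_iso a d e k k "tensor a b d (tensor b c d h g) f" "tensor a c d h (tensor a b c g f)"
    "Idt (burnside_hom d e) k" "burnside_assoc a b c d h g f"
    using bi by (intro tensor_iso.intro hgf.biset_iso_assoc biset_iso_idt)
  show ?case
    unfolding Burnside_simps
  proof (rule burnside_cmp_eqI[of _ "tensor a b e (tensor b c e (tensor c d e k h) g) f"])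
    fix \<eta> \<gamma> x assume *: "\<eta> \<in> Ob a" "\<gamma> \<in> Ob e" "x \<in> Val (tensor a b e (tensor b c e (tensor c d e k h) g) f) (\<eta>, \<gamma>)"
    then show "cmpt (burnside_assoc a c d e k h (tensor a b c g f)) (\<eta>, \<gamma>)
        (cmpt (burnside_assoc a b c e (tensor c d e k h) g f) (\<eta>, \<gamma>) x)
      = cmpt (tensor_map a d e (Idt (burnside_hom d e) k) (burnside_assoc a b c d h g f)) (\<eta>, \<gamma>)
        (cmpt (burnside_assoc a b d e k (tensor b c d h g) f \<cdot>\<^bsub>burnside_hom a e\<^esub>
          tensor_map a b e (burnside_assoc b c d e k h g) (Idt (burnside_hom a b) f)) (\<eta>, \<gamma>) x)"
      by (auto elim!: t1.XY_Z.tensE khg.XY_Z.tensE khg.XY.tensE)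
  qed simp_all
next
  case (11 a b c f g)
  then have bi: "biset a b f" "biset b c g" "biset b b (id_biset b)"
    by (simp_all add: burnside_hom_ob biset_id_biset)
  interpret t: tensor_triple a b b c g "id_biset b" f
    using bi by (intro tensor_triple.intro tensor_pair.intro)
  interpret l: tensor_iso a b c g g "tensor a b b (id_biset b) f" f "Idt (burnside_hom b c) g" "burnside_lun a b f"
    using bi by (intro tensor_iso.intro biset_iso_idt biset_iso_lun)
  interpret r: tensor_iso a b c "tensor b b c g (id_biset b)" g f f "burnside_run b c g" "Idt (burnside_hom a b) f"
    using bi by (intro tensor_iso.intro biset_iso_idt biset_iso_run)
  show ?case
    unfolding Burnside_simps
  proof (rule biset_iso_eqI[OF biset_iso_cmp[OF t.biset_iso_assoc l.biset_iso_tensor_map] r.biset_iso_tensor_map])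
    fix \<alpha> \<gamma> w assume *: "\<alpha> \<in> Ob a" "\<gamma> \<in> Ob c" "w \<in> Val (tensor a b c (tensor b b c g (id_biset b)) f) (\<alpha>, \<gamma>)"
    then obtain \<beta> v y where v: "\<beta> \<in> Ob b" "v \<in> Val (tensor b b c g (id_biset b)) (\<beta>, \<gamma>)" "y \<in> Val f (\<alpha>, \<beta>)"
      "w = tens a b c (tensor b b c g (id_biset b)) f \<alpha> \<gamma> (\<beta>, v, y)"
      by (elim t.XY_Z.tensE)
    then obtain x h where "h \<in> Ar b" "Src b h = \<beta>" "x \<in> Val g (Tgt b h, \<gamma>)"
      "v = tens b b c g (id_biset b) \<beta> \<gamma> (Tgt b h, x, h)"
      using * by (auto elim!: t.XY.tensE)
    then show "cmpt (tensor_map a b c (Idt (burnside_hom b c) g) (burnside_lun a b f) \<cdot>\<^bsub>burnside_hom a c\<^esub>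
        burnside_assoc a b b c g (id_biset b) f) (\<alpha>, \<gamma>) w
      = cmpt (tensor_map a b c (burnside_run b c g) (Idt (burnside_hom a b) f)) (\<alpha>, \<gamma>) w"
      \<comment> \<open>On [[x, h], y] one side yields [x, h y] and the other [x h, y]; the triangle
        is this one slide.\<close>
      using * v l.XY'.tens_slide[of \<alpha> \<gamma> h x y] bi
      by (auto simp: burnside_lun_tens burnside_run_tens)
  qed
qed

section \<open>The pseudo-functor of all functors\<close>

locale grpd_functor = H: groupoid H + G: groupoid G for H G :: "'u grpd" +
  fixes p :: "'u gfun"
  assumes functors: "p \<in> functors H G"
begin

sublocale p: is_functor H G p
  by (rule functors_is_functor[OF functors])

lemma S_biset_val [simp]:
  "\<lbrakk>\<eta> \<in> Ob H; \<gamma> \<in> Ob G\<rbrakk>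
    \<Longrightarrow> f \<in> Val (S_biset H G p) (\<eta>, \<gamma>) \<longleftrightarrow> f \<in> Ar G \<and> Src G f = FO p \<eta> \<and> Tgt G f = \<gamma>"
  by (simp add: S_biset_def homset_iff)

lemma S_biset_act [simp]:
  "\<lbrakk>h \<in> Ar H; g \<in> Ar G; f \<in> Ar G; Src G f = FO p (Tgt H h); Tgt G f = Src G g\<rbrakk>
    \<Longrightarrow> Act (S_biset H G p) (h, g) f = g \<cdot>\<^bsub>G\<^esub> f \<cdot>\<^bsub>G\<^esub> FA p h"
  by (simp add: S_biset_def homset_iff)

lemma T_biset_val [simp]:
  "\<lbrakk>\<gamma> \<in> Ob G; \<eta> \<in> Ob H\<rbrakk>
    \<Longrightarrow> f \<in> Val (T_biset H G p) (\<gamma>, \<eta>) \<longleftrightarrow> f \<in> Ar G \<and> Src G f = \<gamma> \<and> Tgt G f = FO p \<eta>"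
  by (simp add: T_biset_def homset_iff)

lemma T_biset_act [simp]:
  "\<lbrakk>g \<in> Ar G; h \<in> Ar H; f \<in> Ar G; Src G f = Tgt G g; Tgt G f = FO p (Src H h)\<rbrakk>
    \<Longrightarrow> Act (T_biset H G p) (g, h) f = FA p h \<cdot>\<^bsub>G\<^esub> f \<cdot>\<^bsub>G\<^esub> g"
  by (simp add: T_biset_def homset_iff)

lemma biset_S_biset: "biset H G (S_biset H G p)"
  unfolding S_biset_def
  by (rule trim_bisets) (auto simp: homset_iff H.groupoid_axioms G.groupoid_axioms)

lemma biset_T_biset: "biset G H (T_biset H G p)"
  unfolding T_biset_def
  by (rule trim_bisets) (auto simp: homset_iff H.groupoid_axioms G.groupoid_axioms)

text \<open>G(p \<eta>, -) is representable, hence free on one generator, the identity at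
  \<open>FO p \<eta>\<close>.\<close>

lemma admissible_S_biset: "admissible H G (S_biset H G p)"
proof -
  interpret S: biset H G "S_biset H G p" by (rule biset_S_biset)
  show ?thesis
    unfolding S.admissible_iff
  proof (intro ballI conjI)
    fix \<eta> g g' f assume "\<eta> \<in> Ob H" "g \<in> Ar G" "g' \<in> Ar G" "f \<in> Val (S_biset H G p) (\<eta>, Src G g)"
    then show "Src G g = Src G g' \<longrightarrow> Tgt G g = Tgt G g' \<longrightarrow>
      Act (S_biset H G p) (Idt H \<eta>, g) f = Act (S_biset H G p) (Idt H \<eta>, g') f \<longrightarrow> g = g'"
      using G.right_cancel[of g g' f] by auto
  next
    fix \<eta> assume "\<eta> \<in> Ob H"
    then show "\<exists>F. finite F \<and> F \<subseteq> (SIGMA \<gamma>:Ob G. Val (S_biset H G p) (\<eta>, \<gamma>)) \<and>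
      (\<forall>\<gamma>\<in>Ob G. \<forall>x\<in>Val (S_biset H G p) (\<eta>, \<gamma>). \<exists>(\<gamma>', y)\<in>F. \<exists>g\<in>Ar G. Src G g = \<gamma>' \<and> Tgt G g = \<gamma> \<and>
        x = Act (S_biset H G p) (Idt H \<eta>, g) y)"
      by (intro exI[of _ "{(FO p \<eta>, Idt G (FO p \<eta>))}"]) auto
  qed
qed

text \<open>The \<open>H\<close>-set \<open>G(\<gamma>, p -)\<close> is free because an arrow of \<open>H\<close> is determined by its source and its
  image, and it is generated by the identities over the fibre of \<open>\<gamma>\<close>: lift the inverse of a given
  \<open>f : \<gamma> \<rightarrow> p \<eta>\<close>.\<close>

lemma admissible_T_biset:
  assumes "finite_cover H G p"
  shows "admissible G H (T_biset H G p)"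
proof -
  have cover: "cover H G p"
    using assms by (simp add: finite_cover_def)
  interpret T: biset G H "T_biset H G p" by (rule biset_T_biset)
  show ?thesis
    unfolding T.admissible_iff
  proof (intro ballI conjI impI)
    fix \<gamma> h h' f
    assume *: "\<gamma> \<in> Ob G" "h \<in> Ar H" "h' \<in> Ar H" "f \<in> Val (T_biset H G p) (\<gamma>, Src H h)"
      "Src H h = Src H h'" "Tgt H h = Tgt H h'"
      "Act (T_biset H G p) (Idt G \<gamma>, h) f = Act (T_biset H G p) (Idt G \<gamma>, h') f"
    then have "FA p h = FA p h'"
      using G.right_cancel[of "FA p h" "FA p h'" f] by auto
    with * show "h = h'"
      by - (rule coverD(3)[OF cover], auto)
  next
    fix \<gamma> assume \<gamma>: "\<gamma> \<in> Ob G"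
    let ?F = "(\<lambda>\<eta>. (\<eta>, Idt G \<gamma>)) ` {\<eta> \<in> Ob H. FO p \<eta> = \<gamma>}"
    have "\<exists>(\<eta>', y)\<in>?F. \<exists>h\<in>Ar H. Src H h = \<eta>' \<and> Tgt H h = \<eta> \<and> f = Act (T_biset H G p) (Idt G \<gamma>, h) y"
      if \<eta>: "\<eta> \<in> Ob H" and f: "f \<in> Val (T_biset H G p) (\<gamma>, \<eta>)" for \<eta> f
    proof -
      obtain h where h: "h \<in> Ar H" "Src H h = \<eta>" "FA p h = inv_arrow G f"
        using coverD(2)[OF cover, of \<eta> "inv_arrow G f"] \<eta> f \<gamma> by auto
      then have "FO p (Tgt H h) = \<gamma>" "FA p (inv_arrow H h) = f"
        using p.ar(3)[of h] p.map_inv[of h] f \<gamma> \<eta> H.groupoid_axioms G.groupoid_axioms by auto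
      then show ?thesis
        using h f \<gamma> \<eta> by (intro bexI[of _ "(Tgt H h, Idt G \<gamma>)"]) (auto intro!: bexI[of _ "inv_arrow H h"])
    qed
    moreover have "finite ?F" "?F \<subseteq> (SIGMA \<eta>:Ob H. Val (T_biset H G p) (\<gamma>, \<eta>))"
      using assms \<gamma> by (auto simp: finite_cover_def)
    ultimately show "\<exists>F. finite F \<and> F \<subseteq> (SIGMA \<eta>:Ob H. Val (T_biset H G p) (\<gamma>, \<eta>)) \<and>
      (\<forall>\<eta>\<in>Ob H. \<forall>x\<in>Val (T_biset H G p) (\<gamma>, \<eta>). \<exists>(\<eta>', y)\<in>F. \<exists>h\<in>Ar H. Src H h = \<eta>' \<and> Tgt H h = \<eta> \<and>
        x = Act (T_biset H G p) (Idt G \<gamma>, h) y)"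
      by (intro exI[of _ ?F]) blast
  qed
qed

end

lemma grpd_functor_id: "groupoid G \<Longrightarrow> grpd_functor G G (id_fctr G)"
  by (simp add: grpd_functor_def grpd_functor_axioms_def id_fctr_functors groupoid.axioms(1))

text \<open>Trimming turns agreement on objects and arrows into an equality of records, which lets
  the unit comparison be an identity cell. The same happens for T below.\<close>

lemma S_biset_id:
  assumes "groupoid G"
  shows "S_biset G G (id_fctr G) = id_biset G"
proof -
  interpret groupoid G by fact
  show ?thesis
    unfolding S_biset_def id_biset_def
    by (rule cset_trim_cong) (auto simp: category_prod_cat category_op_cat category_axioms)
qed

lemma T_biset_id:
  assumes "groupoid G"
  shows "T_biset G G (id_fctr G) = id_biset G"
proof -
  interpret groupoid G by fact
  show ?thesis
    unfolding T_biset_def id_biset_def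
    by (rule cset_trim_cong) (auto simp: category_prod_cat category_op_cat category_axioms)
qed

locale grpd_transformation = transformation H G p p' \<alpha> + p: grpd_functor H G p + p': grpd_functor H G p'
  for H G :: "'u grpd" and p p' \<alpha>
begin

text \<open>The naturality square of \<alpha> is composed with inverse components on both sides. S
  acts on 2-cells through these inverses, and this is their naturality.\<close>

lemma inv_natural:
  assumes "h \<in> Ar H" "Tgt H h = \<eta>"
  shows "inv_arrow G (cmpt \<alpha> \<eta>) \<cdot>\<^bsub>G\<^esub> FA p' h = FA p h \<cdot>\<^bsub>G\<^esub> inv_arrow G (cmpt \<alpha> (Src H h))"
proof -
  have "inv_arrow G (cmpt \<alpha> \<eta>) \<cdot>\<^bsub>G\<^esub> (FA p' h \<cdot>\<^bsub>G\<^esub> cmpt \<alpha> (Src H h)) \<cdot>\<^bsub>G\<^esub> inv_arrow G (cmpt \<alpha> (Src H h))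
    = inv_arrow G (cmpt \<alpha> \<eta>) \<cdot>\<^bsub>G\<^esub> (cmpt \<alpha> \<eta> \<cdot>\<^bsub>G\<^esub> FA p h) \<cdot>\<^bsub>G\<^esub> inv_arrow G (cmpt \<alpha> (Src H h))"
    using assms by (simp only: natural)
  then show ?thesis
    using assms by auto
qed

end

lemma grpd_transformationI:
  assumes "groupoid H" "groupoid G" "\<alpha> \<in> nat_trans H G" "csrc \<alpha> = p" "ctgt \<alpha> = p'"
  shows "grpd_transformation H G p p' \<alpha>"
  using transformationI[OF assms(3-)] nat_trans_functors[OF assms(3)] assms
  by (simp add: grpd_transformation_def grpd_functor_def grpd_functor_axioms_def)

text \<open>G(p \<eta>, \<gamma>) is contravariant in p, so a transformation from p to p' acts from
  S(p) to S(p') by precomposition with its inverse component.\<close>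

definition S_map :: "'u grpd \<Rightarrow> 'u grpd \<Rightarrow> 'u gnat \<Rightarrow> 'u biset_map" where
  "S_map H G \<alpha> = mk_map H G (S_biset H G (csrc \<alpha>)) (S_biset H G (ctgt \<alpha>))
     (\<lambda>\<eta> \<gamma> f. f \<cdot>\<^bsub>G\<^esub> inv_arrow G (cmpt \<alpha> \<eta>))"

definition S_comp :: "'u::infinite grpd \<Rightarrow> 'u grpd \<Rightarrow> 'u grpd \<Rightarrow> 'u gfun \<Rightarrow> 'u gfun \<Rightarrow> 'u biset_map" where
  "S_comp K H G p q =
     mk_map K G (tensor K H G (S_biset H G p) (S_biset K H q)) (S_biset K G (comp_fctr K p q))
       (\<lambda>\<kappa> \<gamma> z. case class_rep z of (\<eta>, g, h) \<Rightarrow> g \<cdot>\<^bsub>G\<^esub> FA p h)"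

text \<open>The unit comparison must end at S(id), which \<open>S_biset_id\<close> identifies with
  \<open>id_biset\<close>; hence an identity cell.\<close>

definition S_psfun :: "('u::infinite grpd, 'u gfun, 'u gnat, 'u grpd, 'u biset, 'u biset_map) psfun" where
  "S_psfun = \<lparr>PO = (\<lambda>G. G), PHom = (\<lambda>H G. \<lparr>FO = S_biset H G, FA = S_map H G\<rparr>), PComp = S_comp,
     PUnit = (\<lambda>G. Idt (burnside_hom G G) (id_biset G))\<rparr>"

text \<open>\<open>G\<close> comes first because the result is a 2-cell of B(G, H), although
  \<alpha> runs between functors from H to G.\<close>

definition T_map :: "'u grpd \<Rightarrow> 'u grpd \<Rightarrow> 'u gnat \<Rightarrow> 'u biset_map" where
  "T_map G H \<alpha> = mk_map G H (T_biset H G (csrc \<alpha>)) (T_biset H G (ctgt \<alpha>)) (\<lambda>\<gamma> \<eta> f. cmpt \<alpha> \<eta> \<cdot>\<^bsub>G\<^esub> f)"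

text \<open>The arguments follow the opposite bicategory: there \<open>p\<close> is a 1-cell from G
  to H, \<open>q\<close> one from H to K, and \<open>comp_fctr K p q\<close> is their
  composite.\<close>

definition T_comp :: "'u::infinite grpd \<Rightarrow> 'u grpd \<Rightarrow> 'u grpd \<Rightarrow> 'u gfun \<Rightarrow> 'u gfun \<Rightarrow> 'u biset_map" where
  "T_comp G H K q p =
     mk_map G K (tensor G H K (T_biset K H q) (T_biset H G p)) (T_biset K G (comp_fctr K p q))
       (\<lambda>\<gamma> \<kappa> z. case class_rep z of (\<eta>, h, g) \<Rightarrow> FA p h \<cdot>\<^bsub>G\<^esub> g)"

definition T_psfun :: "('u::infinite grpd, 'u gfun, 'u gnat, 'u grpd, 'u biset, 'u biset_map) psfun" where
  "T_psfun = \<lparr>PO = (\<lambda>G. G), PHom = (\<lambda>G H. \<lparr>FO = T_biset H G, FA = T_map G H\<rparr>), PComp = T_comp,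
     PUnit = (\<lambda>G. Idt (burnside_hom G G) (id_biset G))\<rparr>"

lemma psfun_simps [simp]:
  "PO S_psfun G = G" "P1 S_psfun H G = S_biset H G" "P2 S_psfun H G = S_map H G"
  "PComp S_psfun = S_comp" "PUnit S_psfun G = Idt (burnside_hom G G) (id_biset G)"
  "PO T_psfun G = G" "P1 T_psfun G H = T_biset H G" "P2 T_psfun G H = T_map G H"
  "PComp T_psfun = T_comp" "PUnit T_psfun G = Idt (burnside_hom G G) (id_biset G)"
  by (simp_all add: S_psfun_def T_psfun_def)

lemma comparison_simps [simp]:
  "csrc (S_map H G \<alpha>) = S_biset H G (csrc \<alpha>)" "ctgt (S_map H G \<alpha>) = S_biset H G (ctgt \<alpha>)"
  "csrc (T_map G H \<alpha>) = T_biset H G (csrc \<alpha>)" "ctgt (T_map G H \<alpha>) = T_biset H G (ctgt \<alpha>)"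
  "csrc (S_comp K H G p q) = tensor K H G (S_biset H G p) (S_biset K H q)"
  "ctgt (S_comp K H G p q) = S_biset K G (comp_fctr K p q)"
  "csrc (T_comp G H K q p) = tensor G H K (T_biset K H q) (T_biset H G p)"
  "ctgt (T_comp G H K q p) = T_biset K G (comp_fctr K p q)"
  by (simp_all add: S_map_def T_map_def S_comp_def T_comp_def)

section \<open>Isomorphisms of bi-sets induced by transformations\<close>

context grpd_transformation
begin

lemma S_map_cmpt [simp]:
  "\<lbrakk>\<eta> \<in> Ob H; \<gamma> \<in> Ob G; f \<in> Ar G; Src G f = FO p \<eta>; Tgt G f = \<gamma>\<rbrakk>
    \<Longrightarrow> cmpt (S_map H G \<alpha>) (\<eta>, \<gamma>) f = f \<cdot>\<^bsub>G\<^esub> inv_arrow G (cmpt \<alpha> \<eta>)"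
  by (simp add: S_map_def csrc)

lemma biset_iso_S_map: "biset_iso H G (S_biset H G p) (S_biset H G p') (S_map H G \<alpha>)"
  unfolding S_map_def csrc ctgt
proof (rule biset_isoI[OF p.biset_S_biset p'.biset_S_biset])
  fix \<eta> \<gamma> assume "\<eta> \<in> Ob H" "\<gamma> \<in> Ob G"
  then show "bij_betw (\<lambda>f. f \<cdot>\<^bsub>G\<^esub> inv_arrow G (cmpt \<alpha> \<eta>)) (Val (S_biset H G p) (\<eta>, \<gamma>)) (Val (S_biset H G p') (\<eta>, \<gamma>))"
    by (intro bij_betw_byWitness[of _ "\<lambda>f. f \<cdot>\<^bsub>G\<^esub> cmpt \<alpha> \<eta>"]) auto
next
  fix h g f assume "h \<in> Ar H" "g \<in> Ar G" "f \<in> Val (S_biset H G p) (Tgt H h, Src G g)"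
  then show "Act (S_biset H G p) (h, g) f \<cdot>\<^bsub>G\<^esub> inv_arrow G (cmpt \<alpha> (Src H h))
      = Act (S_biset H G p') (h, g) (f \<cdot>\<^bsub>G\<^esub> inv_arrow G (cmpt \<alpha> (Tgt H h)))"
    by (simp add: inv_natural)
qed

lemma T_map_cmpt [simp]:
  "\<lbrakk>\<gamma> \<in> Ob G; \<eta> \<in> Ob H; f \<in> Ar G; Src G f = \<gamma>; Tgt G f = FO p \<eta>\<rbrakk>
    \<Longrightarrow> cmpt (T_map G H \<alpha>) (\<gamma>, \<eta>) f = cmpt \<alpha> \<eta> \<cdot>\<^bsub>G\<^esub> f"
  by (simp add: T_map_def csrc)

lemma biset_iso_T_map: "biset_iso G H (T_biset H G p) (T_biset H G p') (T_map G H \<alpha>)"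
  unfolding T_map_def csrc ctgt
proof (rule biset_isoI[OF p.biset_T_biset p'.biset_T_biset])
  fix \<gamma> \<eta> assume "\<gamma> \<in> Ob G" "\<eta> \<in> Ob H"
  then show "bij_betw (\<lambda>f. cmpt \<alpha> \<eta> \<cdot>\<^bsub>G\<^esub> f) (Val (T_biset H G p) (\<gamma>, \<eta>)) (Val (T_biset H G p') (\<gamma>, \<eta>))"
    by (intro bij_betw_byWitness[of _ "\<lambda>f. inv_arrow G (cmpt \<alpha> \<eta>) \<cdot>\<^bsub>G\<^esub> f"]) auto
next
  fix g h f assume *: "g \<in> Ar G" "h \<in> Ar H" "f \<in> Val (T_biset H G p) (Tgt G g, Src H h)"
  then have "(cmpt \<alpha> (Tgt H h) \<cdot>\<^bsub>G\<^esub> FA p h) \<cdot>\<^bsub>G\<^esub> f \<cdot>\<^bsub>G\<^esub> g = (FA p' h \<cdot>\<^bsub>G\<^esub> cmpt \<alpha> (Src H h)) \<cdot>\<^bsub>G\<^esub> f \<cdot>\<^bsub>G\<^esub> g"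
    by (simp only: natural)
  with * show "cmpt \<alpha> (Tgt H h) \<cdot>\<^bsub>G\<^esub> Act (T_biset H G p) (g, h) f
      = Act (T_biset H G p') (g, h) (cmpt \<alpha> (Src H h) \<cdot>\<^bsub>G\<^esub> f)"
    by simp
qed

end

section \<open>Composition comparisons\<close>

locale grpd_functor_pair = q: grpd_functor K H q + p: grpd_functor H G p
  for K H G :: "'u::infinite grpd" and p q
begin

sublocale pq: grpd_functor K G "comp_fctr K p q"
  by unfold_locales (rule comp_fctr_functors[OF q.functors p.functors])

sublocale S: tensor_pair K H G "S_biset H G p" "S_biset K H q"
  by (intro tensor_pair.intro p.biset_S_biset q.biset_S_biset)

sublocale T: tensor_pair G H K "T_biset K H q" "T_biset H G p"
  by (intro tensor_pair.intro p.biset_T_biset q.biset_T_biset)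

lemma S_comp_tens [simp]:
  assumes "\<kappa> \<in> Ob K" "g \<in> Ar G" "h \<in> Ar H" "Src G g = FO p (Tgt H h)" "Src H h = FO q \<kappa>" "\<eta> = Tgt H h" "Tgt G g = \<gamma>"
  shows "cmpt (S_comp K H G p q) (\<kappa>, \<gamma>) (tens K H G (S_biset H G p) (S_biset K H q) \<kappa> \<gamma> (\<eta>, g, h)) = g \<cdot>\<^bsub>G\<^esub> FA p h"
  unfolding S_comp_def by (subst S.mk_map_tens) (use assms in auto)

text \<open>A co-Yoneda isomorphism: the second factor is H(q \<kappa>, -), so [f, id] represents f.
  If g p(h) = g' p(h'), then g = g' p(h' h^-1), and the two pairs differ by a slide along h'
  h^-1.\<close>

lemma biset_iso_S_comp:
  "biset_iso K G (tensor K H G (S_biset H G p) (S_biset K H q)) (S_biset K G (comp_fctr K p q)) (S_comp K H G p q)"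
  unfolding S_comp_def
proof (rule S.biset_iso_tensorI)
  fix \<kappa> \<gamma> \<eta> g h \<eta>' g' h'
  assume *: "\<kappa> \<in> Ob K" "\<gamma> \<in> Ob G" "\<eta> \<in> Ob H" "g \<in> Val (S_biset H G p) (\<eta>, \<gamma>)" "h \<in> Val (S_biset K H q) (\<kappa>, \<eta>)"
    "\<eta>' \<in> Ob H" "g' \<in> Val (S_biset H G p) (\<eta>', \<gamma>)" "h' \<in> Val (S_biset K H q) (\<kappa>, \<eta>')"
    and eq: "g \<cdot>\<^bsub>G\<^esub> FA p h = g' \<cdot>\<^bsub>G\<^esub> FA p h'"
  have "g = (g \<cdot>\<^bsub>G\<^esub> FA p h) \<cdot>\<^bsub>G\<^esub> FA p (inv_arrow H h)"
    using * by (simp add: p.p.map_inv q.G.groupoid_axioms p.G.groupoid_axioms)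
  also have "\<dots> = g' \<cdot>\<^bsub>G\<^esub> FA p (h' \<cdot>\<^bsub>H\<^esub> inv_arrow H h)"
    unfolding eq using * by simp
  finally have "g = g' \<cdot>\<^bsub>G\<^esub> FA p (h' \<cdot>\<^bsub>H\<^esub> inv_arrow H h)" .
  with * show "tens K H G (S_biset H G p) (S_biset K H q) \<kappa> \<gamma> (\<eta>, g, h)
      = tens K H G (S_biset H G p) (S_biset K H q) \<kappa> \<gamma> (\<eta>', g', h')"
    by (subst S.tens_eq_iff) (auto intro!: bexI[of _ "h' \<cdot>\<^bsub>H\<^esub> inv_arrow H h"])
next
  fix \<kappa> \<gamma> f assume "\<kappa> \<in> Ob K" "\<gamma> \<in> Ob G" "f \<in> Val (S_biset K G (comp_fctr K p q)) (\<kappa>, \<gamma>)"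
  then show "\<exists>\<eta>\<in>Ob H. \<exists>g\<in>Val (S_biset H G p) (\<eta>, \<gamma>). \<exists>h\<in>Val (S_biset K H q) (\<kappa>, \<eta>). f = g \<cdot>\<^bsub>G\<^esub> FA p h"
    by (intro bexI[of _ "FO q \<kappa>"] bexI[of _ f] bexI[of _ "Idt H (FO q \<kappa>)"]) auto
qed (auto simp: pq.biset_S_biset)

lemma T_comp_tens [simp]:
  assumes "\<kappa> \<in> Ob K" "g \<in> Ar G" "h \<in> Ar H" "Tgt G g = FO p (Src H h)" "Tgt H h = FO q \<kappa>" "\<eta> = Src H h" "Src G g = \<gamma>"
  shows "cmpt (T_comp G H K q p) (\<gamma>, \<kappa>) (tens G H K (T_biset K H q) (T_biset H G p) \<gamma> \<kappa> (\<eta>, h, g)) = FA p h \<cdot>\<^bsub>G\<^esub> g"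
  unfolding T_comp_def by (subst T.mk_map_tens) (use assms in auto)

text \<open>Dual to the case of S: the first factor is H(-, q \<kappa>), so [id, f] represents f,
  and pairs with equal image differ by a slide along h'^-1 h.\<close>

lemma biset_iso_T_comp:
  "biset_iso G K (tensor G H K (T_biset K H q) (T_biset H G p)) (T_biset K G (comp_fctr K p q)) (T_comp G H K q p)"
  unfolding T_comp_def
proof (rule T.biset_iso_tensorI)
  fix \<gamma> \<kappa> \<eta> h g \<eta>' h' g'
  assume *: "\<gamma> \<in> Ob G" "\<kappa> \<in> Ob K" "\<eta> \<in> Ob H" "h \<in> Val (T_biset K H q) (\<eta>, \<kappa>)" "g \<in> Val (T_biset H G p) (\<gamma>, \<eta>)"
    "\<eta>' \<in> Ob H" "h' \<in> Val (T_biset K H q) (\<eta>', \<kappa>)" "g' \<in> Val (T_biset H G p) (\<gamma>, \<eta>')"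
    and eq: "FA p h \<cdot>\<^bsub>G\<^esub> g = FA p h' \<cdot>\<^bsub>G\<^esub> g'"
  have "g' = FA p (inv_arrow H h') \<cdot>\<^bsub>G\<^esub> FA p h' \<cdot>\<^bsub>G\<^esub> g'"
    using * by (simp add: p.p.map_inv q.G.groupoid_axioms p.G.groupoid_axioms)
  also have "\<dots> = FA p (inv_arrow H h' \<cdot>\<^bsub>H\<^esub> h) \<cdot>\<^bsub>G\<^esub> g"
    unfolding eq[symmetric] using * by simp
  finally have "g' = FA p (inv_arrow H h' \<cdot>\<^bsub>H\<^esub> h) \<cdot>\<^bsub>G\<^esub> g" .
  with * show "tens G H K (T_biset K H q) (T_biset H G p) \<gamma> \<kappa> (\<eta>, h, g)
      = tens G H K (T_biset K H q) (T_biset H G p) \<gamma> \<kappa> (\<eta>', h', g')"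
    by (subst T.tens_eq_iff) (auto intro!: bexI[of _ "inv_arrow H h' \<cdot>\<^bsub>H\<^esub> h"])
next
  fix \<gamma> \<kappa> f assume "\<gamma> \<in> Ob G" "\<kappa> \<in> Ob K" "f \<in> Val (T_biset K G (comp_fctr K p q)) (\<gamma>, \<kappa>)"
  then show "\<exists>\<eta>\<in>Ob H. \<exists>h\<in>Val (T_biset K H q) (\<eta>, \<kappa>). \<exists>g\<in>Val (T_biset H G p) (\<gamma>, \<eta>). f = FA p h \<cdot>\<^bsub>G\<^esub> g"
    by (intro bexI[of _ "FO q \<kappa>"] bexI[of _ "Idt H (FO q \<kappa>)"] bexI[of _ f]) auto
qed (auto simp: pq.biset_T_biset)

end

lemma grpd_functorI: "\<lbrakk>groupoid H; groupoid G; p \<in> functors H G\<rbrakk> \<Longrightarrow> grpd_functor H G p"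
  by (simp add: grpd_functor_def grpd_functor_axioms_def)

lemma pseudofunctor_S: "pseudofunctor Grpd Burnside S_psfun"
proof (intro pseudofunctor.intro pseudofunctor_axioms.intro, goal_cases)
  case 1
  show ?case by (rule strict_bicategory.bicategory[OF strict_bicategory_Grpd])
next
  case 2
  show ?case by (rule bicategory_Burnside)
next
  case 3
  then show ?case by simp
next
  case (4 H G)
  then have g: "groupoid H" "groupoid G" by simp_all
  interpret B: groupoid "burnside_hom H G" using g by (rule groupoid_burnside_hom)
  show ?case
    unfolding psfun_simps Grpd_simps Burnside_simps
  proof (rule is_functorI, goal_cases)
    case (3 p)
    then interpret grpd_functor H G p using g by (intro grpd_functorI) simp_all
    show ?case by (simp add: burnside_hom_ob g biset_S_biset admissible_S_biset)
  next
    case (4 \<alpha>)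
    then interpret grpd_transformation H G "csrc \<alpha>" "ctgt \<alpha>" \<alpha>
      using g by (intro grpd_transformationI) simp_all
    show ?case
      by (simp add: burnside_hom_ar g biset_iso_S_map p.admissible_S_biset p'.admissible_S_biset)
  next
    case (5 p)
    then interpret grpd_transformation H G p p "Idt (functor_cat H G) p"
      using g by (intro grpd_transformationI functor_cat_idt) simp_all
    show ?case
      unfolding psfun_simps
      by (rule biset_iso_eqI[OF biset_iso_S_map biset_iso_idt[OF p.biset_S_biset]]) auto
  next
    case (6 \<alpha> \<beta>)
    interpret \<alpha>: grpd_transformation H G "csrc \<alpha>" "csrc \<beta>" \<alpha>
      using g 6 by (intro grpd_transformationI) simp_all
    interpret \<beta>: grpd_transformation H G "csrc \<beta>" "ctgt \<beta>" \<beta>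
      using g 6 by (intro grpd_transformationI) simp_all
    interpret \<beta>\<alpha>: grpd_transformation H G "csrc \<alpha>" "ctgt \<beta>" "\<beta> \<cdot>\<^bsub>functor_cat H G\<^esub> \<alpha>"
      using g 6 by (intro grpd_transformationI functor_cat_cmp) simp_all
    show ?case
      unfolding psfun_simps
      by (rule biset_iso_eqI[OF \<beta>\<alpha>.biset_iso_S_map biset_iso_cmp[OF \<alpha>.biset_iso_S_map \<beta>.biset_iso_S_map]]) auto
  qed (simp_all add: category_functor_cat B.category_axioms)
next
  case (5 K H G q p)
  then interpret grpd_functor_pair K H G p q
    by (intro grpd_functor_pair.intro grpd_functorI) simp_all
  show ?case
    using 5 by (simp add: burnside_hom_isos biset_iso_S_comp S.admissible_tensor p.admissible_S_biset
        q.admissible_S_biset pq.admissible_S_biset)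
next
  case (6 K H G \<alpha> q q' \<beta> p p')
  then have g: "groupoid K" "groupoid H" "groupoid G" by simp_all
  interpret \<alpha>: grpd_transformation K H q q' \<alpha>
    using 6 by (intro grpd_transformationI) (simp_all add: homset_iff)
  interpret \<beta>: grpd_transformation H G p p' \<beta>
    using 6 by (intro grpd_transformationI) (simp_all add: homset_iff)
  interpret pq: grpd_functor_pair K H G p q ..
  interpret pq': grpd_functor_pair K H G p' q' ..
  interpret \<beta>\<alpha>: grpd_transformation K G "comp_fctr K p q" "comp_fctr K p' q'" "comp_nat K G \<beta> \<alpha>"
    using g by (intro grpd_transformationI comp_nat_nat_trans[OF \<alpha>.nat_trans \<beta>.nat_trans])
      (simp_all add: \<alpha>.csrc \<alpha>.ctgt \<beta>.csrc \<beta>.ctgt)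
  interpret t: tensor_iso K H G "S_biset H G p" "S_biset H G p'" "S_biset K H q" "S_biset K H q'"
    "S_map H G \<beta>" "S_map K H \<alpha>"
    by (intro tensor_iso.intro \<alpha>.biset_iso_S_map \<beta>.biset_iso_S_map)
  show ?case
    unfolding psfun_simps Grpd_simps Burnside_simps
  proof (rule burnside_cmp_eqI[of _ "tensor K H G (S_biset H G p) (S_biset K H q)"])
    fix \<kappa> \<gamma> z assume *: "\<kappa> \<in> Ob K" "\<gamma> \<in> Ob G" "z \<in> Val (tensor K H G (S_biset H G p) (S_biset K H q)) (\<kappa>, \<gamma>)"
    then obtain g h where "g \<in> Ar G" "h \<in> Ar H" "Src G g = FO p (Tgt H h)" "Tgt G g = \<gamma>" "Src H h = FO q \<kappa>"
      "z = tens K H G (S_biset H G p) (S_biset K H q) \<kappa> \<gamma> (Tgt H h, g, h)"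
      by (auto elim!: pq.S.tensE)
    with * show "cmpt (S_comp K H G p' q') (\<kappa>, \<gamma>) (cmpt (tensor_map K H G (S_map H G \<beta>) (S_map K H \<alpha>)) (\<kappa>, \<gamma>) z)
      = cmpt (S_map K G (comp_nat K G \<beta> \<alpha>)) (\<kappa>, \<gamma>) (cmpt (S_comp K H G p q) (\<kappa>, \<gamma>) z)"
      \<comment> \<open>After \<open>map_inv\<close>, the left side is g \<beta>^-1 p'(h
        \<alpha>^-1) and the right side g p(h \<alpha>^-1) \<beta>^-1, where \<beta>^-1 is taken at
        the target of \<open>h\<close> and at q' \<kappa> respectively. Naturality of the inverse of
        \<beta> at the arrow h \<alpha>^-1 equates them.\<close>
      using \<beta>.inv_natural[of "h \<cdot>\<^bsub>H\<^esub> inv_arrow H (cmpt \<alpha> \<kappa>)" "Tgt H h"]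
      by (simp add: \<alpha>.csrc \<alpha>.ctgt \<beta>.csrc \<beta>.ctgt \<beta>.F.map_inv g)
  qed (simp_all add: \<alpha>.csrc \<alpha>.ctgt \<beta>.csrc \<beta>.ctgt)
next
  case (7 G)
  then show ?case
    by (simp add: burnside_hom_isos S_biset_id biset_iso_idt biset_id_biset admissible_id_biset)
next
  case (8 L K H G r q p)
  then have g: "groupoid L" "groupoid K" "groupoid H" "groupoid G" by simp_all
  interpret qr: grpd_functor_pair L K H q r using 8 by (intro grpd_functor_pair.intro grpd_functorI) simp_all
  interpret pq: grpd_functor_pair K H G p q using 8 by (intro grpd_functor_pair.intro grpd_functorI) simp_all
  interpret pq_r: grpd_functor_pair L K G "comp_fctr K p q" r ..
  interpret p_qr: grpd_functor_pair L H G p "comp_fctr L q r" ..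
  interpret A: tensor_triple L K H G "S_biset H G p" "S_biset K H q" "S_biset L K r" ..
  interpret t: tensor_iso L K G "tensor K H G (S_biset H G p) (S_biset K H q)" "S_biset K G (comp_fctr K p q)"
    "S_biset L K r" "S_biset L K r" "S_comp K H G p q" "Idt (burnside_hom L K) (S_biset L K r)"
    by (intro tensor_iso.intro pq.biset_iso_S_comp biset_iso_idt qr.q.biset_S_biset)
  interpret t': tensor_iso L H G "S_biset H G p" "S_biset H G p" "tensor L K H (S_biset K H q) (S_biset L K r)"
    "S_biset L H (comp_fctr L q r)" "Idt (burnside_hom H G) (S_biset H G p)" "S_comp L K H q r"
    by (intro tensor_iso.intro qr.biset_iso_S_comp biset_iso_idt pq.p.biset_S_biset)
  have assoc: "comp_fctr L (comp_fctr K p q) r = comp_fctr L p (comp_fctr L q r)"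
    using 8 by (intro comp_fctr_assoc) simp_all
  interpret i: grpd_transformation L G "comp_fctr L p (comp_fctr L q r)" "comp_fctr L p (comp_fctr L q r)"
    "Idt (functor_cat L G) (comp_fctr L p (comp_fctr L q r))"
    using g by (intro grpd_transformationI functor_cat_idt p_qr.pq.functors) simp_all
  \<comment> \<open>As the associator is an identity, the law compares the images of [[g, h], k]:
    one side gives g p(h) p(q(k)), the other g p(h q(k)), and these agree because p is a
    functor.\<close>
  have *: "BAssoc Grpd L K H G p q r = Idt (functor_cat L G) (comp_fctr L p (comp_fctr L q r))"
    by (simp add: Grpd_def)
  show ?case
    unfolding psfun_simps Grpd_simps Burnside_simps *
  proof (rule burnside_cmp_eqI[of _ "tensor L K G (tensor K H G (S_biset H G p) (S_biset K H q)) (S_biset L K r)"])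
    fix l \<gamma> z assume *: "l \<in> Ob L" "\<gamma> \<in> Ob G"
      "z \<in> Val (tensor L K G (tensor K H G (S_biset H G p) (S_biset K H q)) (S_biset L K r)) (l, \<gamma>)"
    then show "cmpt (S_map L G (Idt (functor_cat L G) (comp_fctr L p (comp_fctr L q r)))) (l, \<gamma>)
        (cmpt (S_comp L K G (comp_fctr K p q) r \<cdot>\<^bsub>burnside_hom L G\<^esub>
          tensor_map L K G (S_comp K H G p q) (Idt (burnside_hom L K) (S_biset L K r))) (l, \<gamma>) z)
      = cmpt (S_comp L H G p (comp_fctr L q r)) (l, \<gamma>)
        (cmpt (tensor_map L H G (Idt (burnside_hom H G) (S_biset H G p)) (S_comp L K H q r) \<cdot>\<^bsub>burnside_hom L G\<^esub>
          burnside_assoc L K H G (S_biset H G p) (S_biset K H q) (S_biset L K r)) (l, \<gamma>) z)"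
      by (auto elim!: A.XY_Z.tensE pq.S.tensE)
  qed (simp_all add: assoc)
next
  case (9 H G p)
  then have g: "groupoid H" "groupoid G" "p \<in> functors H G" by simp_all
  interpret grpd_functor_pair H G G "id_fctr G" p
    using g by (intro grpd_functor_pair.intro grpd_functorI grpd_functor_id)
  have id_p: "comp_fctr H (id_fctr G) p = p"
    using g(3) by (rule comp_fctr_id_left)
  \<comment> \<open>Turns the factor S(id) in the source of the comparison into
    \<open>id_biset\<close>, the factor that the left unitor expects; both sides then send [g', f]
    to the composite of g' and f.\<close>
  note S_id = S_biset_id[OF g(2)]
  interpret i: grpd_transformation H G p p "Idt (functor_cat H G) p"
    using g by (intro grpd_transformationI functor_cat_idt) simp_all
  interpret t: tensor_iso H G G "id_biset G" "id_biset G" "S_biset H G p" "S_biset H G p"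
    "Idt (burnside_hom G G) (id_biset G)" "Idt (burnside_hom H G) (S_biset H G p)"
    using g by (intro tensor_iso.intro biset_iso_idt biset_id_biset q.biset_S_biset)
  have *: "BLun Grpd H G p = Idt (functor_cat H G) p"
    by (simp add: Grpd_def)
  show ?case
    unfolding psfun_simps Grpd_simps Burnside_simps *
  proof (rule biset_iso_eqI[OF biset_iso_cmp[OF biset_iso_cmp[OF t.biset_iso_tensor_map
            biset_iso_S_comp[unfolded id_p S_id]] i.biset_iso_S_map] biset_iso_lun[OF q.biset_S_biset]])
    fix \<eta> \<gamma> z assume **: "\<eta> \<in> Ob H" "\<gamma> \<in> Ob G" "z \<in> Val (tensor H G G (id_biset G) (S_biset H G p)) (\<eta>, \<gamma>)"
    then obtain g' f where z: "g' \<in> Ar G" "f \<in> Ar G" "Src G g' = Tgt G f" "Tgt G g' = \<gamma>" "Src G f = FO p \<eta>"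
      "z = tens H G G (id_biset G) (S_biset H G p) \<eta> \<gamma> (Tgt G f, g', f)"
      by (auto elim!: t.XY.tensE)
    moreover have "cmpt (S_comp H G G (id_fctr G) p) (\<eta>, \<gamma>) z = g' \<cdot>\<^bsub>G\<^esub> f"
      using z ** by (simp add: S_comp_tens[unfolded S_id])
    ultimately show "cmpt (S_map H G (Idt (functor_cat H G) p) \<cdot>\<^bsub>burnside_hom H G\<^esub>
        (S_comp H G G (id_fctr G) p \<cdot>\<^bsub>burnside_hom H G\<^esub>
         tensor_map H G G (Idt (burnside_hom G G) (id_biset G)) (Idt (burnside_hom H G) (S_biset H G p)))) (\<eta>, \<gamma>) z
      = cmpt (burnside_lun H G (S_biset H G p)) (\<eta>, \<gamma>) z"
      using ** by (simp add: burnside_lun_tens[OF q.biset_S_biset])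
  qed
next
  case (10 H G p)
  then have g: "groupoid H" "groupoid G" "p \<in> functors H G" by simp_all
  interpret grpd_functor_pair H H G p "id_fctr H"
    using g by (intro grpd_functor_pair.intro grpd_functorI grpd_functor_id)
  have p_id: "comp_fctr H p (id_fctr H) = p"
    using g(3) by (rule comp_fctr_id_right)
  note S_id = S_biset_id[OF g(1)]
  interpret i: grpd_transformation H G p p "Idt (functor_cat H G) p"
    using g by (intro grpd_transformationI functor_cat_idt) simp_all
  interpret t: tensor_iso H H G "S_biset H G p" "S_biset H G p" "id_biset H" "id_biset H"
    "Idt (burnside_hom H G) (S_biset H G p)" "Idt (burnside_hom H H) (id_biset H)"
    using g by (intro tensor_iso.intro biset_iso_idt biset_id_biset p.biset_S_biset)
  have *: "BRun Grpd H G p = Idt (functor_cat H G) p"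
    by (simp add: Grpd_def)
  show ?case
    unfolding psfun_simps Grpd_simps Burnside_simps *
  proof (rule biset_iso_eqI[OF biset_iso_cmp[OF biset_iso_cmp[OF t.biset_iso_tensor_map
            biset_iso_S_comp[unfolded p_id S_id]] i.biset_iso_S_map] biset_iso_run[OF p.biset_S_biset]])
    fix \<eta> \<gamma> z assume **: "\<eta> \<in> Ob H" "\<gamma> \<in> Ob G" "z \<in> Val (tensor H H G (S_biset H G p) (id_biset H)) (\<eta>, \<gamma>)"
    then obtain f h where z: "f \<in> Ar G" "h \<in> Ar H" "Src G f = FO p (Tgt H h)" "Tgt G f = \<gamma>" "Src H h = \<eta>"
      "z = tens H H G (S_biset H G p) (id_biset H) \<eta> \<gamma> (Tgt H h, f, h)"
      by (auto elim!: t.XY.tensE)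
    moreover have "cmpt (S_comp H H G p (id_fctr H)) (\<eta>, \<gamma>) z = f \<cdot>\<^bsub>G\<^esub> FA p h"
      using z ** by (simp add: S_comp_tens[unfolded S_id])
    ultimately show "cmpt (S_map H G (Idt (functor_cat H G) p) \<cdot>\<^bsub>burnside_hom H G\<^esub>
        (S_comp H H G p (id_fctr H) \<cdot>\<^bsub>burnside_hom H G\<^esub>
         tensor_map H H G (Idt (burnside_hom H G) (S_biset H G p)) (Idt (burnside_hom H H) (id_biset H)))) (\<eta>, \<gamma>) z
      = cmpt (burnside_run H G (S_biset H G p)) (\<eta>, \<gamma>) z"
      using ** by (simp add: burnside_run_tens[OF p.biset_S_biset])
  qed
qed

section \<open>The pseudo-functor of finite covers\<close>

lemma op_Grpd_fc_simps [simp]: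
  "BOb (op_bicat Grpd_fc) = {G. groupoid G}"
  "BHom (op_bicat Grpd_fc) G H = full_subcat (functor_cat H G) (finite_cover H G)"
  "comp1 (op_bicat Grpd_fc) G H K q p = comp_fctr K p q"
  "comp2 (op_bicat Grpd_fc) G H K \<beta> \<alpha> = comp_nat K G \<alpha> \<beta>"
  "BId (op_bicat Grpd_fc) = id_fctr"
  "BLun (op_bicat Grpd_fc) G H p = Idt (functor_cat H G) p"
  "BRun (op_bicat Grpd_fc) G H p = Idt (functor_cat H G) p"
  by (simp_all add: op_bicat_def Grpd_fc_def sub_bicat_def) (simp_all add: Grpd_def)

lemma finite_cover_functors: "finite_cover H G p \<Longrightarrow> p \<in> functors H G"
  by (simp add: finite_cover_def coverD)

text \<open>A 1-cell from G to H of the source is a finite cover from H to G, so the unit laws are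
  interchanged relative to S: the left one concerns \<open>p\<close> precomposed with the identity
  of H, the right one \<open>p\<close> followed by the identity of G.\<close>

lemma pseudofunctor_T: "pseudofunctor (op_bicat Grpd_fc) Burnside T_psfun"
proof (intro pseudofunctor.intro pseudofunctor_axioms.intro, goal_cases)
  case 1
  show ?case by (rule strict_bicategory.bicategory[OF strict_bicategory_op_Grpd_fc])
next
  case 2
  show ?case by (rule bicategory_Burnside)
next
  case 3
  then show ?case by simp
next
  case (4 G H)
  then have g: "groupoid G" "groupoid H" by simp_all
  interpret B: groupoid "burnside_hom G H" using g by (rule groupoid_burnside_hom)
  show ?case
    unfolding psfun_simps op_Grpd_fc_simps Burnside_simps
  proof (rule is_functorI, goal_cases)
    case (3 p)
    then interpret grpd_functor H G p using g by (intro grpd_functorI) simp_all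
    show ?case using 3 by (simp add: burnside_hom_ob g biset_T_biset admissible_T_biset)
  next
    case (4 \<alpha>)
    then interpret grpd_transformation H G "csrc \<alpha>" "ctgt \<alpha>" \<alpha>
      using g by (intro grpd_transformationI) simp_all
    show ?case
      using 4 by (simp add: burnside_hom_ar g biset_iso_T_map p.admissible_T_biset p'.admissible_T_biset)
  next
    case (5 p)
    then interpret grpd_transformation H G p p "Idt (functor_cat H G) p"
      using g by (intro grpd_transformationI functor_cat_idt) simp_all
    show ?case
      unfolding psfun_simps full_subcat_simps
      by (rule biset_iso_eqI[OF biset_iso_T_map biset_iso_idt[OF p.biset_T_biset]]) auto
  next
    case (6 \<alpha> \<beta>)
    interpret \<alpha>: grpd_transformation H G "csrc \<alpha>" "csrc \<beta>" \<alpha>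
      using g 6 by (intro grpd_transformationI) simp_all
    interpret \<beta>: grpd_transformation H G "csrc \<beta>" "ctgt \<beta>" \<beta>
      using g 6 by (intro grpd_transformationI) simp_all
    interpret \<beta>\<alpha>: grpd_transformation H G "csrc \<alpha>" "ctgt \<beta>" "\<beta> \<cdot>\<^bsub>functor_cat H G\<^esub> \<alpha>"
      using g 6 by (intro grpd_transformationI functor_cat_cmp) simp_all
    show ?case
      unfolding psfun_simps full_subcat_simps
      by (rule biset_iso_eqI[OF \<beta>\<alpha>.biset_iso_T_map biset_iso_cmp[OF \<alpha>.biset_iso_T_map \<beta>.biset_iso_T_map]]) auto
  qed (simp_all add: category_full_subcat category_functor_cat B.category_axioms)
next
  case (5 G H K p q)
  then have fc: "finite_cover H G p" "finite_cover K H q" by simp_all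
  interpret grpd_functor_pair K H G p q
    using 5 by (intro grpd_functor_pair.intro grpd_functorI) simp_all
  show ?case
    \<comment> \<open>The comparison ends at the bi-set of the composite, whose admissibility comes
      from the closure of finite covers under composition.\<close>
    using 5 by (simp add: burnside_hom_isos biset_iso_T_comp T.admissible_tensor p.admissible_T_biset[OF fc(1)]
        q.admissible_T_biset[OF fc(2)] pq.admissible_T_biset[OF finite_cover_comp[OF fc(2,1)]])
next
  case (6 G H K \<alpha> p p' \<beta> q q')
  then have g: "groupoid G" "groupoid H" "groupoid K" by simp_all
  interpret \<alpha>: grpd_transformation H G p p' \<alpha>
    using 6 by (intro grpd_transformationI) (simp_all add: homset_iff)
  interpret \<beta>: grpd_transformation K H q q' \<beta>
    using 6 by (intro grpd_transformationI) (simp_all add: homset_iff)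
  interpret pq: grpd_functor_pair K H G p q ..
  interpret pq': grpd_functor_pair K H G p' q' ..
  interpret \<alpha>\<beta>: grpd_transformation K G "comp_fctr K p q" "comp_fctr K p' q'" "comp_nat K G \<alpha> \<beta>"
    using g by (intro grpd_transformationI comp_nat_nat_trans[OF \<beta>.nat_trans \<alpha>.nat_trans])
      (simp_all add: \<alpha>.csrc \<alpha>.ctgt \<beta>.csrc \<beta>.ctgt)
  interpret t: tensor_iso G H K "T_biset K H q" "T_biset K H q'" "T_biset H G p" "T_biset H G p'"
    "T_map H K \<beta>" "T_map G H \<alpha>"
    by (intro tensor_iso.intro \<alpha>.biset_iso_T_map \<beta>.biset_iso_T_map)
  show ?case
    unfolding psfun_simps op_Grpd_fc_simps Burnside_simps
  proof (rule burnside_cmp_eqI[of _ "tensor G H K (T_biset K H q) (T_biset H G p)"])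
    fix \<gamma> \<kappa> z assume *: "\<gamma> \<in> Ob G" "\<kappa> \<in> Ob K" "z \<in> Val (tensor G H K (T_biset K H q) (T_biset H G p)) (\<gamma>, \<kappa>)"
    then obtain h g where hg: "h \<in> Ar H" "g \<in> Ar G" "Tgt G g = FO p (Src H h)" "Src G g = \<gamma>" "Tgt H h = FO q \<kappa>"
      "z = tens G H K (T_biset K H q) (T_biset H G p) \<gamma> \<kappa> (Src H h, h, g)"
      by (auto elim!: pq.T.tensE)
    \<comment> \<open>Naturality of \<alpha> at the composite of \<open>h\<close> with the component
      of \<beta> at \<kappa>, an arrow from the source of \<open>h\<close> to q' \<kappa>.\<close>
    have "(cmpt \<alpha> (FO q' \<kappa>) \<cdot>\<^bsub>G\<^esub> FA p (cmpt \<beta> \<kappa> \<cdot>\<^bsub>H\<^esub> h)) \<cdot>\<^bsub>G\<^esub> g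
      = (FA p' (cmpt \<beta> \<kappa> \<cdot>\<^bsub>H\<^esub> h) \<cdot>\<^bsub>G\<^esub> cmpt \<alpha> (Src H h)) \<cdot>\<^bsub>G\<^esub> g"
      using * hg by (subst \<alpha>.natural) simp_all
    with * hg show "cmpt (T_comp G H K q' p') (\<gamma>, \<kappa>) (cmpt (tensor_map G H K (T_map H K \<beta>) (T_map G H \<alpha>)) (\<gamma>, \<kappa>) z)
      = cmpt (T_map G K (comp_nat K G \<alpha> \<beta>)) (\<gamma>, \<kappa>) (cmpt (T_comp G H K q p) (\<gamma>, \<kappa>) z)"
      by (simp add: \<alpha>.csrc \<alpha>.ctgt \<beta>.csrc \<beta>.ctgt)
  qed (simp_all add: \<alpha>.csrc \<alpha>.ctgt \<beta>.csrc \<beta>.ctgt)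
next
  case (7 G)
  then show ?case
    by (simp add: burnside_hom_isos T_biset_id biset_iso_idt biset_id_biset admissible_id_biset)
next
  case (8 G H K L p q r)
  then have g: "groupoid G" "groupoid H" "groupoid K" "groupoid L" by simp_all
  interpret qr: grpd_functor_pair L K H q r using 8 by (intro grpd_functor_pair.intro grpd_functorI) simp_all
  interpret pq: grpd_functor_pair K H G p q using 8 by (intro grpd_functor_pair.intro grpd_functorI) simp_all
  interpret pq_r: grpd_functor_pair L K G "comp_fctr K p q" r ..
  interpret p_qr: grpd_functor_pair L H G p "comp_fctr L q r" ..
  interpret A: tensor_triple G H K L "T_biset L K r" "T_biset K H q" "T_biset H G p" ..
  interpret t: tensor_iso G H L "tensor H K L (T_biset L K r) (T_biset K H q)" "T_biset L H (comp_fctr L q r)"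
    "T_biset H G p" "T_biset H G p" "T_comp H K L r q" "Idt (burnside_hom G H) (T_biset H G p)"
    by (intro tensor_iso.intro qr.biset_iso_T_comp biset_iso_idt pq.p.biset_T_biset)
  interpret t': tensor_iso G K L "T_biset L K r" "T_biset L K r" "tensor G H K (T_biset K H q) (T_biset H G p)"
    "T_biset K G (comp_fctr K p q)" "Idt (burnside_hom K L) (T_biset L K r)" "T_comp G H K q p"
    by (intro tensor_iso.intro pq.biset_iso_T_comp biset_iso_idt qr.q.biset_T_biset)
  have assoc: "comp_fctr L (comp_fctr K p q) r = comp_fctr L p (comp_fctr L q r)"
    using 8 by (intro comp_fctr_assoc[of r L K q H p G]) simp_all
  interpret i: grpd_transformation L G "comp_fctr L p (comp_fctr L q r)" "comp_fctr L p (comp_fctr L q r)"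
    "Idt (functor_cat L G) (comp_fctr L p (comp_fctr L q r))"
    using g by (intro grpd_transformationI functor_cat_idt p_qr.pq.functors) simp_all
  \<comment> \<open>By definition this cell is an inverse of an associator of
    \<open>Grpd_fc\<close>; strictness of the opposite shows that it is an identity.\<close>
  have *: "BAssoc (op_bicat Grpd_fc) G H K L r q p = Idt (functor_cat L G) (comp_fctr L p (comp_fctr L q r))"
    using 8 assoc by (subst strict_bicategory.assoc_eq[OF strict_bicategory_op_Grpd_fc]) simp_all
  show ?case
    unfolding psfun_simps * op_Grpd_fc_simps Burnside_simps
  proof (rule burnside_cmp_eqI[of _ "tensor G H L (tensor H K L (T_biset L K r) (T_biset K H q)) (T_biset H G p)"])
    fix \<gamma> l z assume *: "\<gamma> \<in> Ob G" "l \<in> Ob L"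
      "z \<in> Val (tensor G H L (tensor H K L (T_biset L K r) (T_biset K H q)) (T_biset H G p)) (\<gamma>, l)"
    then show "cmpt (T_map G L (Idt (functor_cat L G) (comp_fctr L p (comp_fctr L q r)))) (\<gamma>, l)
        (cmpt (T_comp G H L (comp_fctr L q r) p \<cdot>\<^bsub>burnside_hom G L\<^esub>
          tensor_map G H L (T_comp H K L r q) (Idt (burnside_hom G H) (T_biset H G p))) (\<gamma>, l) z)
      = cmpt (T_comp G K L r (comp_fctr K p q)) (\<gamma>, l)
        (cmpt (tensor_map G K L (Idt (burnside_hom K L) (T_biset L K r)) (T_comp G H K q p) \<cdot>\<^bsub>burnside_hom G L\<^esub>
          burnside_assoc G H K L (T_biset L K r) (T_biset K H q) (T_biset H G p)) (\<gamma>, l) z)"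
      by (auto elim!: A.XY_Z.tensE qr.T.tensE)
  qed (simp_all add: assoc)
next
  case (9 G H p)
  then have g: "groupoid G" "groupoid H" "p \<in> functors H G" by simp_all
  interpret grpd_functor_pair H H G p "id_fctr H"
    using g by (intro grpd_functor_pair.intro grpd_functorI grpd_functor_id)
  have p_id: "comp_fctr H p (id_fctr H) = p"
    using g(3) by (rule comp_fctr_id_right)
  note T_id = T_biset_id[OF g(2)]
  interpret i: grpd_transformation H G p p "Idt (functor_cat H G) p"
    using g by (intro grpd_transformationI functor_cat_idt) simp_all
  interpret t: tensor_iso G H H "id_biset H" "id_biset H" "T_biset H G p" "T_biset H G p"
    "Idt (burnside_hom H H) (id_biset H)" "Idt (burnside_hom G H) (T_biset H G p)"
    using g by (intro tensor_iso.intro biset_iso_idt biset_id_biset p.biset_T_biset)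
  show ?case
    unfolding psfun_simps op_Grpd_fc_simps Burnside_simps
  proof (rule biset_iso_eqI[OF biset_iso_cmp[OF biset_iso_cmp[OF t.biset_iso_tensor_map
            biset_iso_T_comp[unfolded p_id T_id]] i.biset_iso_T_map] biset_iso_lun[OF p.biset_T_biset]])
    fix \<gamma> \<eta> z assume **: "\<gamma> \<in> Ob G" "\<eta> \<in> Ob H" "z \<in> Val (tensor G H H (id_biset H) (T_biset H G p)) (\<gamma>, \<eta>)"
    then obtain h f where z: "h \<in> Ar H" "f \<in> Ar G" "Tgt G f = FO p (Src H h)" "Src G f = \<gamma>" "Tgt H h = \<eta>"
      "z = tens G H H (id_biset H) (T_biset H G p) \<gamma> \<eta> (Src H h, h, f)"
      by (auto elim!: t.XY.tensE)
    moreover have "cmpt (T_comp G H H (id_fctr H) p) (\<gamma>, \<eta>) z = FA p h \<cdot>\<^bsub>G\<^esub> f"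
      using z ** by (simp add: T_comp_tens[unfolded T_id])
    ultimately show "cmpt (T_map G H (Idt (functor_cat H G) p) \<cdot>\<^bsub>burnside_hom G H\<^esub>
        (T_comp G H H (id_fctr H) p \<cdot>\<^bsub>burnside_hom G H\<^esub>
         tensor_map G H H (Idt (burnside_hom H H) (id_biset H)) (Idt (burnside_hom G H) (T_biset H G p)))) (\<gamma>, \<eta>) z
      = cmpt (burnside_lun G H (T_biset H G p)) (\<gamma>, \<eta>) z"
      using ** by (simp add: burnside_lun_tens[OF p.biset_T_biset])
  qed
next
  case (10 G H p)
  then have g: "groupoid G" "groupoid H" "p \<in> functors H G" by simp_all
  interpret grpd_functor_pair H G G "id_fctr G" p
    using g by (intro grpd_functor_pair.intro grpd_functorI grpd_functor_id)
  have id_p: "comp_fctr H (id_fctr G) p = p"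
    using g(3) by (rule comp_fctr_id_left)
  note T_id = T_biset_id[OF g(1)]
  interpret i: grpd_transformation H G p p "Idt (functor_cat H G) p"
    using g by (intro grpd_transformationI functor_cat_idt) simp_all
  interpret t: tensor_iso G G H "T_biset H G p" "T_biset H G p" "id_biset G" "id_biset G"
    "Idt (burnside_hom G H) (T_biset H G p)" "Idt (burnside_hom G G) (id_biset G)"
    using g by (intro tensor_iso.intro biset_iso_idt biset_id_biset q.biset_T_biset)
  show ?case
    unfolding psfun_simps op_Grpd_fc_simps Burnside_simps
  proof (rule biset_iso_eqI[OF biset_iso_cmp[OF biset_iso_cmp[OF t.biset_iso_tensor_map
            biset_iso_T_comp[unfolded id_p T_id]] i.biset_iso_T_map] biset_iso_run[OF q.biset_T_biset]])
    fix \<gamma> \<eta> z assume **: "\<gamma> \<in> Ob G" "\<eta> \<in> Ob H" "z \<in> Val (tensor G G H (T_biset H G p) (id_biset G)) (\<gamma>, \<eta>)"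
    then obtain f g' where z: "f \<in> Ar G" "g' \<in> Ar G" "Src G f = Tgt G g'" "Tgt G f = FO p \<eta>" "Src G g' = \<gamma>"
      "z = tens G G H (T_biset H G p) (id_biset G) \<gamma> \<eta> (Tgt G g', f, g')"
      by (auto elim!: t.XY.tensE)
    moreover have "cmpt (T_comp G G H p (id_fctr G)) (\<gamma>, \<eta>) z = f \<cdot>\<^bsub>G\<^esub> g'"
      using z ** by (simp add: T_comp_tens[unfolded T_id])
    ultimately show "cmpt (T_map G H (Idt (functor_cat H G) p) \<cdot>\<^bsub>burnside_hom G H\<^esub>
        (T_comp G G H p (id_fctr G) \<cdot>\<^bsub>burnside_hom G H\<^esub>
         tensor_map G G H (Idt (burnside_hom G H) (T_biset H G p)) (Idt (burnside_hom G G) (id_biset G)))) (\<gamma>, \<eta>) z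
      = cmpt (burnside_run G H (T_biset H G p)) (\<gamma>, \<eta>) z"
      using ** by (simp add: burnside_run_tens[OF q.biset_T_biset])
  qed
qed

theorem mainTheorem4:
  shows "(\<exists>S :: ('u::infinite grpd, 'u gfun, 'u gnat, 'u grpd, 'u biset, 'u biset_map) psfun.
    pseudofunctor Grpd Burnside S \<and>
    (\<forall>G. groupoid G \<longrightarrow> PO S G = G) \<and>
    (\<forall>H G p. groupoid H \<and> groupoid G \<and> p \<in> functors H G \<longrightarrow> P1 S H G p = S_biset H G p) \<and>
    (\<forall>H G \<alpha> \<eta> \<gamma> f. groupoid H \<and> groupoid G \<and> \<alpha> \<in> nat_trans H G \<and> \<eta> \<in> Ob H \<and> \<gamma> \<in> Ob G \<and>
       f \<in> homset G (FO (csrc \<alpha>) \<eta>) \<gamma> \<longrightarrow>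
       cmpt (P2 S H G \<alpha>) (\<eta>, \<gamma>) f = f \<cdot>\<^bsub>G\<^esub> inv_arrow G (cmpt \<alpha> \<eta>)) \<and>
    (\<forall>K H G p q \<kappa> \<gamma> \<eta> g h. groupoid K \<and> groupoid H \<and> groupoid G \<and>
       q \<in> functors K H \<and> p \<in> functors H G \<and> \<kappa> \<in> Ob K \<and> \<gamma> \<in> Ob G \<and> \<eta> \<in> Ob H \<and>
       g \<in> homset G (FO p \<eta>) \<gamma> \<and> h \<in> homset H (FO q \<kappa>) \<eta> \<longrightarrow>
       cmpt (PComp S K H G p q) (\<kappa>, \<gamma>)
         (tens K H G (S_biset H G p) (S_biset K H q) \<kappa> \<gamma> (\<eta>, g, h)) = g \<cdot>\<^bsub>G\<^esub> FA p h)) \<and>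
   (\<exists>T :: ('u::infinite grpd, 'u gfun, 'u gnat, 'u grpd, 'u biset, 'u biset_map) psfun.
    pseudofunctor (op_bicat Grpd_fc) Burnside T \<and>
    (\<forall>G. groupoid G \<longrightarrow> PO T G = G) \<and>
    (\<forall>H G p. groupoid H \<and> groupoid G \<and> finite_cover H G p \<longrightarrow> P1 T G H p = T_biset H G p) \<and>
    (\<forall>H G \<alpha> \<gamma> \<eta> f. groupoid H \<and> groupoid G \<and> \<alpha> \<in> nat_trans H G \<and>
       finite_cover H G (csrc \<alpha>) \<and> finite_cover H G (ctgt \<alpha>) \<and> \<gamma> \<in> Ob G \<and> \<eta> \<in> Ob H \<and>
       f \<in> homset G \<gamma> (FO (csrc \<alpha>) \<eta>) \<longrightarrow>
       cmpt (P2 T G H \<alpha>) (\<gamma>, \<eta>) f = cmpt \<alpha> \<eta> \<cdot>\<^bsub>G\<^esub> f) \<and>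
    (\<forall>K H G p q \<gamma> \<kappa> \<eta> h g. groupoid K \<and> groupoid H \<and> groupoid G \<and>
       finite_cover K H q \<and> finite_cover H G p \<and> \<gamma> \<in> Ob G \<and> \<kappa> \<in> Ob K \<and> \<eta> \<in> Ob H \<and>
       h \<in> homset H \<eta> (FO q \<kappa>) \<and> g \<in> homset G \<gamma> (FO p \<eta>) \<longrightarrow>
       cmpt (PComp T G H K q p) (\<gamma>, \<kappa>)
         (tens G H K (T_biset K H q) (T_biset H G p) \<gamma> \<kappa> (\<eta>, h, g)) = FA p h \<cdot>\<^bsub>G\<^esub> g))"
\<comment> \<open>The explicit formulas for 2-cells and comparisons are the computation rules of
  \<open>grpd_transformation\<close> and \<open>grpd_functor_pair\<close>, read on the two
  witnesses; the remaining conjuncts hold by the construction of the witnesses and the two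
  pseudo-functor results.\<close>
proof (rule conjI[OF exI[of _ S_psfun] exI[of _ T_psfun]]; intro conjI allI impI; (elim conjE)?)
  fix H G :: "'u grpd" and \<alpha> \<eta> \<gamma> f
  assume *: "groupoid H" "groupoid G" "\<alpha> \<in> nat_trans H G" "\<eta> \<in> Ob H" "\<gamma> \<in> Ob G"
    "f \<in> homset G (FO (csrc \<alpha>) \<eta>) \<gamma>"
  then interpret grpd_transformation H G "csrc \<alpha>" "ctgt \<alpha>" \<alpha>
    by (intro grpd_transformationI) simp_all
  show "cmpt (P2 S_psfun H G \<alpha>) (\<eta>, \<gamma>) f = f \<cdot>\<^bsub>G\<^esub> inv_arrow G (cmpt \<alpha> \<eta>)"
    using * by (simp add: homset_iff)
next
  fix K H G :: "'u grpd" and p q \<kappa> \<gamma> \<eta> g h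
  assume *: "groupoid K" "groupoid H" "groupoid G" "q \<in> functors K H" "p \<in> functors H G"
    "\<kappa> \<in> Ob K" "\<gamma> \<in> Ob G" "\<eta> \<in> Ob H" "g \<in> homset G (FO p \<eta>) \<gamma>" "h \<in> homset H (FO q \<kappa>) \<eta>"
  then interpret grpd_functor_pair K H G p q
    by (intro grpd_functor_pair.intro grpd_functorI)
  show "cmpt (PComp S_psfun K H G p q) (\<kappa>, \<gamma>)
      (tens K H G (S_biset H G p) (S_biset K H q) \<kappa> \<gamma> (\<eta>, g, h)) = g \<cdot>\<^bsub>G\<^esub> FA p h"
    using * by (simp add: homset_iff)
next
  fix H G :: "'u grpd" and \<alpha> \<gamma> \<eta> f
  assume *: "groupoid H" "groupoid G" "\<alpha> \<in> nat_trans H G" "\<gamma> \<in> Ob G" "\<eta> \<in> Ob H"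
    "f \<in> homset G \<gamma> (FO (csrc \<alpha>) \<eta>)"
  then interpret grpd_transformation H G "csrc \<alpha>" "ctgt \<alpha>" \<alpha>
    by (intro grpd_transformationI) simp_all
  show "cmpt (P2 T_psfun G H \<alpha>) (\<gamma>, \<eta>) f = cmpt \<alpha> \<eta> \<cdot>\<^bsub>G\<^esub> f"
    using * by (simp add: homset_iff)
next
  fix K H G :: "'u grpd" and p q \<gamma> \<kappa> \<eta> h g
  assume *: "groupoid K" "groupoid H" "groupoid G" "finite_cover K H q" "finite_cover H G p"
    "\<gamma> \<in> Ob G" "\<kappa> \<in> Ob K" "\<eta> \<in> Ob H" "h \<in> homset H \<eta> (FO q \<kappa>)" "g \<in> homset G \<gamma> (FO p \<eta>)"
  then interpret grpd_functor_pair K H G p q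
    by (intro grpd_functor_pair.intro grpd_functorI finite_cover_functors)
  show "cmpt (PComp T_psfun G H K q p) (\<gamma>, \<kappa>)
      (tens G H K (T_biset K H q) (T_biset H G p) \<gamma> \<kappa> (\<eta>, h, g)) = FA p h \<cdot>\<^bsub>G\<^esub> g"
    using * by (simp add: homset_iff)
qed (simp_all add: pseudofunctor_S pseudofunctor_T)

end
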